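(* Let $E/\mathbb{Q}$ be an elliptic curve with $E(\mathbb{Q})[2]\cong\mathbb{Z}/2\mathbb{Z}$, given by $y^2=x(x^2+ax+b)$ with $a,b\in\mathbb{Z}$, with discriminant $\Delta_E$ of this model, and let $d\in\mathcal{D}_{E/\mathbb{Q}}$. Then, as subgroups of $\mathbb{Q}^\times/\mathbb{Q}^{\times2}$: (i) If $b<0$ (hence $\Delta_E>0$), then $\mathrm{Sel}^\varphi(E/\mathbb{Q})=\mathrm{Sel}^\varphi(E^{-d}/\mathbb{Q})$. (ii) If $\Delta_E<0$ and $b>0$, then $\mathrm{Sel}^\varphi(E/\mathbb{Q})=\mathrm{Sel}^\varphi_{\mathcal{S}_d}(E/\mathbb{Q})\cap\bigcap_{q\mid d}\ker(\lambda_q)$ and $\mathrm{Sel}^\varphi(E^{-d}/\mathbb{Q})=\mathrm{Sel}^\varphi_{\mathcal{S}_d}(E/\mathbb{Q})$. (iii) If $\Delta_E>0$, $b>0$, $a<0$, then $\mathrm{Sel}^\varphi(E/\mathbb{Q})=\mathrm{Sel}^\varphi_{\mathcal{S}_d}(E/\mathbb{Q})\cap\bigcap_{q\mid d}\ker(\lambda_q)$ and $\mathrm{Sel}^\varphi(E^{-d}/\mathbb{Q})=\mathrm{Sel}^\varphi_{\mathcal{S}_d}(E/\mathbb{Q})^+\cap\bigcap_{q\in\mathcal{T}_d^+}\ker(\gamma_q)\cap\bigcap_{q\in\mathcal{T}_d^-}\ker(\gamma_q+\lambda_q)$. (iv) If $\Delta_E>0$, $b>0$, $a>0$, then $\mathrm{Sel}^\varphi(E/\mathbb{Q})=\mathrm{Sel}^\varphi_{\mathcal{S}_d}(E/\mathbb{Q})^+\cap\bigcap_{q\mid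 d}\ker(\lambda_q)$ and $\mathrm{Sel}^\varphi(E^{-d}/\mathbb{Q})=\mathrm{Sel}^\varphi_{\mathcal{S}_d}(E/\mathbb{Q})\cap\bigcap_{q\in\mathcal{T}_d^+}\ker(\gamma_q)\cap\bigcap_{q\in\mathcal{T}_d^-}\ker(\gamma_q+\lambda_q)$.
   Context: $N_E$ is the conductor of $E$. $\varphi:E\to E'$ is the $2$-isogeny with kernel $\langle(0,0)\rangle$, $E':y^2=x(x^2-2ax+a^2-4b)$. For squarefree $d$, $E^{d}:y^2=x(x^2+adx+bd^2)$ with $\varphi:E^d\to(E^d)'$ its $2$-isogeny with kernel generated by $(0,0)$. For $F=\mathbb{Q}$ or $\mathbb{Q}_v$, $E[\varphi]$ and $E^{-d}[\varphi]$ are identified with $\mu_2$ via $(0,0)\mapsto-1$, so $H^1(F,E[\varphi])\cong H^1(F,E^{-d}[\varphi])\cong F^\times/F^{\times2}$. $\mathcal{L}_{\varphi,v}(E)$ is the image of the local Kummer map $E'(\mathbb{Q}_v)/\varphi(E(\mathbb{Q}_v))\to\mathbb{Q}_v^\times/\mathbb{Q}_v^{\times2}$ (similarly for $E^{-d}$), and $\mathrm{Sel}^\varphi(E/\mathbb{Q})$ is the set of $\alpha\in\mathbb{Q}^\times/\mathbb{Q}^{\times2}$ whose image in $\mathbb{Q}_v^\times/\mathbb{Q}_v^{\times2}$ lies in $\mathcal{L}_{\varphi,v}(E)$ for all places $v$ (similarly for $E^{-d}$). $\mathrm{Sel}^\varphi_{\mathcal{S}_d}(E/\mathbb{Q})$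 is the set of $\alpha$ satisfying these conditions only for the finite primes $v\nmid d$ (no condition at primes dividing $d$ or at $\infty$). For a subgroup $V\subseteq\mathbb{Q}^\times/\mathbb{Q}^{\times2}$, $V^+$ is the subgroup of classes with a positive representative. For a prime $p$ and $\alpha\in\mathbb{Q}^\times/\mathbb{Q}^{\times2}$ written $\alpha=p^{v_p(\alpha)}u_\alpha$ with $p\nmid u_\alpha$: $\lambda_p(\alpha)=v_p(\alpha)\bmod 2\in\mathbb{F}_2$, and $\gamma_p(\alpha)=0$ if $\left(\frac{u_\alpha}{p}\right)=1$, $=1$ if $\left(\frac{u_\alpha}{p}\right)=-1$. $\mathcal{D}_{E/\mathbb{Q}}$ is the set of products of an odd number $r\ge1$ of distinct primes $q$ such that every prime $v\mid 2N_E$ splits in $\mathbb{Q}(\sqrt{-q})$. When $b>0,\Delta_E>0$: for each prime $q\mid d$ fix a root $\beta\in\mathbb{Z}_q^\times$ of $x^2-2ax+(a^2-4b)$ (which splits over $\mathbb{Q}_q$), put $d_q=d/q$, and let $\mathcal{T}_d^+=\{q\mid d:\left(\frac{d_q}{q}\right)\ne(\beta,q)_q\}$, $\mathcal{T}_d^-=\{q\mid d:\left(\frac{d_q}{q}\right)=(\beta,q)_q\}$, where $(\cdot,\cdot)_q$ is the quadratic Hilbert symbol. *)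

theory Defs
  imports
    "HOL-Algebra.Algebra"
    "HOL-Algebra.Algebraic_Closure"
    "HOL-Algebra.Algebraic_Closure_Type"
    "HOL-Algebra.Ideal_Product"
    "HOL-Algebra.Elementary_Groups"
    "HOL-Number_Theory.Number_Theory"
    "HOL-Library.Z2"
    "HOL-Analysis.Analysis"
begin

section \<open>The fields \<open>\<rat>\<close>, \<open>\<real>\<close> and \<open>\<rat>\<^sub>p\<close>\<close>

abbreviation rat_field :: "rat ring"
  where "rat_field \<equiv> ring_of_type_algebra"

abbreviation real_field :: "real ring"
  where "real_field \<equiv> ring_of_type_algebra"

text \<open>The value at \<open>0\<close> is a dummy; it is never relied upon below.\<close>

definition padic_val :: "nat \<Rightarrow> rat \<Rightarrow> int"
  where "padic_val p x =
    int (multiplicity (int p) (fst (quotient_of x))) - int (multiplicity (int p) (snd (quotient_of x)))"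

definition padic_abs :: "nat \<Rightarrow> rat \<Rightarrow> real"
  where "padic_abs p x = (if x = 0 then 0 else real p powi (- padic_val p x))"

text \<open>\<open>\<rat>\<^sub>p\<close> is the completion of \<open>\<rat>\<close>: Cauchy sequences of rationals for the \<open>p\<close>-adic absolute
  value, modulo the ideal of null sequences.\<close>

definition padic_cauchy_ring :: "nat \<Rightarrow> (nat \<Rightarrow> rat) ring"
  where "padic_cauchy_ring p =
    \<lparr> carrier = {s. \<forall>e>0. \<exists>N. \<forall>m\<ge>N. \<forall>n\<ge>N. padic_abs p (s m - s n) < e},
      monoid.mult = (\<lambda>s t n. s n * t n),
      one = (\<lambda>_. 1),
      ring.zero = (\<lambda>_. 0),
      add = (\<lambda>s t n. s n + t n) \<rparr>"

definition padic_null_ideal :: "nat \<Rightarrow> (nat \<Rightarrow> rat) set"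
  where "padic_null_ideal p =
    {s \<in> carrier (padic_cauchy_ring p). (\<lambda>n. padic_abs p (s n)) \<longlonglongrightarrow> 0}"

definition padic_field :: "nat \<Rightarrow> (nat \<Rightarrow> rat) set ring"
  where "padic_field p = padic_cauchy_ring p Quot padic_null_ideal p"

definition padic_of_rat :: "nat \<Rightarrow> rat \<Rightarrow> (nat \<Rightarrow> rat) set"
  where "padic_of_rat p x = padic_null_ideal p +>\<^bsub>padic_cauchy_ring p\<^esub> (\<lambda>_. x)"


section \<open>Square classes\<close>

definition unit_squares :: "('k, 'm) ring_scheme \<Rightarrow> 'k set"
  where "unit_squares K = {x \<otimes>\<^bsub>K\<^esub> x | x. x \<in> Units K}"

definition square_classes :: "('k, 'm) ring_scheme \<Rightarrow> 'k set monoid"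
  where "square_classes K = units_of K Mod unit_squares K"

text \<open>The homomorphism \<open>\<rat>\<^sup>\<times>/\<rat>\<^sup>\<times>\<^sup>2 \<rightarrow> K\<^sup>\<times>/K\<^sup>\<times>\<^sup>2\<close> induced by an embedding \<open>f\<close> of \<open>\<rat>\<close> into \<open>K\<close>.\<close>

definition localize_class :: "('k, 'm) ring_scheme \<Rightarrow> (rat \<Rightarrow> 'k) \<Rightarrow> rat set \<Rightarrow> 'k set"
  where "localize_class K f C = unit_squares K <#>\<^bsub>units_of K\<^esub> f ` C"

definition positive_classes :: "rat set set \<Rightarrow> rat set set"
  where "positive_classes V = {C \<in> V. \<exists>\<alpha>\<in>C. \<alpha> > 0}"

text \<open>The functions below are constant on square classes, hence the use of \<open>the_elem\<close>.\<close>

definition lambda_val :: "nat \<Rightarrow> rat set \<Rightarrow> bit"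
  where "lambda_val p C = the_elem ((\<lambda>\<alpha>. of_int (padic_val p \<alpha>)) ` C)"

definition rat_Legendre :: "rat \<Rightarrow> nat \<Rightarrow> int"
  where "rat_Legendre u p =
    Legendre (fst (quotient_of u)) (int p) * Legendre (snd (quotient_of u)) (int p)"

definition gamma_val :: "nat \<Rightarrow> rat set \<Rightarrow> bit"
  where "gamma_val p C = the_elem ((\<lambda>\<alpha>.
    if rat_Legendre (\<alpha> / of_nat p powi padic_val p \<alpha>) p = 1 then 0 else 1) ` C)"

definition class_ker :: "(rat set \<Rightarrow> bit) \<Rightarrow> rat set set"
  where "class_ker f = {C \<in> carrier (square_classes rat_field). f C = 0}"


section \<open>The curves \<open>y\<^sup>2 = x (x\<^sup>2 + a x + b)\<close> over a field and their \<open>2\<close>-isogenies\<close>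

datatype 'k point = Infinity | Affine 'k 'k

context
  fixes K :: "('k, 'm) ring_scheme" (structure)
begin

definition points :: "'k \<Rightarrow> 'k \<Rightarrow> 'k point set"
  where "points a b = insert Infinity
    {Affine x y | x y. x \<in> carrier K \<and> y \<in> carrier K \<and> y \<otimes> y = x \<otimes> (x \<otimes> x \<oplus> a \<otimes> x \<oplus> b)}"

fun point_neg :: "'k point \<Rightarrow> 'k point"
  where
    "point_neg Infinity = Infinity"
  | "point_neg (Affine x y) = Affine x (\<ominus> y)"

fun point_add :: "'k \<Rightarrow> 'k \<Rightarrow> 'k point \<Rightarrow> 'k point \<Rightarrow> 'k point"
  where
    "point_add a b Infinity Q = Q"
  | "point_add a b P Infinity = P"
  | "point_add a b (Affine x1 y1) (Affine x2 y2) =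
      (if x1 = x2 \<and> y1 = \<ominus> y2 then Infinity
       else let m = (if x1 = x2
                     then ([(3::nat)] \<cdot> (x1 \<otimes> x1) \<oplus> [(2::nat)] \<cdot> (a \<otimes> x1) \<oplus> b) \<otimes> inv ([(2::nat)] \<cdot> y1)
                     else (y2 \<ominus> y1) \<otimes> inv (x2 \<ominus> x1));
                x3 = m \<otimes> m \<ominus> a \<ominus> x1 \<ominus> x2
            in Affine x3 (\<ominus> (y1 \<oplus> m \<otimes> (x3 \<ominus> x1))))"

definition point_group :: "'k \<Rightarrow> 'k \<Rightarrow> 'k point monoid"
  where "point_group a b = \<lparr> carrier = points a b, monoid.mult = point_add a b, one = Infinity \<rparr>"

definition two_torsion_group :: "'k \<Rightarrow> 'k \<Rightarrow> 'k point monoid"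
  where "two_torsion_group a b =
    (point_group a b) \<lparr> carrier := {P \<in> points a b. point_add a b P P = Infinity} \<rparr>"

text \<open>\<open>E' : y\<^sup>2 = x (x\<^sup>2 - 2 a x + a\<^sup>2 - 4 b)\<close>\<close>

definition isog_a :: "'k \<Rightarrow> 'k"
  where "isog_a a = \<ominus> ([(2::nat)] \<cdot> a)"

definition isog_b :: "'k \<Rightarrow> 'k \<Rightarrow> 'k"
  where "isog_b a b = a \<otimes> a \<ominus> [(4::nat)] \<cdot> b"

text \<open>\<open>\<phi> : E \<rightarrow> E'\<close> sends \<open>(x, y)\<close> to \<open>(y\<^sup>2/x\<^sup>2, y (b - x\<^sup>2)/x\<^sup>2)\<close>, with kernel generated by \<open>(0,0)\<close>.\<close>

fun isogeny :: "'k \<Rightarrow> 'k point \<Rightarrow> 'k point"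
  where
    "isogeny b Infinity = Infinity"
  | "isogeny b (Affine x y) =
      (if x = \<zero> then Infinity
       else Affine (y \<otimes> y \<otimes> inv (x \<otimes> x)) (y \<otimes> (b \<ominus> x \<otimes> x) \<otimes> inv (x \<otimes> x)))"

text \<open>The identification \<open>E[\<phi>] = {O, (0,0)} \<rightarrow> \<mu>\<^sub>2\<close>.\<close>

definition mu2_of :: "'k point \<Rightarrow> 'k"
  where "mu2_of P = (if P = Infinity then \<one> else \<ominus> \<one>)"

definition hilbert_symbol :: "'k \<Rightarrow> 'k \<Rightarrow> int"
  where "hilbert_symbol u v =
    (if \<exists>x\<in>carrier K. \<exists>y\<in>carrier K. \<exists>z\<in>carrier K. (x, y, z) \<noteq> (\<zero>, \<zero>, \<zero>) \<and>
          z \<otimes> z = u \<otimes> (x \<otimes> x) \<oplus> v \<otimes> (y \<otimes> y)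
     then 1 else - 1)"

end


section \<open>The Kummer map and Selmer groups\<close>

definition relative_auts :: "('l, 'm) ring_scheme \<Rightarrow> 'l set \<Rightarrow> 'l set \<Rightarrow> ('l \<Rightarrow> 'l) set"
  where "relative_auts M F L =
    {\<sigma> \<in> ring_iso (M\<lparr>carrier := L\<rparr>) (M\<lparr>carrier := L\<rparr>). \<forall>x\<in>F. \<sigma> x = x}"

definition finite_galois :: "('l, 'm) ring_scheme \<Rightarrow> 'l set \<Rightarrow> 'l set \<Rightarrow> bool"
  where "finite_galois M F L \<longleftrightarrow>
    subfield F M \<and> subfield L M \<and> F \<subseteq> L \<and> ring.finite_dimension M F L \<and>
    {x \<in> L. \<forall>\<sigma>\<in>relative_auts M F L. \<sigma> x = x} = F"

text \<open>\<open>kummer_map K a b P\<close> is the class in \<open>K\<^sup>\<times>/K\<^sup>\<times>\<^sup>2\<close> attached to \<open>P \<in> E'(K)\<close> by the connecting map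
  \<open>E'(K) \<rightarrow> H\<^sup>1(K, E[\<phi>]) \<cong> H\<^sup>1(K, \<mu>\<^sub>2) \<cong> K\<^sup>\<times>/K\<^sup>\<times>\<^sup>2\<close>, as the coset of all its representatives.
  If \<open>\<phi>(Q) = P\<close>, the connecting map gives the cocycle \<open>\<sigma> \<mapsto> \<sigma>(Q) - Q\<close>, and Kummer theory attaches
  to \<open>\<alpha> = s\<^sup>2\<close> the cocycle \<open>\<sigma> \<mapsto> \<sigma>(s)/s\<close>. The Galois action on \<open>\<mu>\<^sub>2\<close> is trivial, so all coboundaries
  vanish and cohomologous cocycles are equal. Continuous cohomology is the direct limit over the
  finite Galois extensions \<open>L\<close> of \<open>K\<close> inside an algebraic closure \<open>M\<close>.\<close>

definition kummer_map :: "('k, 'm) ring_scheme \<Rightarrow> 'k \<Rightarrow> 'k \<Rightarrow> 'k point \<Rightarrow> 'k set"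
  where "kummer_map K a b P =
    (let M = field.alg_closure K; \<iota> = ring.indexed_const K; F = \<iota> ` carrier K in
     {\<alpha> \<in> Units K. \<exists>L Q s.
        finite_galois M F L \<and>
        Q \<in> points (M\<lparr>carrier := L\<rparr>) (\<iota> a) (\<iota> b) \<and> isogeny M (\<iota> b) Q = map_point \<iota> P \<and>
        s \<in> L \<and> s \<otimes>\<^bsub>M\<^esub> s = \<iota> \<alpha> \<and>
        (\<forall>\<sigma>\<in>relative_auts M F L.
           \<sigma> s \<otimes>\<^bsub>M\<^esub> inv\<^bsub>M\<^esub> s =
           mu2_of M (point_add M (\<iota> a) (\<iota> b) (map_point \<sigma> Q) (point_neg M Q)))})"

definition local_image :: "('k, 'm) ring_scheme \<Rightarrow> 'k \<Rightarrow> 'k \<Rightarrow> 'k set set"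
  where "local_image K a b = kummer_map K a b ` points K (isog_a K a) (isog_b K a b)"

definition local_condition ::
    "('k, 'm) ring_scheme \<Rightarrow> (rat \<Rightarrow> 'k) \<Rightarrow> int \<Rightarrow> int \<Rightarrow> rat set \<Rightarrow> bool"
  where "local_condition K f a b C \<longleftrightarrow>
    localize_class K f C \<in> local_image K (f (of_int a)) (f (of_int b))"

definition selmer :: "int \<Rightarrow> int \<Rightarrow> rat set set"
  where "selmer a b = {C \<in> carrier (square_classes rat_field).
    local_condition real_field of_rat a b C \<and>
    (\<forall>p. Factorial_Ring.prime p \<longrightarrow> local_condition (padic_field p) (padic_of_rat p) a b C)}"

definition relaxed_selmer :: "nat \<Rightarrow> int \<Rightarrow> int \<Rightarrow> rat set set"
  where "relaxed_selmer d a b = {C \<in> carrier (square_classes rat_field).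
    \<forall>p. Factorial_Ring.prime p \<and> \<not> p dvd d \<longrightarrow> local_condition (padic_field p) (padic_of_rat p) a b C}"

text \<open>The Selmer group of \<open>E\<^sup>d : y\<^sup>2 = x (x\<^sup>2 + a d x + b d\<^sup>2)\<close>.\<close>

definition twist_selmer :: "int \<Rightarrow> int \<Rightarrow> int \<Rightarrow> rat set set"
  where "twist_selmer d a b = selmer (a * d) (b * d\<^sup>2)"


section \<open>Weierstrass equations over \<open>\<rat>\<close> and the conductor\<close>

text \<open>\<open>y\<^sup>2 + a\<^sub>1 x y + a\<^sub>3 y = x\<^sup>3 + a\<^sub>2 x\<^sup>2 + a\<^sub>4 x + a\<^sub>6\<close>\<close>

datatype weierstrass = Weierstrass (wa1: rat) (wa2: rat) (wa3: rat) (wa4: rat) (wa6: rat)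

definition wb2 :: "weierstrass \<Rightarrow> rat"
  where "wb2 E = (wa1 E)\<^sup>2 + 4 * wa2 E"

definition wb4 :: "weierstrass \<Rightarrow> rat"
  where "wb4 E = 2 * wa4 E + wa1 E * wa3 E"

definition wb6 :: "weierstrass \<Rightarrow> rat"
  where "wb6 E = (wa3 E)\<^sup>2 + 4 * wa6 E"

definition wb8 :: "weierstrass \<Rightarrow> rat"
  where "wb8 E = (wa1 E)\<^sup>2 * wa6 E + 4 * wa2 E * wa6 E - wa1 E * wa3 E * wa4 E
    + wa2 E * (wa3 E)\<^sup>2 - (wa4 E)\<^sup>2"

definition wc4 :: "weierstrass \<Rightarrow> rat"
  where "wc4 E = (wb2 E)\<^sup>2 - 24 * wb4 E"

definition discriminant :: "weierstrass \<Rightarrow> rat"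
  where "discriminant E = - (wb2 E)\<^sup>2 * wb8 E - 8 * wb4 E ^ 3 - 27 * (wb6 E)\<^sup>2
    + 9 * wb2 E * wb4 E * wb6 E"

definition curve :: "int \<Rightarrow> int \<Rightarrow> weierstrass"
  where "curve a b = Weierstrass 0 (of_int a) 0 (of_int b) 0"

lemma discriminant_curve:
  "discriminant (curve a b) = of_int (16 * b\<^sup>2 * (a\<^sup>2 - 4 * b))"
  by (simp add: discriminant_def wb2_def wb4_def wb6_def wb8_def curve_def
      power2_eq_square power3_eq_cube algebra_simps)

text \<open>The change of variables \<open>x = u\<^sup>2 x' + r\<close>, \<open>y = u\<^sup>3 y' + s u\<^sup>2 x' + t\<close>.\<close>

definition weierstrass_iso :: "weierstrass \<Rightarrow> weierstrass \<Rightarrow> bool"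
  where "weierstrass_iso E E' \<longleftrightarrow> (\<exists>u r s t. u \<noteq> 0 \<and>
    u * wa1 E' = wa1 E + 2 * s \<and>
    u ^ 2 * wa2 E' = wa2 E - s * wa1 E + 3 * r - s\<^sup>2 \<and>
    u ^ 3 * wa3 E' = wa3 E + r * wa1 E + 2 * t \<and>
    u ^ 4 * wa4 E' = wa4 E - s * wa3 E + 2 * r * wa2 E - (t + r * s) * wa1 E + 3 * r\<^sup>2 - 2 * s * t \<and>
    u ^ 6 * wa6 E' = wa6 E + r * wa4 E + r\<^sup>2 * wa2 E + r ^ 3 - t * wa3 E - t\<^sup>2 - r * t * wa1 E)"

text \<open>Divisibility by \<open>p\<^sup>n\<close> in the localization \<open>\<int>\<^sub>(\<^sub>p\<^sub>)\<close>.\<close>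

definition ppow_dvd :: "nat \<Rightarrow> nat \<Rightarrow> rat \<Rightarrow> bool"
  where "ppow_dvd p n x \<longleftrightarrow> x = 0 \<or> int n \<le> padic_val p x"

definition integral_at :: "nat \<Rightarrow> weierstrass \<Rightarrow> bool"
  where "integral_at p E \<longleftrightarrow> ppow_dvd p 0 (wa1 E) \<and> ppow_dvd p 0 (wa2 E) \<and>
    ppow_dvd p 0 (wa3 E) \<and> ppow_dvd p 0 (wa4 E) \<and> ppow_dvd p 0 (wa6 E)"

definition min_disc_exponent :: "nat \<Rightarrow> weierstrass \<Rightarrow> nat"
  where "min_disc_exponent p E = (LEAST n. \<exists>E'. weierstrass_iso E E' \<and> integral_at p E' \<and>
    padic_val p (discriminant E') = int n)"

definition minimal_model :: "nat \<Rightarrow> weierstrass \<Rightarrow> weierstrass \<Rightarrow> bool"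
  where "minimal_model p E E' \<longleftrightarrow> weierstrass_iso E E' \<and> integral_at p E' \<and>
    padic_val p (discriminant E') = int (min_disc_exponent p E)"

definition good_reduction :: "nat \<Rightarrow> weierstrass \<Rightarrow> bool"
  where "good_reduction p E \<longleftrightarrow> min_disc_exponent p E = 0"

definition multiplicative_reduction :: "nat \<Rightarrow> weierstrass \<Rightarrow> bool"
  where "multiplicative_reduction p E \<longleftrightarrow>
    \<not> good_reduction p E \<and> (\<exists>E'. minimal_model p E E' \<and> \<not> ppow_dvd p 1 (wc4 E'))"

text \<open>\<open>additive_components p E m\<close>: the \<open>p\<close>-minimal equation \<open>E\<close> is in one of the terminal normal forms
  of Tate's algorithm for additive reduction, and \<open>m\<close> is the number of geometric components of the
  special fibre for the corresponding Kodaira type. For example, in the form for \<open>I\<^sub>0\<^sup>*\<close> the last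
  premise says that \<open>T\<^sup>3 + (a\<^sub>2/p) T\<^sup>2 + (a\<^sub>4/p\<^sup>2) T + a\<^sub>6/p\<^sup>3\<close> has distinct roots modulo \<open>p\<close>; the two
  families for \<open>I\<^sub>n\<^sup>*\<close> with \<open>n = 2 k - 1\<close> and \<open>n = 2 k\<close> are the stages at which
  \<open>Y\<^sup>2 + (a\<^sub>3/p\<^sup>k\<^sup>+\<^sup>1) Y - a\<^sub>6/p\<^sup>2\<^sup>k\<^sup>+\<^sup>2\<close>, resp. \<open>(a\<^sub>2/p) X\<^sup>2 + (a\<^sub>4/p\<^sup>k\<^sup>+\<^sup>2) X + a\<^sub>6/p\<^sup>2\<^sup>k\<^sup>+\<^sup>3\<close>, has distinct roots
  modulo \<open>p\<close>.\<close>

inductive additive_components :: "nat \<Rightarrow> weierstrass \<Rightarrow> nat \<Rightarrow> bool"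
  for p :: nat and E :: weierstrass
  where
    type_II:
      "\<lbrakk>ppow_dvd p 1 (wb2 E); ppow_dvd p 1 (wa3 E); ppow_dvd p 1 (wa4 E);
        ppow_dvd p 1 (wa6 E); \<not> ppow_dvd p 2 (wa6 E)\<rbrakk>
       \<Longrightarrow> additive_components p E 1"
  | type_III:
      "\<lbrakk>ppow_dvd p 1 (wb2 E); ppow_dvd p 1 (wa3 E); ppow_dvd p 1 (wa4 E);
        ppow_dvd p 2 (wa6 E); \<not> ppow_dvd p 3 (wb8 E)\<rbrakk>
       \<Longrightarrow> additive_components p E 2"
  | type_IV:
      "\<lbrakk>ppow_dvd p 1 (wb2 E); ppow_dvd p 1 (wa3 E); ppow_dvd p 1 (wa4 E);
        ppow_dvd p 2 (wa6 E); ppow_dvd p 3 (wb8 E); \<not> ppow_dvd p 3 (wb6 E)\<rbrakk>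
       \<Longrightarrow> additive_components p E 3"
  | type_I0_star:
      "\<lbrakk>ppow_dvd p 1 (wa1 E); ppow_dvd p 1 (wa2 E); ppow_dvd p 2 (wa3 E); ppow_dvd p 2 (wa4 E);
        ppow_dvd p 3 (wa6 E);
        \<not> ppow_dvd p 7 ((wa2 E)\<^sup>2 * (wa4 E)\<^sup>2 - 4 * wa4 E ^ 3 - 4 * wa2 E ^ 3 * wa6 E
             - 27 * (wa6 E)\<^sup>2 + 18 * wa2 E * wa4 E * wa6 E)\<rbrakk>
       \<Longrightarrow> additive_components p E 5"
  | type_In_star_odd:
      "\<lbrakk>k \<ge> 1; ppow_dvd p 1 (wa1 E); ppow_dvd p 1 (wa2 E); \<not> ppow_dvd p 2 (wa2 E);
        ppow_dvd p (k + 1) (wa3 E); ppow_dvd p (k + 2) (wa4 E); ppow_dvd p (2 * k + 2) (wa6 E);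
        \<not> ppow_dvd p (2 * k + 3) (wb6 E)\<rbrakk>
       \<Longrightarrow> additive_components p E (5 + (2 * k - 1))"
  | type_In_star_even:
      "\<lbrakk>k \<ge> 1; ppow_dvd p 1 (wa1 E); ppow_dvd p 1 (wa2 E); \<not> ppow_dvd p 2 (wa2 E);
        ppow_dvd p (k + 2) (wa3 E); ppow_dvd p (k + 2) (wa4 E); ppow_dvd p (2 * k + 3) (wa6 E);
        \<not> ppow_dvd p (2 * k + 5) ((wa4 E)\<^sup>2 - 4 * wa2 E * wa6 E)\<rbrakk>
       \<Longrightarrow> additive_components p E (5 + 2 * k)"
  | type_IV_star:
      "\<lbrakk>ppow_dvd p 1 (wa1 E); ppow_dvd p 2 (wa2 E); ppow_dvd p 2 (wa3 E); ppow_dvd p 3 (wa4 E);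
        ppow_dvd p 4 (wa6 E); \<not> ppow_dvd p 5 (wb6 E)\<rbrakk>
       \<Longrightarrow> additive_components p E 7"
  | type_III_star:
      "\<lbrakk>ppow_dvd p 1 (wa1 E); ppow_dvd p 2 (wa2 E); ppow_dvd p 3 (wa3 E); ppow_dvd p 3 (wa4 E);
        ppow_dvd p 5 (wa6 E); \<not> ppow_dvd p 4 (wa4 E)\<rbrakk>
       \<Longrightarrow> additive_components p E 8"
  | type_II_star:
      "\<lbrakk>ppow_dvd p 1 (wa1 E); ppow_dvd p 2 (wa2 E); ppow_dvd p 3 (wa3 E); ppow_dvd p 4 (wa4 E);
        ppow_dvd p 5 (wa6 E); \<not> ppow_dvd p 6 (wa6 E)\<rbrakk>
       \<Longrightarrow> additive_components p E 9"

definition component_number :: "nat \<Rightarrow> weierstrass \<Rightarrow> nat"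
  where "component_number p E = (THE m. \<exists>E'. minimal_model p E E' \<and> additive_components p E' m)"

text \<open>For additive reduction the exponent is \<open>2 + \<delta>\<close>, where by Ogg's formula the wild part is
  \<open>\<delta> = v\<^sub>p(\<Delta>\<^sub>m\<^sub>i\<^sub>n) - m - 1\<close>; this is nonnegative, so the subtraction of naturals does not truncate.\<close>

definition conductor_exponent :: "nat \<Rightarrow> weierstrass \<Rightarrow> nat"
  where "conductor_exponent p E =
    (if good_reduction p E then 0
     else if multiplicative_reduction p E then 1
     else 2 + (min_disc_exponent p E - component_number p E - 1))"

definition conductor :: "weierstrass \<Rightarrow> nat"
  where "conductor E = (\<Prod>p \<in> {p. Factorial_Ring.prime p \<and> \<not> good_reduction p E}. p ^ conductor_exponent p E)"


section \<open>The admissible twists\<close>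

definition quadratic_field :: "int \<Rightarrow> complex set"
  where "quadratic_field m = {of_rat x + of_rat y * csqrt (of_int m) | x y. True}"

definition quadratic_integers :: "int \<Rightarrow> complex ring"
  where "quadratic_integers m =
    ring_of_type_algebra \<lparr> carrier := {z \<in> quadratic_field m. algebraic_int z} \<rparr>"

definition splits_in :: "nat \<Rightarrow> int \<Rightarrow> bool"
  where "splits_in p m \<longleftrightarrow> (\<exists>P Q. primeideal P (quadratic_integers m) \<and>
    primeideal Q (quadratic_integers m) \<and> P \<noteq> Q \<and>
    P \<cdot>\<^bsub>quadratic_integers m\<^esub> Q = PIdl\<^bsub>quadratic_integers m\<^esub> (of_nat p))"

definition twist_set :: "weierstrass \<Rightarrow> nat set"
  where "twist_set E = {\<Prod>S | S. finite S \<and> odd (card S) \<and>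
    (\<forall>q\<in>S. Factorial_Ring.prime q \<and> (\<forall>v. Factorial_Ring.prime v \<and> v dvd 2 * conductor E \<longrightarrow> splits_in v (- int q)))}"

text \<open>A family of roots \<open>\<beta>\<^sub>q \<in> \<rat>\<^sub>q\<close> of \<open>x\<^sup>2 - 2 a x + (a\<^sup>2 - 4 b)\<close> for \<open>q\<close> dividing \<open>d\<close>. If the
  discriminant of the equation is prime to \<open>q\<close>, such roots are automatically \<open>q\<close>-adic units.\<close>

definition root_family :: "int \<Rightarrow> int \<Rightarrow> nat \<Rightarrow> (nat \<Rightarrow> (nat \<Rightarrow> rat) set) \<Rightarrow> bool"
  where "root_family a b d \<beta> \<longleftrightarrow> (\<forall>q\<in>prime_factors d.
    \<beta> q \<in> carrier (padic_field q) \<and>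
    \<beta> q \<otimes>\<^bsub>padic_field q\<^esub> \<beta> q \<oplus>\<^bsub>padic_field q\<^esub>
      padic_of_rat q (of_int (- 2 * a)) \<otimes>\<^bsub>padic_field q\<^esub> \<beta> q \<oplus>\<^bsub>padic_field q\<^esub>
      padic_of_rat q (of_int (a\<^sup>2 - 4 * b)) = \<zero>\<^bsub>padic_field q\<^esub>)"

definition T_plus :: "nat \<Rightarrow> (nat \<Rightarrow> (nat \<Rightarrow> rat) set) \<Rightarrow> nat set"
  where "T_plus d \<beta> = {q \<in> prime_factors d. Legendre (int (d div q)) (int q) \<noteq>
    hilbert_symbol (padic_field q) (\<beta> q) (padic_of_rat q (of_nat q))}"

definition T_minus :: "nat \<Rightarrow> (nat \<Rightarrow> (nat \<Rightarrow> rat) set) \<Rightarrow> nat set"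
  where "T_minus d \<beta> = {q \<in> prime_factors d. Legendre (int (d div q)) (int q) =
    hilbert_symbol (padic_field q) (\<beta> q) (padic_of_rat q (of_nat q))}"

end

theory Submission
  imports Defs
begin

text \<open>
  The Kummer map sends a point \<open>(x, y)\<close> of \<open>E'\<close> with \<open>x \<noteq> 0\<close> to the class of \<open>x\<close>, and \<open>(0, 0)\<close> to the class
  of \<open>a\<^sup>2 - 4 b\<close>. Hence \<open>\<alpha>\<close> lies in the local image at a place if and only if \<open>\<alpha>\<close> is a square there or
  the torsor \<open>\<alpha> z\<^sup>2 = (\<alpha> w\<^sup>2 - a)\<^sup>2 - 4 b\<close> has a point, and everything reduces to this equation.

  Since \<open>-d\<close> is a product of an odd number of factors \<open>-q\<close>, it is a square at every prime dividing
  \<open>2 N\<^sub>E\<close>, so there the twist changes nothing. At an odd prime of good reduction not dividing \<open>d\<close> both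
  images consist of the classes of even valuation; a nonsquare unit is reached because, by counting
  the values of \<open>X + b/X\<close>, fewer than \<open>(p + 1)/2\<close> residues \<open>c\<close> make \<open>(c - a)\<^sup>2 - 4 b\<close> a nonzero square.

  For \<open>q\<close> dividing \<open>d\<close>, quadratic reciprocity shows \<open>q \<equiv> 7 (mod 8)\<close> and that every prime dividing \<open>2 N\<^sub>E\<close>
  is a square in \<open>\<rat>\<^sub>q\<close>. As \<open>b\<close> and \<open>a\<^sup>2 - 4 b\<close> have even valuation at all other primes, they are squares
  in \<open>\<rat>\<^sub>q\<close> exactly when they are positive, and the image of the twist at \<open>q\<close> is accordingly trivial, everything,
  or \<open>{1, - d \<beta>}\<close>. In the first case (\<open>b < 0\<close>) the local conditions at \<open>q\<close> differ, but a positive class with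
  even valuation at all primes of good reduction is automatically a square in \<open>\<rat>\<^sub>q\<close>.
\<close>

section \<open>The p-adic absolute value on the rationals\<close>

text \<open>The arithmetic takes place on rationals and on Cauchy sequences of rationals rather than
  inside the quotient field. Being a square is an open condition, so a good rational approximation
  decides it, and a torsor point is a pair of sequences whose defect is null. Existence goes through
  Hensel's lemma for sequences; an obstruction to the torsor needs just one approximate rational
  point.

  Good reduction speaks about some integral model, and the given a, b may be non-minimal at p. At
  odd p the 2-torsion point of a good model is integral, whence a = a' u^2 and b = b' u^4 with good
  a', b'; the torsor does not see the square u^2.

  The congruence q = 7 (mod 8) serves twice. It makes -q a square in Q_2, so that the twist is
  invisible at 2. It also makes -1 a nonsquare in Q_q, so that the sign of an integer with even
  valuations outside 2 N_E can be read off at q.\<close>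

locale padic =
  fixes p :: nat
  assumes prime_p: "Factorial_Ring.prime p"
begin

abbreviation v :: "rat \<Rightarrow> int" where "v \<equiv> padic_val p"
abbreviation N :: "rat \<Rightarrow> real" where "N \<equiv> padic_abs p"

lemma prime_int_p: "Factorial_Ring.prime (int p)"
  using prime_p by simp

lemma p_gt_1: "p > 1"
  using prime_p prime_gt_1_nat by blast

lemma multiplicity_int_mult:
  "m \<noteq> 0 \<Longrightarrow> n \<noteq> 0 \<Longrightarrow> multiplicity (int p) (m * n) = multiplicity (int p) m + multiplicity (int p) n"
  using prime_int_p by (intro prime_elem_multiplicity_mult_distrib) auto

text \<open>\<open>padic_val\<close> is defined on the reduced fraction. Cross-multiplying frees
  later computations from coprimality, so that sums can be put over a common denominator.\<close>

lemma padic_val_of_frac: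
  assumes "m \<noteq> 0" "n \<noteq> 0"
  shows "v (of_int m / of_int n) = int (multiplicity (int p) m) - int (multiplicity (int p) n)"
proof -
  obtain x y where xy: "quotient_of (of_int m / of_int n) = (x, y)" by fastforce
  have y: "y > 0" and eq: "(of_int m / of_int n :: rat) = of_int x / of_int y"
    using quotient_of_denom_pos[OF xy] quotient_of_div[OF xy] by auto
  have "(of_int (m * y) :: rat) = of_int (x * n)"
    using eq y assms by (simp add: field_simps)
  then have e: "m * y = x * n" by (simp only: of_int_eq_iff)
  then have "x \<noteq> 0" using y assms by auto
  then have "multiplicity (int p) m + multiplicity (int p) y = multiplicity (int p) x + multiplicity (int p) n"
    using multiplicity_int_mult[of m y] multiplicity_int_mult[of x n] e y assms by simp
  then show ?thesis by (simp add: padic_val_def xy)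
qed

lemma padic_val_of_int: "m \<noteq> 0 \<Longrightarrow> v (of_int m) = int (multiplicity (int p) m)"
  using padic_val_of_frac[of m 1] by simp

lemma rat_frac:
  fixes x :: rat
  obtains m n where "n > 0" "x = of_int m / of_int n" "coprime m n"
proof -
  obtain m n where mn: "quotient_of x = (m, n)" by fastforce
  show ?thesis
    using that[of n m] quotient_of_denom_pos[OF mn] quotient_of_div[OF mn] quotient_of_coprime[OF mn] by simp
qed

lemma padic_val_mult [simp]: 
  assumes "x \<noteq> 0" "y \<noteq> 0" shows "v (x * y) = v x + v y"
proof -
  obtain a b where ab: "b > 0" "x = of_int a / of_int b" by (rule rat_frac)
  obtain c e where ce: "e > 0" "y = of_int c / of_int e" by (rule rat_frac)
  have "a \<noteq> 0" "c \<noteq> 0" using assms ab ce by auto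
  have "x * y = of_int (a * c) / of_int (b * e)" using ab ce by simp
  moreover have "v \<dots> = int (multiplicity (int p) (a * c)) - int (multiplicity (int p) (b * e))"
    using ab ce \<open>a \<noteq> 0\<close> \<open>c \<noteq> 0\<close> by (intro padic_val_of_frac) auto
  ultimately show ?thesis
    using ab ce \<open>a \<noteq> 0\<close> \<open>c \<noteq> 0\<close> padic_val_of_frac[of a b] padic_val_of_frac[of c e]
    by (simp add: multiplicity_int_mult)
qed

lemma padic_val_1 [simp]: "v 1 = 0"
  using padic_val_of_int[of 1] by simp

lemma padic_val_minus [simp]: "v (- x) = v x"
proof (cases "x = 0")
  case False
  obtain a b where ab: "b > 0" "x = of_int a / of_int b" by (rule rat_frac)
  then show ?thesis
    using False padic_val_of_frac[of a b] padic_val_of_frac[of "- a" b] by auto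
qed auto

lemma padic_val_inverse [simp]: "x \<noteq> 0 \<Longrightarrow> v (inverse x) = - v x"
  using padic_val_mult[of x "inverse x"] by simp

lemma padic_val_divide: "x \<noteq> 0 \<Longrightarrow> y \<noteq> 0 \<Longrightarrow> v (x / y) = v x - v y"
  by (simp add: divide_inverse)

lemma padic_val_power: "x \<noteq> 0 \<Longrightarrow> v (x ^ n) = int n * v x"
  by (induction n) (auto simp: algebra_simps)

lemma padic_val_powi: "x \<noteq> 0 \<Longrightarrow> v (x powi k) = k * v x"
  by (auto simp: power_int_def padic_val_power)

lemma padic_val_p [simp]: "v (of_nat p) = 1"
  using padic_val_of_int[of "int p"] p_gt_1 prime_int_p by (simp add: multiplicity_prime)

lemma padic_val_add:
  assumes "x \<noteq> 0" "y \<noteq> 0" "x + y \<noteq> 0" shows "min (v x) (v y) \<le> v (x + y)"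
proof -
  obtain a b where ab: "b > 0" "x = of_int a / of_int b" by (rule rat_frac)
  obtain c e where ce: "e > 0" "y = of_int c / of_int e" by (rule rat_frac)
  define m n k where "m = a * e" and "n = c * b" and "k = b * e"
  have k: "k \<noteq> 0" and x: "x = of_int m / of_int k" and y: "y = of_int n / of_int k"
    using ab ce by (auto simp: k_def m_def n_def field_simps)
  have xy: "x + y = of_int (m + n) / of_int k" using x y by (simp add: add_divide_distrib)
  have nz: "m \<noteq> 0" "n \<noteq> 0" "m + n \<noteq> 0" using assms x y xy by auto
  have "min (multiplicity (int p) m) (multiplicity (int p) n) \<le> multiplicity (int p) (m + n)"
  proof (rule multiplicity_geI)
    show "int p ^ min (multiplicity (int p) m) (multiplicity (int p) n) dvd m + n"
      by (intro dvd_add) (auto intro!: multiplicity_dvd')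
  qed (use nz prime_int_p in auto)
  then show ?thesis
    unfolding xy unfolding x y using nz k by (simp add: padic_val_of_frac del: of_int_add)
qed

lemma N_0 [simp]: "N 0 = 0" by (simp add: padic_abs_def)
lemma N_eq_0 [simp]: "N x = 0 \<longleftrightarrow> x = 0"
  using p_gt_1 by (simp add: padic_abs_def)
lemma N_nonneg [simp]: "0 \<le> N x" by (simp add: padic_abs_def)
lemma N_pos [simp]: "0 < N x \<longleftrightarrow> x \<noteq> 0"
  by (metis N_eq_0 N_nonneg less_le)
lemma N_1 [simp]: "N 1 = 1" by (simp add: padic_abs_def)
lemma N_minus [simp]: "N (- x) = N x" by (simp add: padic_abs_def)
lemma N_minus_commute: "N (x - y) = N (y - x)" using N_minus[of "x - y"] by simp
lemma N_mult: "N (x * y) = N x * N y"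
  using p_gt_1 by (auto simp: padic_abs_def power_int_add[symmetric] add.commute)
lemma N_inverse: "N (inverse x) = inverse (N x)"
  by (cases "x = 0") (auto simp: padic_abs_def power_int_minus)
lemma N_divide: "N (x / y) = N x / N y"
  by (simp add: divide_inverse N_mult N_inverse)
lemma N_power: "N (x ^ n) = N x ^ n"
  by (induction n) (auto simp: N_mult)

lemma N_le_iff: "x \<noteq> 0 \<Longrightarrow> y \<noteq> 0 \<Longrightarrow> N x \<le> N y \<longleftrightarrow> v y \<le> v x"
  using p_gt_1 power_int_strict_increasing[of "- v y" "- v x" "real p"]
    power_int_increasing[of "- v x" "- v y" "real p"]
  by (auto simp: padic_abs_def not_le[symmetric])
lemma N_less_iff: "x \<noteq> 0 \<Longrightarrow> y \<noteq> 0 \<Longrightarrow> N x < N y \<longleftrightarrow> v y < v x"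
  using N_le_iff[of y x] by (simp add: not_le[symmetric])
lemma N_eq_iff: "x \<noteq> 0 \<Longrightarrow> y \<noteq> 0 \<Longrightarrow> N x = N y \<longleftrightarrow> v x = v y"
  using N_le_iff[of y x] N_le_iff[of x y] by auto
lemma N_eq_1_iff: "N x = 1 \<longleftrightarrow> x \<noteq> 0 \<and> v x = 0"
  using N_eq_iff[of x 1] by (cases "x = 0") auto
lemma N_le_1_iff: "N x \<le> 1 \<longleftrightarrow> x = 0 \<or> v x \<ge> 0"
  using N_le_iff[of x 1] by (cases "x = 0") auto

lemma N_add_le_max: "N (x + y) \<le> max (N x) (N y)"
proof (cases "x = 0 \<or> y = 0 \<or> x + y = 0")
  case False
  then have "v x \<le> v (x + y) \<or> v y \<le> v (x + y)" using padic_val_add[of x y] by linarith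
  then show ?thesis using False by (auto simp: N_le_iff le_max_iff_disj)
qed (auto simp: max_def)

lemma N_diff_le_max: "N (x - y) \<le> max (N x) (N y)"
  using N_add_le_max[of x "- y"] by simp

lemma N_add_le: "N x \<le> e \<Longrightarrow> N y \<le> e \<Longrightarrow> N (x + y) \<le> e"
  using N_add_le_max[of x y] by linarith
lemma N_add_less: "N x < e \<Longrightarrow> N y < e \<Longrightarrow> N (x + y) < e"
  using N_add_le_max[of x y] by linarith
lemma N_diff_le: "N x \<le> e \<Longrightarrow> N y \<le> e \<Longrightarrow> N (x - y) \<le> e"
  using N_diff_le_max[of x y] by linarith
lemma N_diff_less: "N x < e \<Longrightarrow> N y < e \<Longrightarrow> N (x - y) < e"
  using N_diff_le_max[of x y] by linarith
lemma N_triangle: "N (x + y) \<le> N x + N y"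
  using N_add_le_max[of x y] N_nonneg[of x] N_nonneg[of y] by linarith
lemma N_add_eq: "N y < N x \<Longrightarrow> N (x + y) = N x"
  using N_add_le_max[of x y] N_diff_le_max[of "x + y" y] by (auto simp: max_def split: if_splits)
lemma N_diff_eq: "N y < N x \<Longrightarrow> N (x - y) = N x"
  using N_add_eq[of "- y" x] by simp
lemma N_diff_eq2: "N x < N y \<Longrightarrow> N (x - y) = N y"
  using N_diff_eq[of x y] N_minus_commute[of x y] by simp

text \<open>The basic tool of all approximations below: an error smaller than the target cannot
  change the absolute value, by the ultrametric inequality.\<close>

lemma N_eq_of_close: "N (x - y) < N y \<Longrightarrow> N x = N y"
  using N_add_eq[of "x - y" y] by simp

lemma N_of_int_le_1: "N (of_int m) \<le> 1"
  by (cases "m = 0") (auto simp: N_le_1_iff padic_val_of_int)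
lemma N_of_nat_le_1: "N (of_nat m) \<le> 1"
  using N_of_int_le_1[of "int m"] by simp
lemma N_numeral_le_1: "N (numeral m) \<le> 1"
  using N_of_int_le_1[of "numeral m"] by simp

lemma N_of_int_less_1_iff: "N (of_int m) < 1 \<longleftrightarrow> int p dvd m"
proof (cases "m = 0")
  case False
  then have "N (of_int m) < 1 \<longleftrightarrow> multiplicity (int p) m > 0"
    using N_less_iff[of "of_int m" 1] by (simp add: padic_val_of_int)
  also have "\<dots> \<longleftrightarrow> int p dvd m"
    using False prime_int_p by (simp add: prime_multiplicity_gt_zero_iff)
  finally show ?thesis .
qed auto

lemma N_of_int_eq_1_iff: "N (of_int m) = 1 \<longleftrightarrow> \<not> int p dvd m"
  using N_of_int_less_1_iff[of m] N_of_int_le_1[of m] by linarith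

lemma N_p: "N (of_nat p) = 1 / real p"
  using p_gt_1 by (simp add: padic_abs_def power_int_minus divide_inverse)

text \<open>The value group is discrete, so a strict inequality gains a factor p. This turns
  congruences modulo p into the radius that Hensel's lemma asks for.\<close>

lemma N_less_1_imp: "N x < 1 \<Longrightarrow> N x \<le> 1 / real p"
proof (cases "x = 0")
  case False
  assume "N x < 1"
  then have "v x \<ge> 1" using N_less_iff[of x 1] False by simp
  then have "N x \<le> N (of_nat p)" using False p_gt_1 by (simp add: N_le_iff)
  then show ?thesis by (simp add: N_p)
qed auto

end

section \<open>Cauchy sequences and the field of p-adic numbers\<close>

context padic begin

definition pcauchy :: "(nat \<Rightarrow> rat) \<Rightarrow> bool"
  where "pcauchy s \<longleftrightarrow> (\<forall>e>0. \<exists>M. \<forall>m\<ge>M. \<forall>n\<ge>M. N (s m - s n) < e)"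

definition pnull :: "(nat \<Rightarrow> rat) \<Rightarrow> bool"
  where "pnull s \<longleftrightarrow> (\<lambda>n. N (s n)) \<longlonglongrightarrow> 0"

lemma pnull_iff: "pnull s \<longleftrightarrow> (\<forall>e>0. \<exists>M. \<forall>n\<ge>M. N (s n) < e)"
  unfolding pnull_def LIMSEQ_def by (simp add: dist_real_def)

lemma pnullD: "pnull s \<Longrightarrow> e > 0 \<Longrightarrow> \<exists>M. \<forall>n\<ge>M. N (s n) < e"
  by (simp add: pnull_iff)

lemma pcauchy_const [simp, intro]: "pcauchy (\<lambda>_. c)"
  by (auto simp: pcauchy_def)

lemma pnull_zero [simp, intro]: "pnull (\<lambda>_. 0)"
  by (simp add: pnull_def)

lemma pnull_const_iff [simp]: "pnull (\<lambda>_. c) \<longleftrightarrow> c = 0"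
proof
  assume "pnull (\<lambda>_. c)"
  then show "c = 0"
    using pnullD[of "\<lambda>_. c" "N c"] by (auto simp del: N_pos) (metis N_pos less_irrefl order_refl)
qed auto

lemma pnull_imp_pcauchy: "pnull s \<Longrightarrow> pcauchy s"
  unfolding pnull_iff pcauchy_def by (meson N_diff_less)

lemma pcauchy_add [intro]:
  assumes "pcauchy s" "pcauchy t" shows "pcauchy (\<lambda>n. s n + t n)"
  unfolding pcauchy_def
proof (intro allI impI)
  fix e :: real assume "e > 0"
  obtain M1 where M1: "\<forall>m\<ge>M1. \<forall>n\<ge>M1. N (s m - s n) < e" using assms \<open>e > 0\<close> unfolding pcauchy_def by blast
  obtain M2 where M2: "\<forall>m\<ge>M2. \<forall>n\<ge>M2. N (t m - t n) < e" using assms \<open>e > 0\<close> unfolding pcauchy_def by blast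
  have "N (s m + t m - (s n + t n)) < e" if "m \<ge> max M1 M2" "n \<ge> max M1 M2" for m n
  proof -
    have "N ((s m - s n) + (t m - t n)) < e" using M1 M2 that by (intro N_add_less) auto
    then show ?thesis by (simp add: algebra_simps)
  qed
  then show "\<exists>M. \<forall>m\<ge>M. \<forall>n\<ge>M. N (s m + t m - (s n + t n)) < e" by blast
qed

lemma pcauchy_minus [intro]: "pcauchy s \<Longrightarrow> pcauchy (\<lambda>n. - s n)"
  unfolding pcauchy_def by (metis N_minus minus_diff_eq minus_diff_minus)

lemma pcauchy_diff [intro]: "pcauchy s \<Longrightarrow> pcauchy t \<Longrightarrow> pcauchy (\<lambda>n. s n - t n)"
  using pcauchy_add[of s "\<lambda>n. - t n"] pcauchy_minus[of t] by simp

lemma pcauchy_bounded: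
  assumes "pcauchy s" shows "\<exists>B>0. \<forall>n. N (s n) \<le> B"
proof -
  obtain M where M: "\<forall>m\<ge>M. \<forall>n\<ge>M. N (s m - s n) < 1"
    using assms unfolding pcauchy_def by (meson zero_less_one)
  define B where "B = 1 + N (s M) + (\<Sum>i<M. N (s i))"
  have "N (s n) \<le> B" for n
  proof (cases "n < M")
    case True
    then have "N (s n) \<le> (\<Sum>i<M. N (s i))" by (intro member_le_sum) auto
    then show ?thesis by (simp add: B_def add_nonneg_nonneg add_increasing)
  next
    case False
    have "N ((s n - s M) + s M) \<le> N (s n - s M) + N (s M)" by (rule N_triangle)
    moreover have "N (s n - s M) < 1" using M False by auto
    moreover have "(\<Sum>i<M. N (s i)) \<ge> 0" by (simp add: sum_nonneg)
    ultimately show ?thesis by (simp add: B_def)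
  qed
  moreover have "B > 0" unfolding B_def by (simp add: add_pos_nonneg sum_nonneg)
  ultimately show ?thesis by blast
qed

lemma pnull_add [intro]:
  assumes "pnull s" "pnull t" shows "pnull (\<lambda>n. s n + t n)"
  unfolding pnull_iff
proof (intro allI impI)
  fix e :: real assume "e > 0"
  obtain M1 M2 where "\<forall>n\<ge>M1. N (s n) < e" "\<forall>n\<ge>M2. N (t n) < e"
    using pnullD[OF assms(1) \<open>e > 0\<close>] pnullD[OF assms(2) \<open>e > 0\<close>] by blast
  then have "\<forall>n\<ge>max M1 M2. N (s n + t n) < e" by (simp add: N_add_less)
  then show "\<exists>M. \<forall>n\<ge>M. N (s n + t n) < e" by blast
qed

lemma pnull_minus [intro]: "pnull s \<Longrightarrow> pnull (\<lambda>n. - s n)"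
  by (simp add: pnull_def)

lemma pnull_mult [intro]:
  assumes "pcauchy s" "pnull t" shows "pnull (\<lambda>n. s n * t n)"
  unfolding pnull_iff
proof (intro allI impI)
  fix e :: real assume "e > 0"
  obtain B where B: "B > 0" "\<forall>n. N (s n) \<le> B" using pcauchy_bounded[OF assms(1)] by blast
  then have "e / B > 0" using \<open>e > 0\<close> by simp
  then obtain M where M: "\<forall>n\<ge>M. N (t n) < e / B" using pnullD[OF assms(2)] by blast
  have "N (s n * t n) < e" if "n \<ge> M" for n
  proof -
    have "N (s n * t n) \<le> B * N (t n)" using B by (simp add: N_mult mult_right_mono)
    also have "\<dots> < e" using M that B(1) by (simp add: less_divide_eq mult.commute)
    finally show ?thesis .
  qed
  then show "\<exists>M. \<forall>n\<ge>M. N (s n * t n) < e" by blast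
qed

lemma pnull_mult2 [intro]: "pnull s \<Longrightarrow> pcauchy t \<Longrightarrow> pnull (\<lambda>n. s n * t n)"
  using pnull_mult[of t s] by (simp add: mult.commute)

lemma pcauchy_mult [intro]:
  assumes "pcauchy s" "pcauchy t" shows "pcauchy (\<lambda>n. s n * t n)"
  unfolding pcauchy_def
proof (intro allI impI)
  fix e :: real assume "e > 0"
  obtain B where B: "B > 0" "\<forall>n. N (s n) \<le> B" using pcauchy_bounded[OF assms(1)] by blast
  obtain C where C: "C > 0" "\<forall>n. N (t n) \<le> C" using pcauchy_bounded[OF assms(2)] by blast
  obtain M1 where M1: "\<forall>m\<ge>M1. \<forall>n\<ge>M1. N (s m - s n) < e / C"
    using assms \<open>e > 0\<close> C unfolding pcauchy_def by (meson divide_pos_pos)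
  obtain M2 where M2: "\<forall>m\<ge>M2. \<forall>n\<ge>M2. N (t m - t n) < e / B"
    using assms \<open>e > 0\<close> B unfolding pcauchy_def by (meson divide_pos_pos)
  have "N (s m * t m - s n * t n) < e" if "m \<ge> max M1 M2" "n \<ge> max M1 M2" for m n
  proof -
    have "N (s m - s n) < e / C" "N (t m - t n) < e / B" using M1 M2 that by auto
    then have "N (s m - s n) * C < e" "B * N (t m - t n) < e" using B C by (auto simp: field_simps)
    moreover have "N ((s m - s n) * t m) \<le> N (s m - s n) * C" "N (s n * (t m - t n)) \<le> B * N (t m - t n)"
      using B C by (auto simp: N_mult intro!: mult_left_mono mult_right_mono)
    ultimately have "N ((s m - s n) * t m + s n * (t m - t n)) < e" by (intro N_add_less) auto
    then show ?thesis by (simp add: algebra_simps)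
  qed
  then show "\<exists>M. \<forall>m\<ge>M. \<forall>n\<ge>M. N (s m * t m - s n * t n) < e" by blast
qed

lemma pcauchy_power [intro]: "pcauchy s \<Longrightarrow> pcauchy (\<lambda>n. s n ^ k)"
  by (induction k) auto

text \<open>Some term beyond the Cauchy threshold for c has absolute value at least c, and by the
  ultrametric inequality all terms beyond the threshold share its absolute value.\<close>

lemma pcauchy_not_null:
  assumes "pcauchy s" "\<not> pnull s" shows "\<exists>c>0. \<exists>M. \<forall>n\<ge>M. N (s n) \<ge> c"
proof -
  obtain c where c: "c > 0" "\<forall>M. \<exists>n\<ge>M. N (s n) \<ge> c"
    using assms(2) unfolding pnull_iff not_all not_imp not_ex not_less by auto
  obtain M where M: "\<forall>m\<ge>M. \<forall>n\<ge>M. N (s m - s n) < c"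
    using assms(1) c unfolding pcauchy_def by blast
  obtain k where k: "k \<ge> M" "N (s k) \<ge> c" using c by blast
  have "N (s n) \<ge> c" if "n \<ge> M" for n
    using N_eq_of_close[of "s n" "s k"] M k that by force
  then show ?thesis using c by blast
qed

text \<open>Finitely many terms may vanish, where \<open>inverse 0 = 0\<close> is harmless. The
  others are bounded away from zero, and 1/x - 1/y = (y - x)/(x y).\<close>

lemma pcauchy_inverse:
  assumes "pcauchy s" "\<not> pnull s" shows "pcauchy (\<lambda>n. inverse (s n))"
  unfolding pcauchy_def
proof (intro allI impI)
  fix e :: real assume "e > 0"
  obtain c M where c: "c > 0" "\<forall>n\<ge>M. N (s n) \<ge> c" using pcauchy_not_null[OF assms] by blast
  obtain M1 where M1: "\<forall>m\<ge>M1. \<forall>n\<ge>M1. N (s m - s n) < e * c * c"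
    using assms \<open>e > 0\<close> c unfolding pcauchy_def by (meson mult_pos_pos)
  have "N (inverse (s m) - inverse (s n)) < e" if "m \<ge> max M M1" "n \<ge> max M M1" for m n
  proof -
    have nz: "N (s m) \<ge> c" "N (s n) \<ge> c" using that c by auto
    then have "s m \<noteq> 0" "s n \<noteq> 0" using c(1) by auto
    then have "inverse (s m) - inverse (s n) = (s n - s m) / (s m * s n)" by (simp add: field_simps)
    then have "N (inverse (s m) - inverse (s n)) = N (s n - s m) / (N (s m) * N (s n))"
      by (simp add: N_divide N_mult)
    also have "\<dots> \<le> N (s n - s m) / (c * c)"
      using nz c by (intro divide_left_mono mult_mono mult_pos_pos) auto
    finally have "N (inverse (s m) - inverse (s n)) \<le> N (s n - s m) / (c * c)" .
    moreover have "N (s n - s m) < e * c * c" using M1 that by simp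
    then have "N (s n - s m) / (c * c) < e" using c by (simp add: divide_less_eq mult.assoc)
    ultimately show ?thesis by linarith
  qed
  then show "\<exists>M. \<forall>m\<ge>M. \<forall>n\<ge>M. N (inverse (s m) - inverse (s n)) < e" by blast
qed

lemma pnull_inverse:
  assumes "pcauchy s" "\<not> pnull s" shows "pnull (\<lambda>n. s n * inverse (s n) - 1)"
proof -
  obtain c M where c: "c > 0" "\<forall>n\<ge>M. N (s n) \<ge> c" using pcauchy_not_null[OF assms] by blast
  have "N (s n * inverse (s n) - 1) = 0" if "n \<ge> M" for n
  proof -
    have "s n \<noteq> 0" using c(1) c(2) that by auto
    then show ?thesis by simp
  qed
  then have "\<exists>M. \<forall>n\<ge>M. N (s n * inverse (s n) - 1) < e" if "e > 0" for e
    using that by (intro exI[of _ M]) simp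
  then show ?thesis unfolding pnull_iff by blast
qed

abbreviation CR where "CR \<equiv> padic_cauchy_ring p"
abbreviation NI where "NI \<equiv> padic_null_ideal p"
abbreviation Qp where "Qp \<equiv> padic_field p"

lemma CR_simps:
  "carrier CR = {s. pcauchy s}" "s \<otimes>\<^bsub>CR\<^esub> t = (\<lambda>n. s n * t n)" "\<one>\<^bsub>CR\<^esub> = (\<lambda>_. 1)"
  "\<zero>\<^bsub>CR\<^esub> = (\<lambda>_. 0)" "s \<oplus>\<^bsub>CR\<^esub> t = (\<lambda>n. s n + t n)"
  by (auto simp: padic_cauchy_ring_def pcauchy_def)

lemma NI_eq: "NI = {s. pnull s}"
  using pnull_imp_pcauchy by (auto simp: padic_null_ideal_def CR_simps pnull_def)

lemma cring_CR: "cring CR"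
proof (rule cringI)
  show "abelian_group CR"
  proof (rule abelian_groupI)
    fix x assume "x \<in> carrier CR"
    then show "\<exists>y\<in>carrier CR. y \<oplus>\<^bsub>CR\<^esub> x = \<zero>\<^bsub>CR\<^esub>"
      by (intro bexI[of _ "\<lambda>n. - x n"]) (auto simp: CR_simps)
  qed (auto simp: CR_simps algebra_simps)
  show "Group.comm_monoid CR"
    by (rule Group.comm_monoidI) (auto simp: CR_simps algebra_simps)
qed (auto simp: CR_simps algebra_simps)

interpretation CR: cring CR by (rule cring_CR)

lemma CR_uminus: "pcauchy s \<Longrightarrow> \<ominus>\<^bsub>CR\<^esub> s = (\<lambda>n. - s n)"
  by (rule CR.minus_equality) (auto simp: CR_simps)

lemma CR_minus: "pcauchy s \<Longrightarrow> pcauchy t \<Longrightarrow> s \<ominus>\<^bsub>CR\<^esub> t = (\<lambda>n. s n - t n)"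
  by (simp add: a_minus_def CR_uminus CR_simps)

lemma ideal_NI: "ideal NI CR"
proof (rule idealI)
  show "subgroup NI (add_monoid CR)"
  proof (rule group.subgroupI)
    show "group (add_monoid CR)" by (rule CR.add.group_axioms)
    show "NI \<subseteq> carrier (add_monoid CR)" using pnull_imp_pcauchy by (auto simp: NI_eq CR_simps)
    show "NI \<noteq> {}" using pnull_zero by (auto simp: NI_eq)
    fix a b assume "a \<in> NI" "b \<in> NI"
    then have ab: "pnull a" "pnull b" "pcauchy a" using pnull_imp_pcauchy by (auto simp: NI_eq)
    show "inv\<^bsub>add_monoid CR\<^esub> a \<in> NI"
      unfolding a_inv_def[symmetric] CR_uminus[OF ab(3)] using ab by (auto simp: NI_eq)
    show "a \<otimes>\<^bsub>add_monoid CR\<^esub> b \<in> NI" using ab by (auto simp: NI_eq CR_simps)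
  qed
qed (use CR.ring_axioms in \<open>auto simp: NI_eq CR_simps\<close>)

definition cls :: "(nat \<Rightarrow> rat) \<Rightarrow> (nat \<Rightarrow> rat) set"
  where "cls s = NI +>\<^bsub>CR\<^esub> s"

lemma carrier_Qp: "carrier Qp = cls ` {s. pcauchy s}"
  by (auto simp: padic_field_def FactRing_def A_RCOSETS_def' cls_def CR_simps)

lemma cls_in_Qp [simp, intro]: "pcauchy s \<Longrightarrow> cls s \<in> carrier Qp"
  by (auto simp: carrier_Qp)

lemma Qp_cases:
  assumes "x \<in> carrier Qp" obtains s where "pcauchy s" "x = cls s"
  using assms by (auto simp: carrier_Qp)

lemma cring_Qp: "cring Qp"
  unfolding padic_field_def by (rule ideal.quotient_is_cring[OF ideal_NI cring_CR])

lemma cls_hom: "cls \<in> ring_hom CR Qp"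
  using ideal.rcos_ring_hom[OF ideal_NI] by (simp add: padic_field_def cls_def[abs_def])

lemma cls_mult: "pcauchy s \<Longrightarrow> pcauchy t \<Longrightarrow> cls s \<otimes>\<^bsub>Qp\<^esub> cls t = cls (\<lambda>n. s n * t n)"
  using ring_hom_mult[OF cls_hom, of s t] by (simp add: CR_simps)
lemma cls_add: "pcauchy s \<Longrightarrow> pcauchy t \<Longrightarrow> cls s \<oplus>\<^bsub>Qp\<^esub> cls t = cls (\<lambda>n. s n + t n)"
  using ring_hom_add[OF cls_hom, of s t] by (simp add: CR_simps)
lemma cls_one: "\<one>\<^bsub>Qp\<^esub> = cls (\<lambda>_. 1)"
  using ring_hom_one[OF cls_hom] by (simp add: CR_simps)
lemma cls_zero: "\<zero>\<^bsub>Qp\<^esub> = cls (\<lambda>_. 0)"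
  using ring_hom_zero[OF cls_hom] CR.ring_axioms cring.axioms(1)[OF cring_Qp] by (simp add: CR_simps)

lemma cls_uminus: "pcauchy s \<Longrightarrow> \<ominus>\<^bsub>Qp\<^esub> cls s = cls (\<lambda>n. - s n)"
proof -
  interpret cring Qp by (rule cring_Qp)
  assume "pcauchy s"
  then show ?thesis
    by (intro minus_equality) (auto simp: cls_add cls_zero pcauchy_minus)
qed
lemma cls_minus: "pcauchy s \<Longrightarrow> pcauchy t \<Longrightarrow> cls s \<ominus>\<^bsub>Qp\<^esub> cls t = cls (\<lambda>n. s n - t n)"
  by (simp add: a_minus_def cls_uminus cls_add pcauchy_minus)

lemma cls_eq_iff: "pcauchy s \<Longrightarrow> pcauchy t \<Longrightarrow> cls s = cls t \<longleftrightarrow> pnull (\<lambda>n. s n - t n)"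
  using CR.quotient_eq_iff_same_a_r_cos[OF ideal_NI, of s t]
  by (simp add: CR_simps CR_minus NI_eq cls_def)

lemma padic_of_rat_eq: "padic_of_rat p x = cls (\<lambda>_. x)"
  by (simp add: padic_of_rat_def cls_def)

lemma field_Qp: "field Qp"
proof (rule cring.cring_fieldI[OF cring_Qp])
  interpret cring Qp by (rule cring_Qp)
  have ne: "\<zero>\<^bsub>Qp\<^esub> \<noteq> \<one>\<^bsub>Qp\<^esub>" by (simp add: cls_one cls_zero cls_eq_iff)
  have "x \<in> Units Qp" if x: "x \<in> carrier Qp" "x \<noteq> \<zero>\<^bsub>Qp\<^esub>" for x
  proof -
    obtain s where s: "pcauchy s" "x = cls s" using x by (elim Qp_cases)
    then have nn: "\<not> pnull s" using x by (simp add: cls_zero cls_eq_iff)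
    have "cls (\<lambda>n. inverse (s n)) \<otimes>\<^bsub>Qp\<^esub> x = \<one>\<^bsub>Qp\<^esub>"
      using pcauchy_inverse[OF s(1) nn] pnull_inverse[OF s(1) nn] s
      by (simp add: cls_mult cls_one cls_eq_iff pcauchy_mult mult.commute)
    moreover have i: "cls (\<lambda>n. inverse (s n)) \<in> carrier Qp" using pcauchy_inverse[OF s(1) nn] by simp
    ultimately have "x \<otimes>\<^bsub>Qp\<^esub> cls (\<lambda>n. inverse (s n)) = \<one>\<^bsub>Qp\<^esub>"
      using m_comm[OF x(1) i] by simp
    with \<open>cls (\<lambda>n. inverse (s n)) \<otimes>\<^bsub>Qp\<^esub> x = \<one>\<^bsub>Qp\<^esub>\<close> i x(1) show ?thesis
      unfolding Units_def by blast
  qed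
  moreover have "\<zero>\<^bsub>Qp\<^esub> \<notin> Units Qp" using ne by (auto simp: Units_def)
  ultimately show "Units Qp = carrier Qp - {\<zero>\<^bsub>Qp\<^esub>}" by auto
qed

lemma padic_of_rat_hom: "padic_of_rat p \<in> ring_hom rat_field Qp"
  by (rule ring_hom_memI)
    (auto simp: padic_of_rat_eq ring_of_type_algebra_def cls_mult cls_add cls_one)

end

section \<open>Squares and torsors over the p-adic numbers\<close>

context padic begin

lemmas pcauchy_intros = pcauchy_mult pcauchy_add pcauchy_diff pcauchy_minus pcauchy_power pcauchy_const

text \<open>Being a square in Q_p, expressed on rationals: closeness to a rational square with
  relative precision |4p|. This is Hensel's radius for all p at once, namely modulo p for odd p and
  modulo 8 for p = 2.\<close>

definition psq :: "rat \<Rightarrow> bool"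
  where "psq x \<longleftrightarrow> x \<noteq> 0 \<and> (\<exists>s. s \<noteq> 0 \<and> N (x / s\<^sup>2 - 1) \<le> N (4 * of_nat p))"

lemma N_2p_less: "N (2 * of_nat p) < N 2" "N (2 * of_nat p) < 1" "N (4 * of_nat p) < 1"
proof -
  have "1 / real p < 1" using p_gt_1 by simp
  then show 1: "N (2 * of_nat p) < N 2" unfolding N_mult N_p
    using mult_strict_left_mono[of "1 / real p" 1 "N 2"] by simp
  then show "N (2 * of_nat p) < 1" using N_numeral_le_1[of "num.Bit0 num.One"] by linarith
  have "N (4 * of_nat p) \<le> N (of_nat p)" unfolding N_mult using N_numeral_le_1 by (simp add: mult_left_le_one_le)
  then show "N (4 * of_nat p) < 1" using \<open>1 / real p < 1\<close> by (simp add: N_p)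
qed

text \<open>Newton's iteration for the square root, carried out on rational approximations.\<close>

lemma hensel_approx:
  assumes "N (u - 1) \<le> N (4 * of_nat p)"
  shows "\<exists>r. N (r - 1) \<le> N (2 * of_nat p) \<and> N (r\<^sup>2 - u) \<le> N (4 * of_nat p) * (1 / real p) ^ k"
proof (induction k)
  case 0
  show ?case using assms by (intro exI[of _ 1]) (simp add: N_minus_commute)
next
  case (Suc k)
  then obtain r where r: "N (r - 1) \<le> N (2 * of_nat p)" "N (r\<^sup>2 - u) \<le> N (4 * of_nat p) * (1 / real p) ^ k"
    by blast
  have "N (r - 1) < N 1" using r(1) N_2p_less(2) by simp
  then have Nr: "N r = 1" using N_eq_of_close[of r 1] by simp
  then have r0: "r \<noteq> 0" by auto
  \<comment> \<open>Newton's correction; the new defect is exactly h^2. Dividing by 2r costs a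
    factor |2|, which the radius |4p| pays for: |h| is at most |2p|/p^k and also at most |2p|, so
    |h^2| is at most |4p|/p^(k+1).\<close>
  define h where "h = (r\<^sup>2 - u) / (2 * r)"
  have h: "(r - h)\<^sup>2 - u = h\<^sup>2"
    using r0 unfolding h_def by (simp add: field_simps power2_eq_square)
  have "N h \<le> N (4 * of_nat p) * (1 / real p) ^ k / N 2"
    unfolding h_def N_divide N_mult[of 2 r] Nr using r(2) by (simp add: divide_right_mono)
  also have "\<dots> = N (2 * of_nat p) * (1 / real p) ^ k"
    using N_mult[of 2 "2 * of_nat p"] by simp
  finally have Nh: "N h \<le> N (2 * of_nat p) * (1 / real p) ^ k" .
  have pk: "(1 / real p) ^ k \<le> 1" using p_gt_1 by (intro power_le_one) auto
  have Nh1: "N h \<le> N (2 * of_nat p)"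
    using Nh pk mult_left_mono[OF pk N_nonneg[of "2 * of_nat p"]] by linarith
  have "N (h\<^sup>2) = N h * N h" by (simp add: power2_eq_square N_mult)
  also have "\<dots> \<le> N (2 * of_nat p) * (N (2 * of_nat p) * (1 / real p) ^ k)"
    using Nh Nh1 by (intro mult_mono) auto
  also have "\<dots> = N ((2 * of_nat p) * (2 * of_nat p)) * (1 / real p) ^ k" by (simp only: N_mult mult.assoc)
  also have "(2 * of_nat p) * (2 * of_nat p) = (4 * of_nat p * of_nat p :: rat)" by simp
  also have "N \<dots> * (1 / real p) ^ k = N (4 * of_nat p) * (1 / real p) ^ Suc k"
    by (simp add: N_mult N_p)
  finally have 1: "N ((r - h)\<^sup>2 - u) \<le> N (4 * of_nat p) * (1 / real p) ^ Suc k" using h by simp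
  have "r - h - 1 = (r - 1) - h" by simp
  then have "N (r - h - 1) \<le> N (2 * of_nat p)" using r(1) Nh1 N_diff_le by metis
  then show ?case using 1 by blast
qed

lemma pcauchy_cong:
  assumes "pcauchy s" "\<And>n. n \<ge> M \<Longrightarrow> t n = s n" shows "pcauchy t"
  unfolding pcauchy_def
proof (intro allI impI)
  fix e :: real assume "e > 0"
  then obtain M' where "\<forall>m\<ge>M'. \<forall>n\<ge>M'. N (s m - s n) < e" using assms(1) unfolding pcauchy_def by blast
  then have "\<forall>m\<ge>max M M'. \<forall>n\<ge>max M M'. N (t m - t n) < e" using assms(2) by simp
  then show "\<exists>M. \<forall>m\<ge>M. \<forall>n\<ge>M. N (t m - t n) < e" by blast
qed

lemma pnull_cong:
  assumes "pnull s" "\<And>n. n \<ge> M \<Longrightarrow> t n = s n" shows "pnull t"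
  unfolding pnull_iff
proof (intro allI impI)
  fix e :: real assume "e > 0"
  then obtain M' where "\<forall>n\<ge>M'. N (s n) < e" using assms(1) unfolding pnull_iff by blast
  then have "\<forall>n\<ge>max M M'. N (t n) < e" using assms(2) by simp
  then show "\<exists>M. \<forall>n\<ge>M. N (t n) < e" by blast
qed

text \<open>A diagonal choice: the n-th entry is a root of the n-th term up to precision p^(-n). All
  these roots are kept near 1, so any two of them have a sum of absolute value |2|, and the
  difference of the squares controls the difference of the roots. Without this normalization the
  signs could alternate and the sequence would not be Cauchy.\<close>

lemma hensel_seq:
  assumes "pcauchy s" "\<And>n. N (s n - 1) \<le> N (4 * of_nat p)"
  obtains t where "pcauchy t" "pnull (\<lambda>n. (t n)\<^sup>2 - s n)" "\<And>n. N (t n - 1) \<le> N (2 * of_nat p)"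
proof -
  have "\<forall>n. \<exists>r. N (r - 1) \<le> N (2 * of_nat p) \<and> N (r\<^sup>2 - s n) \<le> N (4 * of_nat p) * (1 / real p) ^ n"
    using hensel_approx[OF assms(2)] by blast
  then obtain t where t: "\<And>n. N (t n - 1) \<le> N (2 * of_nat p)"
    "\<And>n. N ((t n)\<^sup>2 - s n) \<le> N (4 * of_nat p) * (1 / real p) ^ n" by metis
  have lim: "(\<lambda>n. N (4 * of_nat p) * (1 / real p) ^ n) \<longlonglongrightarrow> 0"
    using p_gt_1 by (intro tendsto_mult_right_zero LIMSEQ_power_zero) auto
  have null: "pnull (\<lambda>n. (t n)\<^sup>2 - s n)"
    unfolding pnull_def
    by (rule tendsto_sandwich[OF _ _ tendsto_const lim]) (simp_all add: t(2))
  have "pcauchy (\<lambda>n. ((t n)\<^sup>2 - s n) + s n)"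
    by (rule pcauchy_add[OF pnull_imp_pcauchy[OF null] assms(1)])
  then have sq: "pcauchy (\<lambda>n. (t n)\<^sup>2)" by simp
  have sum: "N (t m + t n) = N 2" for m n
  proof -
    have "N ((t m - 1) + (t n - 1)) \<le> N (2 * of_nat p)" using t(1) N_add_le by blast
    then have "N (2 + ((t m - 1) + (t n - 1))) = N 2" using N_2p_less by (intro N_add_eq) auto
    then show ?thesis by (simp add: algebra_simps)
  qed
  have "pcauchy t"
    unfolding pcauchy_def
  proof (intro allI impI)
    fix e :: real assume "e > 0"
    then have "e * N 2 > 0" by simp
    then obtain M where M: "\<forall>m\<ge>M. \<forall>n\<ge>M. N ((t m)\<^sup>2 - (t n)\<^sup>2) < e * N 2"
      using sq unfolding pcauchy_def by blast
    have "N (t m - t n) < e" if "m \<ge> M" "n \<ge> M" for m n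
    proof -
      have "N ((t m + t n) * (t m - t n)) < e * N 2"
        using M that by (simp add: power2_eq_square square_diff_square_factored)
      then have "N (t m - t n) * N 2 < e * N 2" by (simp add: N_mult sum mult.commute)
      then show ?thesis by (simp add: mult_less_cancel_right)
    qed
    then show "\<exists>M. \<forall>m\<ge>M. \<forall>n\<ge>M. N (t m - t n) < e" by blast
  qed
  then show ?thesis using that null t(1) by blast
qed

text \<open>Rescaling by c^2 reduces to terms near 1; the finitely many terms before M are replaced
  by 1, which changes nothing up to a null sequence.\<close>

lemma hensel_seq':
  assumes "pcauchy s" "c \<noteq> 0" "\<And>n. n \<ge> M \<Longrightarrow> N (s n / c\<^sup>2 - 1) \<le> N (4 * of_nat p)"
  obtains t where "pcauchy t" "pnull (\<lambda>n. (t n)\<^sup>2 - s n)"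
proof -
  define s' where "s' n = (if n \<ge> M then s n / c\<^sup>2 else 1)" for n
  have "pcauchy (\<lambda>n. inverse (c\<^sup>2) * s n)" by (intro pcauchy_intros assms)
  then have "pcauchy s'" by (rule pcauchy_cong[where M = M]) (simp add: s'_def field_simps)
  moreover have "N (s' n - 1) \<le> N (4 * of_nat p)" for n using assms(3) by (simp add: s'_def)
  ultimately obtain t where t: "pcauchy t" "pnull (\<lambda>n. (t n)\<^sup>2 - s' n)" using hensel_seq by blast
  have "pnull (\<lambda>n. c\<^sup>2 * ((t n)\<^sup>2 - s' n))" by (rule pnull_mult[OF pcauchy_const t(2)])
  then have "pnull (\<lambda>n. (c * t n)\<^sup>2 - s n)"
    by (rule pnull_cong[where M = M]) (simp add: s'_def assms(2) field_simps power_mult_distrib)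
  moreover have "pcauchy (\<lambda>n. c * t n)" by (intro pcauchy_intros t)
  ultimately show ?thesis using that by blast
qed

text \<open>One direction is Hensel's lemma. For the other, a single rational term of a sequence of
  square roots, taken late enough, already witnesses \<open>psq\<close>.\<close>

lemma psq_iff:
  assumes "x \<noteq> 0" shows "psq x \<longleftrightarrow> (\<exists>t. pcauchy t \<and> pnull (\<lambda>n. (t n)\<^sup>2 - x))"
proof
  assume "psq x"
  then obtain c where "c \<noteq> 0" "N (x / c\<^sup>2 - 1) \<le> N (4 * of_nat p)" unfolding psq_def by blast
  then show "\<exists>t. pcauchy t \<and> pnull (\<lambda>n. (t n)\<^sup>2 - x)"
    using hensel_seq'[of "\<lambda>_. x" c 0] pcauchy_const by metis
next
  assume "\<exists>t. pcauchy t \<and> pnull (\<lambda>n. (t n)\<^sup>2 - x)"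
  then obtain t where t: "pnull (\<lambda>n. (t n)\<^sup>2 - x)" by blast
  have "N (4 * of_nat p) * N x > 0" using assms p_gt_1 by (simp add: N_mult)
  then obtain n where n: "N ((t n)\<^sup>2 - x) < N (4 * of_nat p) * N x" using pnullD[OF t] by blast
  also have "\<dots> \<le> N x" using N_2p_less(3) by (simp add: mult_left_le_one_le)
  finally have e: "N ((t n)\<^sup>2) = N x" by (rule N_eq_of_close)
  then have t0: "t n \<noteq> 0" using assms by auto
  then have "x / (t n)\<^sup>2 - 1 = (x - (t n)\<^sup>2) / (t n)\<^sup>2" by (simp add: field_simps)
  then have "N (x / (t n)\<^sup>2 - 1) = N ((t n)\<^sup>2 - x) / N x" by (simp add: N_divide e N_minus_commute)
  also have "\<dots> \<le> N (4 * of_nat p)" using n assms by (simp add: divide_le_eq)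
  finally show "psq x" using t0 assms unfolding psq_def by blast
qed

lemma psq_nonzero: "psq x \<Longrightarrow> x \<noteq> 0" by (simp add: psq_def)

lemma psq_square [simp, intro]: "c \<noteq> 0 \<Longrightarrow> psq (c\<^sup>2)"
  unfolding psq_def by (intro conjI exI[of _ c]) auto

lemma psq_mult:
  assumes "psq x" "psq y" shows "psq (x * y)"
proof -
  have nz: "x \<noteq> 0" "y \<noteq> 0" using assms psq_nonzero by auto
  obtain s t where st: "pcauchy s" "pnull (\<lambda>n. (s n)\<^sup>2 - x)" "pcauchy t" "pnull (\<lambda>n. (t n)\<^sup>2 - y)"
    using assms psq_iff nz by metis
  have "pnull (\<lambda>n. (t n)\<^sup>2 * ((s n)\<^sup>2 - x) + x * ((t n)\<^sup>2 - y))"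
    by (intro pnull_add pnull_mult st pcauchy_intros)
  then have "pnull (\<lambda>n. (s n * t n)\<^sup>2 - x * y)" by (simp add: algebra_simps power_mult_distrib)
  moreover have "pcauchy (\<lambda>n. s n * t n)" by (intro pcauchy_intros st)
  ultimately show ?thesis using nz psq_iff[of "x * y"] by auto
qed

lemma psq_mult_square [simp]:
  assumes "c \<noteq> 0" shows "psq (x * c\<^sup>2) \<longleftrightarrow> psq x"
proof
  assume "psq (x * c\<^sup>2)"
  then have "psq (x * c\<^sup>2 * (inverse c)\<^sup>2)" using assms psq_mult[of _ "(inverse c)\<^sup>2"] by simp
  then show "psq x" using assms by (simp add: field_simps)
qed (simp add: assms psq_mult)

lemma psq_mult_iff: "psq x \<Longrightarrow> psq (x * y) \<longleftrightarrow> psq y"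
proof
  assume x: "psq x" "psq (x * y)"
  then have "psq (x * (x * y))" by (rule psq_mult)
  then have "psq (y * x\<^sup>2)" by (simp add: power2_eq_square algebra_simps)
  then show "psq y" using psq_mult_square[of x y] psq_nonzero[OF x(1)] by blast
qed (rule psq_mult)

lemma psq_inverse: "psq x \<Longrightarrow> psq (inverse x)"
  using psq_mult_iff[of x "inverse x"] psq_square[of 1] psq_nonzero[of x] by simp

lemma psq_even: assumes "psq x" shows "even (v x)"
proof -
  obtain s where s: "s \<noteq> 0" "N (x / s\<^sup>2 - 1) \<le> N (4 * of_nat p)" and x: "x \<noteq> 0"
    using assms unfolding psq_def by blast
  then have "N (x / s\<^sup>2) = N 1" using N_2p_less by (intro N_eq_of_close) simp
  then have "v (x / s\<^sup>2) = 0" using N_eq_1_iff by simp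
  then show ?thesis using s x by (simp add: padic_val_divide padic_val_power)
qed

text \<open>Solvability in \<open>\<rat>\<^sub>p\<close> of the torsor \<open>\<alpha> z\<^sup>2 = (\<alpha> w\<^sup>2 - a)\<^sup>2 - 4 b\<close>; the first disjunct accounts for
  its points at infinity.\<close>

definition ptors :: "rat \<Rightarrow> rat \<Rightarrow> rat \<Rightarrow> bool"
  where "ptors \<alpha> a b \<longleftrightarrow> psq \<alpha> \<or>
    (\<exists>s t. pcauchy s \<and> pcauchy t \<and> pnull (\<lambda>n. \<alpha> * (t n)\<^sup>2 - ((\<alpha> * (s n)\<^sup>2 - a)\<^sup>2 - 4 * b)))"

text \<open>For D = e^2 the map (w, z) to (e w, e^2 z) carries one torsor to the other. On sequences
  e^2 equals D only up to a null sequence, so the transported defect is e^4 times the old one plus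
  an explicit multiple of e^2 - D.\<close>

lemma ptors_scale_imp:
  assumes "psq D" "ptors \<alpha> a b" shows "ptors \<alpha> (a * D) (b * D\<^sup>2)"
  using assms(2) unfolding ptors_def
proof (elim disjE exE conjE)
  fix s t assume st: "pcauchy s" "pcauchy t"
    and null: "pnull (\<lambda>n. \<alpha> * (t n)\<^sup>2 - ((\<alpha> * (s n)\<^sup>2 - a)\<^sup>2 - 4 * b))"
  obtain e where e: "pcauchy e" "pnull (\<lambda>n. (e n)\<^sup>2 - D)" using assms(1) psq_iff psq_nonzero by blast
  have "pnull (\<lambda>n. (e n) ^ 4 * (\<alpha> * (t n)\<^sup>2 - ((\<alpha> * (s n)\<^sup>2 - a)\<^sup>2 - 4 * b)) +
      ((e n)\<^sup>2 - D) * (- a * (2 * \<alpha> * (e n)\<^sup>2 * (s n)\<^sup>2 - a * (e n)\<^sup>2 - a * D) - 4 * b * ((e n)\<^sup>2 + D)))"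
    by (intro pnull_add pnull_mult[OF _ null] pnull_mult2[OF e(2)] pcauchy_intros e st)
  moreover have "(e n) ^ 4 * (\<alpha> * (t n)\<^sup>2 - ((\<alpha> * (s n)\<^sup>2 - a)\<^sup>2 - 4 * b)) +
      ((e n)\<^sup>2 - D) * (- a * (2 * \<alpha> * (e n)\<^sup>2 * (s n)\<^sup>2 - a * (e n)\<^sup>2 - a * D) - 4 * b * ((e n)\<^sup>2 + D))
    = \<alpha> * ((e n)\<^sup>2 * t n)\<^sup>2 - ((\<alpha> * (e n * s n)\<^sup>2 - a * D)\<^sup>2 - 4 * (b * D\<^sup>2))" for n
    by Groebner_Basis.algebra
  ultimately have "pnull (\<lambda>n. \<alpha> * ((e n)\<^sup>2 * t n)\<^sup>2 - ((\<alpha> * (e n * s n)\<^sup>2 - a * D)\<^sup>2 - 4 * (b * D\<^sup>2)))"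
    by simp
  moreover have "pcauchy (\<lambda>n. e n * s n)" "pcauchy (\<lambda>n. (e n)\<^sup>2 * t n)" by (intro pcauchy_intros e st)+
  ultimately show "psq \<alpha> \<or> (\<exists>s t. pcauchy s \<and> pcauchy t \<and>
    pnull (\<lambda>n. \<alpha> * (t n)\<^sup>2 - ((\<alpha> * (s n)\<^sup>2 - a * D)\<^sup>2 - 4 * (b * D\<^sup>2))))" by blast
qed auto

lemma ptors_scale:
  assumes "psq D" shows "ptors \<alpha> (a * D) (b * D\<^sup>2) \<longleftrightarrow> ptors \<alpha> a b"
proof
  assume "ptors \<alpha> (a * D) (b * D\<^sup>2)"
  from ptors_scale_imp[OF psq_inverse[OF assms] this] show "ptors \<alpha> a b"
    using psq_nonzero[OF assms] by (simp add: field_simps)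
qed (rule ptors_scale_imp[OF assms])

lemma ptors_mult_square_imp:
  assumes "c \<noteq> 0" "ptors \<alpha> a b" shows "ptors (\<alpha> * c\<^sup>2) a b"
  using assms(2) unfolding ptors_def
proof (elim disjE exE conjE)
  fix s t assume st: "pcauchy s" "pcauchy t"
    and null: "pnull (\<lambda>n. \<alpha> * (t n)\<^sup>2 - ((\<alpha> * (s n)\<^sup>2 - a)\<^sup>2 - 4 * b))"
  have *: "\<alpha> * c\<^sup>2 * (inverse c * x)\<^sup>2 = \<alpha> * x\<^sup>2" for x using assms(1) by (simp add: field_simps power2_eq_square)
  have "pcauchy (\<lambda>n. inverse c * s n)" "pcauchy (\<lambda>n. inverse c * t n)" by (intro pcauchy_intros st)+
  moreover have "pnull (\<lambda>n. \<alpha> * c\<^sup>2 * (inverse c * t n)\<^sup>2 - ((\<alpha> * c\<^sup>2 * (inverse c * s n)\<^sup>2 - a)\<^sup>2 - 4 * b))"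
    using null unfolding * .
  ultimately show "psq (\<alpha> * c\<^sup>2) \<or> (\<exists>s t. pcauchy s \<and> pcauchy t \<and>
      pnull (\<lambda>n. \<alpha> * c\<^sup>2 * (t n)\<^sup>2 - ((\<alpha> * c\<^sup>2 * (s n)\<^sup>2 - a)\<^sup>2 - 4 * b)))" by blast
qed (simp add: assms)

lemma ptors_mult_square:
  assumes "c \<noteq> 0" shows "ptors (\<alpha> * c\<^sup>2) a b \<longleftrightarrow> ptors \<alpha> a b"
  using ptors_mult_square_imp[OF assms, of \<alpha> a b] ptors_mult_square_imp[of "inverse c" "\<alpha> * c\<^sup>2" a b] assms
  by (auto simp: field_simps)

text \<open>The form in which solvability is used for obstructions: one rational pair solving the
  equation up to a prescribed error.\<close>

lemma ptors_approx:
  assumes "ptors \<alpha> a b" "e > 0"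
  shows "psq \<alpha> \<or> (\<exists>w z. N (\<alpha> * z\<^sup>2 - ((\<alpha> * w\<^sup>2 - a)\<^sup>2 - 4 * b)) < e)"
  using assms pnullD unfolding ptors_def by blast

text \<open>With rational w, only z has to be a genuine p-adic number: it is a square root of
  \<alpha> f divided by \<alpha>.\<close>

lemma ptorsI:
  assumes "\<alpha> \<noteq> 0" "psq (\<alpha> * ((\<alpha> * w\<^sup>2 - a)\<^sup>2 - 4 * b))" shows "ptors \<alpha> a b"
proof -
  define f where "f = (\<alpha> * w\<^sup>2 - a)\<^sup>2 - 4 * b"
  obtain t where t: "pcauchy t" "pnull (\<lambda>n. (t n)\<^sup>2 - \<alpha> * f)"
    using assms(2) psq_iff psq_nonzero unfolding f_def by blast
  have "pnull (\<lambda>n. inverse \<alpha> * ((t n)\<^sup>2 - \<alpha> * f))" by (rule pnull_mult[OF pcauchy_const t(2)])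
  then have "pnull (\<lambda>n. \<alpha> * (inverse \<alpha> * t n)\<^sup>2 - f)"
    using assms(1) by (simp add: field_simps power2_eq_square)
  moreover have "pcauchy (\<lambda>n. inverse \<alpha> * t n)" by (intro pcauchy_intros t)
  ultimately show ?thesis unfolding ptors_def f_def
    by (intro disjI2 exI[of _ "\<lambda>_. w"] exI[of _ "\<lambda>n. inverse \<alpha> * t n"] conjI pcauchy_const) assumption+
qed

end

section \<open>Squares and explicit torsor points at odd primes\<close>

locale odd_padic = padic + assumes p_ne_2: "p \<noteq> 2"
begin

lemma odd_p: "odd p" using prime_p p_ne_2 primes_dvd_imp_eq two_is_prime_nat by blast

lemma N_2 [simp]: "N 2 = 1"
proof -
  have "\<not> int p dvd 2" using prime_p p_ne_2 primes_dvd_imp_eq two_is_prime_nat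
    by (metis int_dvd_int_iff of_nat_numeral)
  then show ?thesis using N_of_int_eq_1_iff[of 2] by simp
qed

lemma N_4 [simp]: "N 4 = 1" using N_mult[of 2 2] by simp

lemma N_4p: "N (4 * of_nat p) = 1 / real p" by (simp add: N_mult N_p)

text \<open>At odd p the Hensel radius is |p|, and by discreteness every relative error below 1 lies
  within it. Hence squares can be tested modulo p.\<close>

lemma psq_near:
  assumes "N (x - y) < N y" "psq y" shows "psq x"
proof -
  have y: "y \<noteq> 0" using assms psq_nonzero by auto
  have x: "x \<noteq> 0" using N_eq_of_close[OF assms(1)] y by auto
  have "x / y / 1\<^sup>2 - 1 = (x - y) / y" using y by (simp add: field_simps)
  then have "N (x / y / 1\<^sup>2 - 1) < 1" using assms(1) y by (simp add: N_divide divide_less_eq)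
  then have "psq (x / y)" unfolding psq_def N_4p using N_less_1_imp x y
    by (intro conjI exI[of _ 1]) auto
  from psq_mult[OF this assms(2)] show ?thesis using y by simp
qed

lemma near_sym: "N (x - y) < N y \<Longrightarrow> N (y - x) < N x"
  using N_eq_of_close[of x y] N_minus_commute[of x y] by simp

lemma psq_near_iff: "N (x - y) < N y \<Longrightarrow> psq x \<longleftrightarrow> psq y"
  using psq_near[of x y] psq_near[of y x] near_sym by blast

lemma near_mult: "c \<noteq> 0 \<Longrightarrow> N (x - y) < N y \<Longrightarrow> N (c * x - c * y) < N (c * y)"
  unfolding right_diff_distrib[symmetric] N_mult by simp

lemma psq_obtain_near:
  assumes "psq x" obtains s where "s \<noteq> 0" "N (x - s\<^sup>2) < N (s\<^sup>2)"
proof -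
  obtain s where s: "s \<noteq> 0" "N (x / s\<^sup>2 - 1) \<le> N (4 * of_nat p)" using assms unfolding psq_def by blast
  have "x - s\<^sup>2 = s\<^sup>2 * (x / s\<^sup>2 - 1)" using s by (simp add: field_simps)
  then have "N (x - s\<^sup>2) = N (s\<^sup>2) * N (x / s\<^sup>2 - 1)" by (simp only: N_mult)
  also have "\<dots> < N (s\<^sup>2) * 1" using s N_2p_less by (intro mult_strict_left_mono) auto
  finally show ?thesis using that s by simp
qed

text \<open>The point of the torsor with \<open>z = 0\<close>, where \<open>\<alpha> w\<^sup>2 = a + 2 \<surd>b\<close> and \<open>r\<close> approximates \<open>\<surd>b\<close>.\<close>

lemma ptorsI_root:
  assumes "\<alpha> \<noteq> 0" "r \<noteq> 0" "N (r\<^sup>2 - b) < N (r\<^sup>2)" "N r \<le> N (a + 2 * r)" "psq (\<alpha> * (a + 2 * r))"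
  shows "ptors \<alpha> a b"
proof -
  have "b / r\<^sup>2 - 1 = (b - r\<^sup>2) / r\<^sup>2" using assms(2) by (simp add: field_simps)
  then have "N (b / r\<^sup>2 - 1) < 1"
    using assms(2,3) by (simp add: N_divide divide_less_eq N_minus_commute)
  then have "N (b / r\<^sup>2 - 1) \<le> N (4 * of_nat p)" unfolding N_4p by (rule N_less_1_imp)
  then obtain t where t: "pcauchy t" "pnull (\<lambda>n. (t n)\<^sup>2 - b / r\<^sup>2)" "\<And>n. N (t n - 1) \<le> N (2 * of_nat p)"
    using hensel_seq[of "\<lambda>_. b / r\<^sup>2"] by blast
  define \<beta> where "\<beta> n = a + 2 * (r * t n)" for n
  have \<beta>: "pcauchy \<beta>" unfolding \<beta>_def by (intro pcauchy_intros t)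
  have near: "N (\<beta> n - (a + 2 * r)) < N (a + 2 * r)" for n
  proof -
    have "\<beta> n - (a + 2 * r) = 2 * (r * (t n - 1))" by (simp add: \<beta>_def algebra_simps)
    then have "N (\<beta> n - (a + 2 * r)) = N r * N (t n - 1)" by (simp add: N_mult)
    also have "\<dots> < N r * 1" using assms(2) t(3)[of n] N_2p_less(2) by (intro mult_strict_left_mono) auto
    finally show ?thesis using assms(4) by simp
  qed
  obtain c where c: "c \<noteq> 0" "N (\<alpha> * (a + 2 * r) - c\<^sup>2) < N (c\<^sup>2)"
    using psq_obtain_near[OF assms(5)] by blast
  have "N (\<alpha> * \<beta> n / c\<^sup>2 - 1) \<le> N (4 * of_nat p)" for n
  proof -
    have e: "N (\<alpha> * (a + 2 * r)) = N (c\<^sup>2)" using c by (rule_tac N_eq_of_close)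
    have "N (\<alpha> * \<beta> n - \<alpha> * (a + 2 * r)) < N (c\<^sup>2)" using near_mult[OF assms(1) near] e by simp
    then have "N ((\<alpha> * \<beta> n - \<alpha> * (a + 2 * r)) + (\<alpha> * (a + 2 * r) - c\<^sup>2)) < N (c\<^sup>2)"
      using c by (intro N_add_less)
    then have "N (\<alpha> * \<beta> n - c\<^sup>2) < N (c\<^sup>2)" by simp
    moreover have "\<alpha> * \<beta> n / c\<^sup>2 - 1 = (\<alpha> * \<beta> n - c\<^sup>2) / c\<^sup>2" using c by (simp add: field_simps)
    ultimately have "N (\<alpha> * \<beta> n / c\<^sup>2 - 1) < 1" using c by (simp add: N_divide divide_less_eq)
    then show ?thesis unfolding N_4p by (rule N_less_1_imp)
  qed
  moreover have "pcauchy (\<lambda>n. \<alpha> * \<beta> n)" by (intro pcauchy_intros \<beta>)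
  ultimately obtain y where y: "pcauchy y" "pnull (\<lambda>n. (y n)\<^sup>2 - \<alpha> * \<beta> n)"
    using hensel_seq'[of "\<lambda>n. \<alpha> * \<beta> n" c 0] c(1) by blast
  define i where "i = inverse \<alpha>"
  have i: "\<alpha> * i = 1" using assms(1) by (simp add: i_def)
  have rb: "r\<^sup>2 * (b / r\<^sup>2) = b" using assms(2) by simp
  have "pnull (\<lambda>n. ((t n)\<^sup>2 - b / r\<^sup>2) * (- 4 * r\<^sup>2) +
      ((y n)\<^sup>2 - \<alpha> * \<beta> n) * (- 4 * r * t n * i - ((y n)\<^sup>2 - \<alpha> * \<beta> n) * i\<^sup>2))"
    by (intro pnull_add pnull_mult2 t(2) y pcauchy_intros t(1) \<beta>)
  \<comment> \<open>With w = Y/\<alpha> and \<eta> = Y^2 - \<alpha>\<beta> the defect of Y as a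
    square root, \<alpha> w^2 - a equals 2rT + \<eta>/\<alpha>. Squaring and subtracting 4b leaves a
    multiple of T^2 - c and a multiple of \<eta>, both null.\<close>
  moreover have "(T\<^sup>2 - c) * (- 4 * r\<^sup>2) +
      (Y\<^sup>2 - \<alpha> * (a + 2 * (r * T))) * (- 4 * r * T * i - (Y\<^sup>2 - \<alpha> * (a + 2 * (r * T))) * i\<^sup>2)
     = \<alpha> * 0\<^sup>2 - ((\<alpha> * (i * Y)\<^sup>2 - a)\<^sup>2 - 4 * b)" if "r\<^sup>2 * c = b" for T Y c
  proof -
    define \<eta> where "\<eta> = Y\<^sup>2 - \<alpha> * (a + 2 * (r * T))"
    have 1: "\<alpha> * (i * Y)\<^sup>2 = (\<alpha> * i) * (i * Y\<^sup>2)" by (simp add: power2_eq_square)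
    have 2: "i * \<eta> = i * Y\<^sup>2 - (\<alpha> * i) * (a + 2 * (r * T))" by (simp add: \<eta>_def algebra_simps)
    have 3: "\<alpha> * (i * Y)\<^sup>2 - a = 2 * r * T + i * \<eta>" using 1 2 i by simp
    show ?thesis
      unfolding 3 \<eta>_def[symmetric] that[symmetric] by (simp add: power2_eq_square algebra_simps)
  qed
  from this[OF rb] have "((t n)\<^sup>2 - b / r\<^sup>2) * (- 4 * r\<^sup>2) +
      ((y n)\<^sup>2 - \<alpha> * \<beta> n) * (- 4 * r * t n * i - ((y n)\<^sup>2 - \<alpha> * \<beta> n) * i\<^sup>2)
     = \<alpha> * 0\<^sup>2 - ((\<alpha> * (i * y n)\<^sup>2 - a)\<^sup>2 - 4 * b)" for n
    unfolding \<beta>_def by blast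
  ultimately have "pnull (\<lambda>n. \<alpha> * 0\<^sup>2 - ((\<alpha> * (i * y n)\<^sup>2 - a)\<^sup>2 - 4 * b))" by simp
  moreover have "pcauchy (\<lambda>n. i * y n)" by (intro pcauchy_intros y)
  ultimately show ?thesis unfolding ptors_def
    by (intro disjI2 exI[of _ "\<lambda>n. i * y n"] exI[of _ "\<lambda>_. 0"] conjI pcauchy_const) assumption+
qed

end

section \<open>Adjoining a square root\<close>

lemma (in algebraically_closed) exists_sqrt:
  assumes x: "x \<in> carrier L" shows "\<exists>t\<in>carrier L. t \<otimes> t = x"
proof -
  let ?P = "[\<one>, \<zero>, \<ominus> x]"
  have P: "?P \<in> carrier (poly_ring L)"
    using x by (simp add: univ_poly_carrier[symmetric] polynomial_def)
  have "size (roots ?P) = 2"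
    using roots_over_carrier[OF P] unfolding splitted_def by simp
  then obtain t where "t \<in># roots ?P"
    by (metis multiset_nonemptyE size_empty zero_neq_numeral)
  then have "is_root ?P t" using roots_mem_iff_is_root[OF P] by simp
  then have t: "t \<in> carrier L" and "eval ?P t = \<zero>" by (auto simp: is_root_def)
  then have "t \<otimes> t \<ominus> x = \<zero>" using x by (simp add: numeral_2_eq_2 a_minus_def)
  then show ?thesis using t x by (meson m_closed r_right_minus_eq)
qed

definition quad_ext :: "('a, 'b) ring_scheme \<Rightarrow> 'a set \<Rightarrow> 'a \<Rightarrow> 'a set"
  where "quad_ext M F t = {u \<oplus>\<^bsub>M\<^esub> v \<otimes>\<^bsub>M\<^esub> t | u v. u \<in> F \<and> v \<in> F}"


text \<open>If t lies in F, the extension is F itself. Otherwise coordinates with respect to 1, t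
  are unique, conjugation t to -t is an automorphism over F, and 2 being nonzero leaves F as its
  fixed field. Allowing both cases spares the Kummer map a case split on whether the class is
  trivial.\<close>

lemma (in field) quad_ext_galois:
  assumes F: "subfield F R" and two: "\<one> \<oplus> \<one> \<noteq> \<zero>" and t: "t \<in> carrier R" "t \<otimes> t \<in> F"
  shows "finite_galois R F (quad_ext R F t)" "t \<in> quad_ext R F t"
proof -
  note Fr = subfieldE(1)[OF F]
  have Fc [simp]: "\<And>u. u \<in> F \<Longrightarrow> u \<in> carrier R" using subfieldE(3)[OF F] by blast
  have F0 [simp]: "\<zero> \<in> F" and F1 [simp]: "\<one> \<in> F" using subringE(2,3)[OF Fr] by auto
  have Fm [simp]: "\<And>u v. u \<in> F \<Longrightarrow> v \<in> F \<Longrightarrow> u \<otimes> v \<in> F" using subringE(6)[OF Fr] by auto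
  have Fa [simp]: "\<And>u v. u \<in> F \<Longrightarrow> v \<in> F \<Longrightarrow> u \<oplus> v \<in> F" using subringE(7)[OF Fr] by auto
  have Fn [simp]: "\<And>u. u \<in> F \<Longrightarrow> \<ominus> u \<in> F" using subringE(5)[OF Fr] by auto
  have Fs [simp]: "\<And>u v. u \<in> F \<Longrightarrow> v \<in> F \<Longrightarrow> u \<ominus> v \<in> F" by (simp add: a_minus_def)
  have Fi: "\<And>u. u \<in> F \<Longrightarrow> u \<noteq> \<zero> \<Longrightarrow> inv u \<in> F \<and> u \<otimes> inv u = \<one>" using subfield_m_inv[OF F] by blast
  let ?L = "quad_ext R F t"
  have LI: "\<And>u v. u \<in> F \<Longrightarrow> v \<in> F \<Longrightarrow> u \<oplus> v \<otimes> t \<in> ?L" unfolding quad_ext_def by blast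
  have LE: "\<exists>u v. u \<in> F \<and> v \<in> F \<and> x = u \<oplus> v \<otimes> t" if "x \<in> ?L" for x
    using that unfolding quad_ext_def by blast
  have "\<zero> \<oplus> \<one> \<otimes> t \<in> ?L" by (intro LI) auto
  then show tL: "t \<in> ?L" using t by simp
  have FL: "F \<subseteq> ?L"
  proof
    fix u assume "u \<in> F"
    then have "u \<oplus> \<zero> \<otimes> t \<in> ?L" by (intro LI) auto
    then show "u \<in> ?L" using t \<open>u \<in> F\<close> by simp
  qed
  have Lc: "\<And>x. x \<in> ?L \<Longrightarrow> x \<in> carrier R" using t by (auto simp: quad_ext_def)
  have mulform: "(u \<oplus> v \<otimes> t) \<otimes> (u' \<oplus> v' \<otimes> t) = (u \<otimes> u' \<oplus> v \<otimes> v' \<otimes> (t \<otimes> t)) \<oplus> (u \<otimes> v' \<oplus> v \<otimes> u') \<otimes> t"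
    if "u \<in> F" "v \<in> F" "u' \<in> F" "v' \<in> F" for u v u' v' using Fc[OF that(1)] Fc[OF that(2)] Fc[OF that(3)] Fc[OF that(4)] t(1) by algebra
  have addform: "(u \<oplus> v \<otimes> t) \<oplus> (u' \<oplus> v' \<otimes> t) = (u \<oplus> u') \<oplus> (v \<oplus> v') \<otimes> t"
    if "u \<in> F" "v \<in> F" "u' \<in> F" "v' \<in> F" for u v u' v' using Fc[OF that(1)] Fc[OF that(2)] Fc[OF that(3)] Fc[OF that(4)] t(1) by algebra
  have negform: "\<ominus> (u \<oplus> v \<otimes> t) = (\<ominus> u) \<oplus> (\<ominus> v) \<otimes> t"
    if "u \<in> F" "v \<in> F" for u v using Fc[OF that(1)] Fc[OF that(2)] t(1) by algebra
  have Lm: "x \<otimes> y \<in> ?L" if xy: "x \<in> ?L" "y \<in> ?L" for x y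
  proof -
    obtain u v u' v' where uv: "u \<in> F" "v \<in> F" "u' \<in> F" "v' \<in> F" "x = u \<oplus> v \<otimes> t" "y = u' \<oplus> v' \<otimes> t"
      using LE[OF xy(1)] LE[OF xy(2)] by blast
    show ?thesis unfolding uv(5,6) mulform[OF uv(1-4)] using uv t by (intro LI) auto
  qed
  have La: "x \<oplus> y \<in> ?L" if xy: "x \<in> ?L" "y \<in> ?L" for x y
  proof -
    obtain u v u' v' where uv: "u \<in> F" "v \<in> F" "u' \<in> F" "v' \<in> F" "x = u \<oplus> v \<otimes> t" "y = u' \<oplus> v' \<otimes> t"
      using LE[OF xy(1)] LE[OF xy(2)] by blast
    show ?thesis unfolding uv(5,6) addform[OF uv(1-4)] using uv t by (intro LI) auto
  qed
  have Ln: "\<ominus> x \<in> ?L" if x: "x \<in> ?L" for x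
  proof -
    obtain u v where uv: "u \<in> F" "v \<in> F" "x = u \<oplus> v \<otimes> t" using LE[OF x] by blast
    show ?thesis unfolding uv(3) negform[OF uv(1,2)] using uv t by (intro LI) auto
  qed
  have Lring: "subring ?L R" by (rule subringI) (use Lc FL Ln Lm La in auto)
  have "?L = Span F [t, \<one>]"
  proof -
    have "line_extension F \<one> {\<zero>} = F"
      by (intro Set.set_eqI) (auto simp: line_extension_mem_iff)
    then have "Span F [t, \<one>] = line_extension F t F" by simp
    also have "\<dots> = ?L"
    proof (intro Set.set_eqI)
      fix w
      show "w \<in> line_extension F t F \<longleftrightarrow> w \<in> ?L"
        unfolding line_extension_mem_iff quad_ext_def using t by (force simp: a_comm)
    qed
    finally show ?thesis by simp
  qed
  then have fd: "finite_dimension F ?L" using Span_finite_dimension[OF F, of "[t, \<one>]"] t by simp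
  have "subfield ?L R \<and> {x \<in> ?L. \<forall>\<sigma>\<in>relative_auts R F ?L. \<sigma> x = x} \<subseteq> F"
  proof (cases "t \<in> F")
    case True
    then have "?L \<subseteq> F" by (auto simp: quad_ext_def)
    then have "?L = F" using FL by blast
    then show ?thesis using F by auto
  next
    case False
    have zero: "u = \<zero> \<and> v = \<zero>" if "u \<in> F" "v \<in> F" "u \<oplus> v \<otimes> t = \<zero>" for u v
    proof (cases "v = \<zero>")
      case True then show ?thesis using that t by simp
    next
      case v: False
      note vi = Fi[OF that(2) v]
      have "\<ominus> u = v \<otimes> t" using that t by (metis Fc m_closed minus_equality minus_minus)
      then have "inv v \<otimes> (\<ominus> u) = inv v \<otimes> (v \<otimes> t)" by simp
      also have "\<dots> = (v \<otimes> inv v) \<otimes> t" using that(2) vi t(1) Fc by (simp add: m_ac)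
      finally have "t = inv v \<otimes> (\<ominus> u)" using vi t by simp
      then have "t \<in> F" using vi that by simp
      with \<open>t \<notin> F\<close> show ?thesis by blast
    qed
    have uniq: "u = u' \<and> v = v'"
      if "u \<in> F" "v \<in> F" "u' \<in> F" "v' \<in> F" "u \<oplus> v \<otimes> t = u' \<oplus> v' \<otimes> t" for u v u' v'
    proof -
      have "(u \<ominus> u') \<oplus> (v \<ominus> v') \<otimes> t = (u \<oplus> v \<otimes> t) \<ominus> (u' \<oplus> v' \<otimes> t)"
        using Fc[OF that(1)] Fc[OF that(2)] Fc[OF that(3)] Fc[OF that(4)] t(1) by algebra
      also have "\<dots> = \<zero>" using that t by (simp add: r_right_minus_eq)
      finally have "u \<ominus> u' = \<zero> \<and> v \<ominus> v' = \<zero>" using that by (intro zero) auto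
      then show ?thesis using that by (simp add: r_right_minus_eq)
    qed
    have inv_L: "inv x \<in> ?L" if x: "x \<in> ?L - {\<zero>}" for x
    proof -
      obtain u v where uv: "u \<in> F" "v \<in> F" "x = u \<oplus> v \<otimes> t" using LE[of x] x by blast
      \<comment> \<open>The conjugate of \<open>x\<close>. The norm \<open>x \<otimes> y\<close> is
        a nonzero element of F, so the inverse of \<open>x\<close> is \<open>y\<close> divided by
        it.\<close>
      define y where "y = u \<oplus> (\<ominus> v) \<otimes> t"
      have yL: "y \<in> ?L" unfolding y_def using uv by (intro LI) auto
      have "y \<noteq> \<zero>"
      proof
        assume "y = \<zero>"
        then have "u = \<zero> \<and> \<ominus> v = \<zero>" unfolding y_def using uv by (intro zero) auto
        then have "x = \<zero>" using uv t by (metis Fc Fm F0 minus_minus minus_zero l_null l_zero)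
        with x show False by blast
      qed
      have n: "x \<otimes> y = u \<otimes> u \<ominus> v \<otimes> v \<otimes> (t \<otimes> t)"
        unfolding uv(3) y_def using Fc[OF uv(1)] Fc[OF uv(2)] t(1) by algebra
      have nF: "x \<otimes> y \<in> F" unfolding n using uv t by auto
      have xy: "x \<in> carrier R" "y \<in> carrier R" using x yL Lc by auto
      have n0: "x \<otimes> y \<noteq> \<zero>" using \<open>y \<noteq> \<zero>\<close> x xy integral by blast
      note ni = Fi[OF nF n0]
      have "x \<otimes> (y \<otimes> inv (x \<otimes> y)) = \<one>" using ni xy Fc by (simp add: m_assoc[symmetric])
      then have "inv x = y \<otimes> inv (x \<otimes> y)" using xy ni Fc by (metis comm_inv_char m_closed)
      then show ?thesis using yL ni FL Lm by auto
    qed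
    have sub: "subfield ?L R" by (rule subfieldI'[OF Lring inv_L])
    \<comment> \<open>Conjugation. The choice operator extracts the coordinates of \<open>x\<close>,
      which \<open>uniq\<close> shows to be determined.\<close>
    define \<tau> where "\<tau> x = (let (u, v) = SOME (u, v). u \<in> F \<and> v \<in> F \<and> x = u \<oplus> v \<otimes> t in u \<oplus> (\<ominus> v) \<otimes> t)" for x
    have \<tau>: "\<tau> (u \<oplus> v \<otimes> t) = u \<oplus> (\<ominus> v) \<otimes> t" if uv: "u \<in> F" "v \<in> F" for u v
    proof -
      have "(SOME (u', v'). u' \<in> F \<and> v' \<in> F \<and> u \<oplus> v \<otimes> t = u' \<oplus> v' \<otimes> t) = (u, v)"
        by (rule some_equality) (use uv uniq in auto)
      then show ?thesis by (simp add: \<tau>_def)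
    qed
    have \<tau>L: "\<tau> x \<in> ?L" if "x \<in> ?L" for x
      using LE[OF that] LI \<tau> by auto
    have \<tau>\<tau>: "\<tau> (\<tau> x) = x" if "x \<in> ?L" for x
      using LE[OF that] \<tau> by (auto simp: \<tau>)
    have \<tau>F: "\<tau> u = u" if "u \<in> F" for u
      using \<tau>[OF that F0] that t by simp
    have "\<tau> \<in> ring_iso (R\<lparr>carrier := ?L\<rparr>) (R\<lparr>carrier := ?L\<rparr>)"
    proof (rule ring_iso_memI)
      fix x y assume "x \<in> carrier (R\<lparr>carrier := ?L\<rparr>)" "y \<in> carrier (R\<lparr>carrier := ?L\<rparr>)"
      then have "x \<in> ?L" "y \<in> ?L" by auto
      then obtain u v u' v' where uv: "u \<in> F" "v \<in> F" "u' \<in> F" "v' \<in> F" "x = u \<oplus> v \<otimes> t" "y = u' \<oplus> v' \<otimes> t"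
        using LE[of x] LE[of y] by blast
      note c = Fc[OF uv(1)] Fc[OF uv(2)] Fc[OF uv(3)] Fc[OF uv(4)] t(1)
      have "\<tau> (x \<otimes> y) = (u \<otimes> u' \<oplus> v \<otimes> v' \<otimes> (t \<otimes> t)) \<oplus> (\<ominus> (u \<otimes> v' \<oplus> v \<otimes> u')) \<otimes> t"
        unfolding uv(5,6) mulform[OF uv(1-4)] using uv t by (intro \<tau>) auto
      also have "\<dots> = (u \<oplus> (\<ominus> v) \<otimes> t) \<otimes> (u' \<oplus> (\<ominus> v') \<otimes> t)" using c by algebra
      finally show "\<tau> (x \<otimes>\<^bsub>R\<lparr>carrier := ?L\<rparr>\<^esub> y) = \<tau> x \<otimes>\<^bsub>R\<lparr>carrier := ?L\<rparr>\<^esub> \<tau> y"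
        using uv by (simp add: \<tau>)
      have "\<tau> (x \<oplus> y) = (u \<oplus> u') \<oplus> (\<ominus> (v \<oplus> v')) \<otimes> t"
        unfolding uv(5,6) addform[OF uv(1-4)] using uv t by (intro \<tau>) auto
      also have "\<dots> = (u \<oplus> (\<ominus> v) \<otimes> t) \<oplus> (u' \<oplus> (\<ominus> v') \<otimes> t)" using c by algebra
      finally show "\<tau> (x \<oplus>\<^bsub>R\<lparr>carrier := ?L\<rparr>\<^esub> y) = \<tau> x \<oplus>\<^bsub>R\<lparr>carrier := ?L\<rparr>\<^esub> \<tau> y"
        using uv by (simp add: \<tau>)
    next
      show "bij_betw \<tau> (carrier (R\<lparr>carrier := ?L\<rparr>)) (carrier (R\<lparr>carrier := ?L\<rparr>))"
        by (rule bij_betw_byWitness[where f' = \<tau>]) (use \<tau>L \<tau>\<tau> in auto)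
    qed (use \<tau>L \<tau>F in auto)
    then have \<tau>aut: "\<tau> \<in> relative_auts R F ?L" using \<tau>F by (simp add: relative_auts_def)
    have "x \<in> F" if x: "x \<in> ?L" "\<tau> x = x" for x
    proof -
      obtain u v where uv: "u \<in> F" "v \<in> F" "x = u \<oplus> v \<otimes> t" using LE[OF x(1)] by blast
      then have "\<ominus> v = v" using uniq[of u "\<ominus> v" u v] \<tau>[OF uv(1,2)] x(2) by auto
      then have "v \<oplus> v = \<zero>" using uv by (metis Fc r_neg)
      then have "(\<one> \<oplus> \<one>) \<otimes> v = \<zero>" using uv by (simp add: l_distr)
      then have "v = \<zero>" using two uv integral[of "\<one> \<oplus> \<one>" v] by auto
      then show ?thesis using uv t by simp
    qed
    then show ?thesis using sub \<tau>aut by blast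
  qed
  moreover have "F \<subseteq> {x \<in> ?L. \<forall>\<sigma>\<in>relative_auts R F ?L. \<sigma> x = x}"
    using FL by (auto simp: relative_auts_def)
  ultimately show "finite_galois R F ?L"
    unfolding finite_galois_def using F FL fd by blast
qed

section \<open>The Kummer map\<close>

lemma relative_autsD:
  assumes "\<sigma> \<in> relative_auts M F L"
  shows "x \<in> L \<Longrightarrow> \<sigma> x \<in> L" "x \<in> L \<Longrightarrow> y \<in> L \<Longrightarrow> \<sigma> (x \<otimes>\<^bsub>M\<^esub> y) = \<sigma> x \<otimes>\<^bsub>M\<^esub> \<sigma> y"
    "x \<in> L \<Longrightarrow> y \<in> L \<Longrightarrow> \<sigma> (x \<oplus>\<^bsub>M\<^esub> y) = \<sigma> x \<oplus>\<^bsub>M\<^esub> \<sigma> y" "x \<in> F \<Longrightarrow> \<sigma> x = x"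
proof -
  have h: "\<sigma> \<in> ring_hom (M\<lparr>carrier := L\<rparr>) (M\<lparr>carrier := L\<rparr>)" and f: "\<forall>x\<in>F. \<sigma> x = x"
    using assms by (auto simp: relative_auts_def ring_iso_def)
  show "x \<in> L \<Longrightarrow> \<sigma> x \<in> L" "x \<in> L \<Longrightarrow> y \<in> L \<Longrightarrow> \<sigma> (x \<otimes>\<^bsub>M\<^esub> y) = \<sigma> x \<otimes>\<^bsub>M\<^esub> \<sigma> y"
    "x \<in> L \<Longrightarrow> y \<in> L \<Longrightarrow> \<sigma> (x \<oplus>\<^bsub>M\<^esub> y) = \<sigma> x \<oplus>\<^bsub>M\<^esub> \<sigma> y" "x \<in> F \<Longrightarrow> \<sigma> x = x"
    using ring_hom_closed[OF h, of x] ring_hom_mult[OF h, of x y] ring_hom_add[OF h, of x y] f by auto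
qed

text \<open>Off the kernel of the dual isogeny this is the x-coordinate. The value at (0,0) fits
  because x (x^2 - 2ax + a^2 - 4b) is a square on the curve: x and the second factor have the same
  class, and the latter is a^2 - 4b at x = 0.\<close>

definition kcls :: "('k, 'm) ring_scheme \<Rightarrow> 'k \<Rightarrow> 'k \<Rightarrow> 'k point \<Rightarrow> 'k"
  where "kcls K a b P = (case P of Infinity \<Rightarrow> \<one>\<^bsub>K\<^esub>
    | Affine x y \<Rightarrow> if x = \<zero>\<^bsub>K\<^esub> then isog_b K a b else x)"

section \<open>Preimages under the isogeny and the square root they generate\<close>

context field begin

lemma double_cancel:
  assumes "\<one> \<oplus> \<one> \<noteq> \<zero>" "x \<in> carrier R" "y \<in> carrier R" "x \<oplus> x = y \<oplus> y" shows "x = y"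
proof -
  have "(\<one> \<oplus> \<one>) \<otimes> (x \<ominus> y) = (x \<oplus> x) \<ominus> (y \<oplus> y)" using assms(2,3) by algebra
  also have "\<dots> = \<zero>" using assms by (simp add: r_right_minus_eq)
  finally have "x \<ominus> y = \<zero>" using assms integral[of "\<one> \<oplus> \<one>" "x \<ominus> y"] by auto
  then show ?thesis using assms by (simp add: r_right_minus_eq)
qed

lemma mult_cancel:
  assumes "x \<noteq> \<zero>" "x \<in> carrier R" "y \<in> carrier R" "z \<in> carrier R" "x \<otimes> y = x \<otimes> z" shows "y = z"
proof -
  have "x \<otimes> (y \<ominus> z) = x \<otimes> y \<ominus> x \<otimes> z" using assms(2-4) by algebra
  also have "\<dots> = \<zero>" using assms by (simp add: r_right_minus_eq)
  finally have "y \<ominus> z = \<zero>" using assms integral[of x "y \<ominus> z"] by auto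
  then show ?thesis using assms by (simp add: r_right_minus_eq)
qed

lemma inv_nonzero:
  assumes "x \<in> carrier R" "x \<noteq> \<zero>" shows "inv x \<in> carrier R" "x \<otimes> inv x = \<one>"
  using assms field_Units by auto

lemma square_eq_zero: "x \<in> carrier R \<Longrightarrow> x \<otimes> x = \<zero> \<Longrightarrow> x = \<zero>"
  using integral by blast

lemma inv_square: "x \<in> carrier R \<Longrightarrow> x \<noteq> \<zero> \<Longrightarrow> inv (x \<otimes> x) = inv x \<otimes> inv x"
proof -
  assume x: "x \<in> carrier R" "x \<noteq> \<zero>"
  note i = inv_nonzero[OF x]
  have "(x \<otimes> x) \<otimes> (inv x \<otimes> inv x) = (x \<otimes> inv x) \<otimes> (x \<otimes> inv x)" using x i(1) by algebra
  then have "(x \<otimes> x) \<otimes> (inv x \<otimes> inv x) = \<one>" by (simp only: i(2) r_one one_closed)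
  moreover have "x \<otimes> x \<in> carrier R" "inv x \<otimes> inv x \<in> carrier R" using i x by auto
  ultimately show ?thesis using comm_inv_char by blast
qed

lemma add_pow_2: "x \<in> carrier R \<Longrightarrow> [(2::nat)] \<cdot> x = x \<oplus> x"
  by (simp add: numeral_2_eq_2)
lemma add_pow_4: "x \<in> carrier R \<Longrightarrow> [(4::nat)] \<cdot> x = x \<oplus> x \<oplus> x \<oplus> x"
  by (simp add: numeral_eq_Suc)

text \<open>For Q = (u, w) over P = (x, y) with x nonzero, t = w/u has square x, and u is recovered
  rationally from t by t (x - a - 2u) = y; so an automorphism over F fixes Q exactly when it fixes
  t. Over (0,0) the role of t is played by 2u + a, and over infinity, where both preimages are
  rational, by 1. This compares the cocycle of Q with that of t.\<close>

lemma isogeny_preimage: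
  assumes two: "\<one> \<oplus> \<one> \<noteq> \<zero>" and sub: "subfield F R" "subfield L R" "F \<subseteq> L"
    and ab: "a \<in> F" "b \<in> F" and Q: "Q \<in> points (R\<lparr>carrier := L\<rparr>) a b" and P: "isogeny R b Q = P"
    and PF: "\<And>x y. P = Affine x y \<Longrightarrow> x \<in> F \<and> y \<in> F"
  shows "\<exists>t\<in>L. t \<otimes> t = kcls R a b P \<and> (\<forall>\<sigma>\<in>relative_auts R F L. map_point \<sigma> Q = Q \<longleftrightarrow> \<sigma> t = t)"
proof -
  note Lr = subfieldE(1)[OF sub(2)]
  have Lc: "\<And>u. u \<in> L \<Longrightarrow> u \<in> carrier R" using subfieldE(3)[OF sub(2)] by blast
  have L1: "\<one> \<in> L" using subringE(3)[OF Lr] by auto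
  have F01: "\<zero> \<in> F" "\<one> \<in> F" using subringE(2,3)[OF subfieldE(1)[OF sub(1)]] by auto
  have abL: "a \<in> L" "b \<in> L" using ab sub by auto
  have abc: "a \<in> carrier R" "b \<in> carrier R" using abL Lc by auto
  show ?thesis
  proof (cases Q)
    case Infinity
    then have "P = Infinity" using P by auto
    then show ?thesis using Infinity L1 F01 by (intro bexI[of _ \<one>]) (auto simp: kcls_def dest: relative_autsD(4))
  next
    case (Affine u w)
    have uw: "u \<in> L" "w \<in> L" and eq: "w \<otimes> w = u \<otimes> (u \<otimes> u \<oplus> a \<otimes> u \<oplus> b)"
      using Q Affine by (auto simp: points_def)
    note c = Lc[OF uw(1)] Lc[OF uw(2)] abc
    show ?thesis
    proof (cases "u = \<zero>")
      case True
      have "\<zero> \<otimes> (\<zero> \<otimes> \<zero> \<oplus> a \<otimes> \<zero> \<oplus> b) = \<zero>" using abc by simp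
      then have "w \<otimes> w = \<zero>" using eq unfolding True by simp
      then have "w = \<zero>" by (rule square_eq_zero[OF c(2)])
      moreover have "P = Infinity" using True P Affine by auto
      ultimately show ?thesis using Affine True L1 F01
        by (intro bexI[of _ \<one>]) (auto simp: kcls_def dest: relative_autsD(4))
    next
      case False
      define i where "i = inv u"
      have i: "i \<in> L" "u \<otimes> i = \<one>"
        using subfield_m_inv[OF sub(2), of u] uw False by (auto simp: i_def)
      have ic: "i \<in> carrier R" using i Lc by blast
      obtain x y where P': "P = Affine x y" "x = w \<otimes> w \<otimes> inv (u \<otimes> u)" "y = w \<otimes> (b \<ominus> u \<otimes> u) \<otimes> inv (u \<otimes> u)"
        using P Affine False by auto
      have xyF: "x \<in> F" "y \<in> F" using PF[OF P'(1)] by auto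
      then have xyc: "x \<in> carrier R" "y \<in> carrier R" using sub Lc by auto
      have x: "x = w \<otimes> w \<otimes> (i \<otimes> i)" and y: "y = w \<otimes> (b \<ominus> u \<otimes> u) \<otimes> (i \<otimes> i)"
        using P'(2,3) inv_square[OF c(1) False] by (auto simp: i_def)
      show ?thesis
      proof (cases "x = \<zero>")
        case x0: True
        have "(u \<otimes> i) \<otimes> (u \<otimes> i) \<otimes> (w \<otimes> w) = (u \<otimes> u) \<otimes> (w \<otimes> w \<otimes> (i \<otimes> i))" using c ic by algebra
        also have "w \<otimes> w \<otimes> (i \<otimes> i) = \<zero>" unfolding x[symmetric] by (rule x0)
        also have "u \<otimes> u \<otimes> \<zero> = \<zero>" using c by simp
        finally have ww: "w \<otimes> w = \<zero>" using i c by simp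
        then have w: "w = \<zero>" using c square_eq_zero by blast
        have q: "u \<otimes> u \<oplus> a \<otimes> u \<oplus> b = \<zero>"
          using eq ww False c integral[of u "u \<otimes> u \<oplus> a \<otimes> u \<oplus> b"] by auto
        \<comment> \<open>Here u is a root of X^2 + aX + b, so 2u + a is a square root of its
          discriminant.\<close>
        define t where "t = u \<oplus> u \<oplus> a"
        have tL: "t \<in> L" unfolding t_def using uw abL subringE(7)[OF Lr] by auto
        have m: "u \<otimes> u \<oplus> a \<otimes> u = \<ominus> b" using q c by (metis a_closed m_closed minus_equality minus_minus)
        have "t \<otimes> t = a \<otimes> a \<oplus> ((u \<otimes> u \<oplus> a \<otimes> u) \<oplus> (u \<otimes> u \<oplus> a \<otimes> u) \<oplus> (u \<otimes> u \<oplus> a \<otimes> u) \<oplus> (u \<otimes> u \<oplus> a \<otimes> u))"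
          unfolding t_def using c by algebra
        also have "\<dots> = a \<otimes> a \<ominus> (b \<oplus> b \<oplus> b \<oplus> b)" unfolding m using abc by algebra
        finally have "t \<otimes> t = isog_b R a b" using c by (simp add: isog_b_def add_pow_4)
        moreover have "map_point \<sigma> Q = Q \<longleftrightarrow> \<sigma> t = t" if \<sigma>: "\<sigma> \<in> relative_auts R F L" for \<sigma>
        proof -
          have su: "\<sigma> u \<in> carrier R" using relative_autsD(1)[OF \<sigma>] uw Lc by blast
          have "\<sigma> t = \<sigma> u \<oplus> \<sigma> u \<oplus> a"
            unfolding t_def using relative_autsD[OF \<sigma>] uw ab abL subringE(7)[OF Lr] by auto
          then have "\<sigma> t = t \<longleftrightarrow> \<sigma> u \<oplus> \<sigma> u = u \<oplus> u"
            unfolding t_def using su c by (metis a_closed add.r_cancel)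
          also have "\<dots> \<longleftrightarrow> \<sigma> u = u" using double_cancel[OF two su c(1)] by auto
          also have "\<dots> \<longleftrightarrow> map_point \<sigma> Q = Q" using Affine w relative_autsD(4)[OF \<sigma>] F01 by auto
          finally show ?thesis by simp
        qed
        ultimately show ?thesis using P' x0 tL by (intro bexI[of _ t]) (auto simp: kcls_def)
      next
        case x0: False
        define t where "t = w \<otimes> i"
        have tL: "t \<in> L" unfolding t_def using uw i subringE(6)[OF Lr] by auto
        then have tc: "t \<in> carrier R" using Lc by blast
        have tt: "t \<otimes> t = x" unfolding t_def x using c ic by algebra
        then have t0: "t \<noteq> \<zero>" using x0 tc by auto
        have tu: "t \<otimes> u = w"
        proof -
          have "t \<otimes> u = w \<otimes> (u \<otimes> i)" unfolding t_def using c ic by algebra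
          then show ?thesis using i c by simp
        qed
        \<comment> \<open>The curve equation gives x = u + a + b/u, hence x - a - 2u = b/u - u,
          while y = t (b/u - u) by the formula of the isogeny.\<close>
        have key: "t \<otimes> (x \<ominus> a \<ominus> (u \<oplus> u)) = y"
        proof -
          have uui: "u \<otimes> u \<otimes> i = u" "a \<otimes> u \<otimes> i = a" using i c ic by (simp_all add: m_assoc)
          have "x = (u \<otimes> i) \<otimes> ((u \<otimes> u \<oplus> a \<otimes> u \<oplus> b) \<otimes> i)" unfolding x eq using c ic by algebra
          also have "\<dots> = (u \<otimes> u \<oplus> a \<otimes> u \<oplus> b) \<otimes> i" using i c ic by simp
          also have "\<dots> = u \<otimes> u \<otimes> i \<oplus> a \<otimes> u \<otimes> i \<oplus> b \<otimes> i" using c ic by algebra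
          also have "\<dots> = u \<oplus> a \<oplus> b \<otimes> i" by (simp only: uui)
          finally have "x \<ominus> a \<ominus> (u \<oplus> u) = u \<oplus> a \<oplus> b \<otimes> i \<ominus> a \<ominus> (u \<oplus> u)" by simp
          also have "\<dots> = b \<otimes> i \<ominus> u" using c ic by algebra
          finally have 1: "t \<otimes> (x \<ominus> a \<ominus> (u \<oplus> u)) = t \<otimes> (b \<otimes> i \<ominus> u)" by simp
          have "y = t \<otimes> (b \<otimes> i \<ominus> u \<otimes> u \<otimes> i)" unfolding y t_def using c ic by algebra
          then show ?thesis using 1 uui by simp
        qed
        have "map_point \<sigma> Q = Q \<longleftrightarrow> \<sigma> t = t" if \<sigma>: "\<sigma> \<in> relative_auts R F L" for \<sigma>
        proof -
          have sc: "\<sigma> u \<in> carrier R" "\<sigma> w \<in> carrier R" "\<sigma> t \<in> carrier R"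
            using relative_autsD(1)[OF \<sigma>] uw tL Lc by blast+
          have stu: "\<sigma> t \<otimes> \<sigma> u = \<sigma> w" using relative_autsD(2)[OF \<sigma> tL uw(1)] tu by simp
          have "\<sigma> u = u \<and> \<sigma> w = w \<longleftrightarrow> \<sigma> t = t"
          proof
            assume h: "\<sigma> u = u \<and> \<sigma> w = w"
            then have "u \<otimes> \<sigma> t = u \<otimes> t" using stu tu sc c tc by (simp add: m_comm)
            then show "\<sigma> t = t" using mult_cancel[OF False] c sc tc by blast
          next
            assume h: "\<sigma> t = t"
            define z where "z = x \<ominus> a \<ominus> (u \<oplus> u)"
            have "z \<oplus> (u \<oplus> u) = x \<ominus> a" unfolding z_def using c xyc by algebra
            have zL: "z \<in> L" unfolding z_def using xyF sub abL uw subringE[OF Lr] by (simp add: a_minus_def subset_iff)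
            have zc: "z \<in> carrier R" using zL Lc by blast
            have "t \<otimes> \<sigma> z = \<sigma> y" using relative_autsD(2)[OF \<sigma> tL zL] key h unfolding z_def by simp
            then have "t \<otimes> \<sigma> z = t \<otimes> z" using key relative_autsD(4)[OF \<sigma>] xyF unfolding z_def by simp
            then have sz: "\<sigma> z = z" using mult_cancel[OF t0 tc _ zc] relative_autsD(1)[OF \<sigma> zL] Lc by blast
            have xaF: "x \<ominus> a \<in> F" using xyF ab subringE[OF subfieldE(1)[OF sub(1)]] by (simp add: a_minus_def)
            have "\<sigma> z \<oplus> (\<sigma> u \<oplus> \<sigma> u) = \<sigma> (z \<oplus> (u \<oplus> u))"
              using relative_autsD(3)[OF \<sigma>] zL uw subringE(7)[OF Lr] by auto
            also have "\<dots> = z \<oplus> (u \<oplus> u)"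
              using \<open>z \<oplus> (u \<oplus> u) = x \<ominus> a\<close> relative_autsD(4)[OF \<sigma> xaF] by simp
            finally have "\<sigma> u \<oplus> \<sigma> u = u \<oplus> u" using sz zc sc c by simp
            then have "\<sigma> u = u" using double_cancel[OF two] sc c by blast
            then show "\<sigma> u = u \<and> \<sigma> w = w" using stu tu h by simp
          qed
          then show ?thesis using Affine by simp
        qed
        then show ?thesis using P' x0 tt tL by (intro bexI[of _ t]) (auto simp: kcls_def)
      qed
    qed
  qed
qed

text \<open>For x nonzero, a preimage has first coordinate u with u + b/u = x - a. The discriminant
  (x - a)^2 - 4b of this quadratic equals (y/t)^2, so both roots lie in L; u is the root with sign
  -y/t because b/u - u must equal +y/t. For x = 0 the root (t - a)/2 of X^2 + aX + b serves.\<close>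

lemma isogeny_surj:
  assumes two: "\<one> \<oplus> \<one> \<noteq> \<zero>" and sub: "subfield L R"
    and ab: "a \<in> L" "b \<in> L" "b \<noteq> \<zero>" and P: "P \<in> points (R\<lparr>carrier := L\<rparr>) (isog_a R a) (isog_b R a b)"
    and t: "t \<in> L" "t \<otimes> t = kcls R a b P"
  shows "\<exists>Q\<in>points (R\<lparr>carrier := L\<rparr>) a b. isogeny R b Q = P"
proof (cases P)
  case Infinity
  then show ?thesis by (intro bexI[of _ Infinity]) (auto simp: points_def)
next
  case (Affine x y)
  note Lr = subfieldE(1)[OF sub]
  have Lc: "\<And>u. u \<in> L \<Longrightarrow> u \<in> carrier R" using subfieldE(3)[OF sub] by blast
  have L1: "\<one> \<oplus> \<one> \<in> L" "\<zero> \<in> L" using subringE(2,3,7)[OF Lr] by auto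
  define h where "h = inv (\<one> \<oplus> \<one>)"
  have h: "h \<in> L" "(\<one> \<oplus> \<one>) \<otimes> h = \<one>" using subfield_m_inv[OF sub, of "\<one> \<oplus> \<one>"] L1 two by (auto simp: h_def)
  have hc: "h \<in> carrier R" using h Lc by blast
  have hh: "h \<oplus> h = \<one>" using h hc by (simp add: l_distr)
  have xy: "x \<in> L" "y \<in> L" and eq: "y \<otimes> y = x \<otimes> (x \<otimes> x \<oplus> isog_a R a \<otimes> x \<oplus> isog_b R a b)"
    using P Affine by (auto simp: points_def)
  note c = Lc[OF ab(1)] Lc[OF ab(2)] Lc[OF xy(1)] Lc[OF xy(2)] Lc[OF t(1)] hc
  have B: "isog_b R a b = a \<otimes> a \<ominus> (b \<oplus> b \<oplus> b \<oplus> b)" "isog_a R a = \<ominus> (a \<oplus> a)"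
    using c by (simp_all add: isog_b_def isog_a_def add_pow_4 add_pow_2)
  have four: "z = h \<otimes> h \<otimes> (z \<oplus> z \<oplus> z \<oplus> z)" if "z \<in> carrier R" for z
  proof -
    have "(h \<oplus> h) \<otimes> (h \<oplus> h) \<otimes> z = h \<otimes> h \<otimes> (z \<oplus> z \<oplus> z \<oplus> z)" using that hc by algebra
    then show ?thesis using hh that by simp
  qed
  show ?thesis
  proof (cases "x = \<zero>")
    case True
    have "\<zero> \<otimes> (\<zero> \<otimes> \<zero> \<oplus> isog_a R a \<otimes> \<zero> \<oplus> isog_b R a b) = \<zero>" unfolding B using c by simp
    then have "y \<otimes> y = \<zero>" using eq unfolding True by simp
    then have "y = \<zero>" by (rule square_eq_zero[OF c(4)])
    have tt: "t \<otimes> t = a \<otimes> a \<ominus> (b \<oplus> b \<oplus> b \<oplus> b)" using t Affine True B by (simp add: kcls_def)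
    define u where "u = h \<otimes> (t \<ominus> a)"
    have uL: "u \<in> L" unfolding u_def using h t ab subringE[OF Lr] by (simp add: a_minus_def)
    have uc: "u \<in> carrier R" using uL Lc by blast
    have "u \<otimes> u \<oplus> a \<otimes> u \<oplus> b = h \<otimes> h \<otimes> (t \<ominus> a) \<otimes> (t \<ominus> a) \<oplus> (h \<oplus> h) \<otimes> h \<otimes> (a \<otimes> (t \<ominus> a)) \<oplus> h \<otimes> h \<otimes> (b \<oplus> b \<oplus> b \<oplus> b)"
    proof -
      have "a \<otimes> u = (h \<oplus> h) \<otimes> h \<otimes> (a \<otimes> (t \<ominus> a))" unfolding hh u_def using c by algebra
      moreover have "u \<otimes> u = h \<otimes> h \<otimes> (t \<ominus> a) \<otimes> (t \<ominus> a)" unfolding u_def using c by algebra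
      ultimately show ?thesis using four[OF c(2)] by simp
    qed
    also have "\<dots> = h \<otimes> h \<otimes> (t \<otimes> t \<ominus> a \<otimes> a \<oplus> (b \<oplus> b \<oplus> b \<oplus> b))" using c by algebra
    also have "\<dots> = \<zero>" unfolding tt using c by algebra
    finally have q: "u \<otimes> u \<oplus> a \<otimes> u \<oplus> b = \<zero>" .
    then have u0: "u \<noteq> \<zero>" using ab(3) c by auto
    have "Affine u \<zero> \<in> points (R\<lparr>carrier := L\<rparr>) a b" using uL L1 q uc by (auto simp: points_def)
    moreover have "isogeny R b (Affine u \<zero>) = P"
      using u0 Affine True \<open>y = \<zero>\<close> uc c inv_nonzero[OF uc u0] by (simp add: inv_square)
    ultimately show ?thesis by blast
  next
    case False
    have tt: "t \<otimes> t = x" using t Affine False by (simp add: kcls_def)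
    then have t0: "t \<noteq> \<zero>" using False c by auto
    define g where "g = inv t"
    have g: "g \<in> L" "t \<otimes> g = \<one>" using subfield_m_inv[OF sub, of t] t t0 by (auto simp: g_def)
    have gc: "g \<in> carrier R" using g Lc by blast
    define e where "e = y \<otimes> g"
    have eL: "e \<in> L" unfolding e_def using xy g subringE[OF Lr] by simp
    have ec: "e \<in> carrier R" using eL Lc by blast
    have te: "t \<otimes> e = y"
    proof -
      have "t \<otimes> e = (t \<otimes> g) \<otimes> y" unfolding e_def using c gc by algebra
      then show ?thesis using g c by simp
    qed
    have ee: "e \<otimes> e = (x \<ominus> a) \<otimes> (x \<ominus> a) \<ominus> (b \<oplus> b \<oplus> b \<oplus> b)"
    proof -
      have "x \<otimes> (e \<otimes> e) = (t \<otimes> e) \<otimes> (t \<otimes> e)" unfolding tt[symmetric] using c ec by algebra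
      also have "\<dots> = y \<otimes> y" by (simp add: te)
      also have "\<dots> = x \<otimes> ((x \<ominus> a) \<otimes> (x \<ominus> a) \<ominus> (b \<oplus> b \<oplus> b \<oplus> b))" unfolding eq B using c by algebra
      finally show ?thesis using mult_cancel[OF False c(3)] ec c by simp
    qed
    define u u' where "u = h \<otimes> (x \<ominus> a \<ominus> e)" and "u' = h \<otimes> (x \<ominus> a \<oplus> e)"
    have uL: "u \<in> L" "u' \<in> L" unfolding u_def u'_def using h xy ab eL subringE[OF Lr] by (simp_all add: a_minus_def)
    have uc: "u \<in> carrier R" "u' \<in> carrier R" using uL Lc by blast+
    have uu': "u \<otimes> u' = b"
    proof -
      have "u \<otimes> u' = h \<otimes> h \<otimes> ((x \<ominus> a) \<otimes> (x \<ominus> a) \<ominus> e \<otimes> e)" unfolding u_def u'_def using c ec by algebra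
      also have "\<dots> = h \<otimes> h \<otimes> (b \<oplus> b \<oplus> b \<oplus> b)" unfolding ee using c by algebra
      finally show ?thesis using four[OF c(2)] by simp
    qed
    have sum: "u \<oplus> u' = x \<ominus> a"
    proof -
      have "u \<oplus> u' = (h \<oplus> h) \<otimes> (x \<ominus> a)" unfolding u_def u'_def using c ec by algebra
      then show ?thesis using hh c by simp
    qed
    have diff: "u' \<ominus> u = e"
    proof -
      have "u' \<ominus> u = (h \<oplus> h) \<otimes> e" unfolding u_def u'_def using c ec by algebra
      then show ?thesis using hh ec by simp
    qed
    have u0: "u \<noteq> \<zero>" using uu' ab(3) uc by auto
    have quad: "u \<otimes> u \<oplus> a \<otimes> u \<oplus> b = x \<otimes> u"
    proof -
      have "x \<otimes> u = (u \<oplus> u') \<otimes> u \<oplus> a \<otimes> u" unfolding sum using c uc by algebra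
      also have "\<dots> = u \<otimes> u \<oplus> a \<otimes> u \<oplus> u \<otimes> u'" using c uc by algebra
      finally show ?thesis unfolding uu' by simp
    qed
    define w where "w = t \<otimes> u"
    have wL: "w \<in> L" unfolding w_def using t uL subringE[OF Lr] by simp
    have ww: "w \<otimes> w = u \<otimes> (x \<otimes> u)" unfolding w_def tt[symmetric] using c uc by algebra
    have Q: "Affine u w \<in> points (R\<lparr>carrier := L\<rparr>) a b" using uL wL quad ww by (auto simp: points_def)
    define j where "j = inv u"
    have j: "j \<in> carrier R" "u \<otimes> j = \<one>" using inv_nonzero[OF uc(1) u0] by (auto simp: j_def)
    have "w \<otimes> w \<otimes> (j \<otimes> j) = x \<otimes> ((u \<otimes> j) \<otimes> (u \<otimes> j))" unfolding ww using c uc j(1) by algebra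
    then have 1: "w \<otimes> w \<otimes> (j \<otimes> j) = x" using j c by simp
    have "w \<otimes> (b \<ominus> u \<otimes> u) \<otimes> (j \<otimes> j) = t \<otimes> (u' \<ominus> u) \<otimes> ((u \<otimes> j) \<otimes> (u \<otimes> j))"
      unfolding w_def uu'[symmetric] using c uc j(1) by algebra
    then have 2: "w \<otimes> (b \<ominus> u \<otimes> u) \<otimes> (j \<otimes> j) = y" using j c diff te by simp
    have "isogeny R b (Affine u w) = P" using u0 Affine 1 2 uc by (simp add: inv_square j_def)
    then show ?thesis using Q by blast
  qed
qed

text \<open>\<open>mu2_of\<close> only distinguishes the point at infinity, and the sum of f(Q) and
  -Q is infinity exactly when f(Q) = Q, so no further case of the addition law is needed.\<close>

lemma mu2_of_diff:
  assumes "subfield L R" "Q \<in> points (R\<lparr>carrier := L\<rparr>) a b"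
  shows "mu2_of R (point_add R a b (map_point f Q) (point_neg R Q)) = (if map_point f Q = Q then \<one> else \<ominus> \<one>)"
proof (cases Q)
  case (Affine u w)
  then have "w \<in> L" using assms(2) by (auto simp: points_def)
  then have "w \<in> carrier R" using subfieldE(3)[OF assms(1)] by blast
  then show ?thesis using Affine by (auto simp: mu2_of_def Let_def)
qed (auto simp: mu2_of_def)

end


lemma inj_ring_hom_point:
  fixes R (structure) and S (structure)
  assumes "field R" "field S" "h \<in> ring_hom R S" "inj_on h (carrier R)" "a \<in> carrier R" "b \<in> carrier R"
  shows "h (isog_a R a) = isog_a S (h a)" "h (isog_b R a b) = isog_b S (h a) (h b)"
    "P \<in> points R a b \<Longrightarrow> map_point h P \<in> points (S\<lparr>carrier := h ` carrier R\<rparr>) (h a) (h b)"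
    "P \<in> points R a' b' \<Longrightarrow> kcls S (h a) (h b) (map_point h P) = h (kcls R a b P)"
proof -
  interpret R: field R by fact
  interpret S: field S by fact
  interpret h: ring_hom_cring R S h
    using assms(3) by (intro ring_hom_cringI R.cring_axioms S.cring_axioms ring_hom_ring.intro)
      (auto simp: ring_hom_ring_axioms_def ring_hom_ring_def R.ring_axioms S.ring_axioms ring_hom_cring_axioms_def)
  have sc: "h a \<in> carrier S" "h b \<in> carrier S" using assms by auto
  show 1: "h (isog_a R a) = isog_a S (h a)" "h (isog_b R a b) = isog_b S (h a) (h b)"
    unfolding isog_a_def isog_b_def using assms sc
    by (simp_all add: R.add_pow_2 S.add_pow_2 R.add_pow_4 S.add_pow_4 a_minus_def)
  show "P \<in> points R a b \<Longrightarrow> map_point h P \<in> points (S\<lparr>carrier := h ` carrier R\<rparr>) (h a) (h b)"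
  proof (cases P)
    case (Affine x y)
    assume "P \<in> points R a b"
    then have xy: "x \<in> carrier R" "y \<in> carrier R" "y \<otimes> y = x \<otimes> (x \<otimes> x \<oplus> a \<otimes> x \<oplus> b)"
      using Affine by (auto simp: points_def)
    have "h y \<otimes>\<^bsub>S\<^esub> h y = h (y \<otimes> y)" using xy(2) by simp
    also have "\<dots> = h (x \<otimes> (x \<otimes> x \<oplus> a \<otimes> x \<oplus> b))" by (simp only: xy(3))
    also have "\<dots> = h x \<otimes>\<^bsub>S\<^esub> (h x \<otimes>\<^bsub>S\<^esub> h x \<oplus>\<^bsub>S\<^esub> h a \<otimes>\<^bsub>S\<^esub> h x \<oplus>\<^bsub>S\<^esub> h b)"
      using xy(1) assms(5,6) by simp
    finally show ?thesis using Affine xy by (simp add: points_def)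
  qed (auto simp: points_def)
  show "P \<in> points R a' b' \<Longrightarrow> kcls S (h a) (h b) (map_point h P) = h (kcls R a b P)"
  proof (cases P)
    case (Affine x y)
    assume "P \<in> points R a' b'"
    then have xy: "x \<in> carrier R" using Affine by (auto simp: points_def)
    have "h x = \<zero>\<^bsub>S\<^esub> \<longleftrightarrow> x = \<zero>"
      using assms(4) xy by (metis R.zero_closed h.hom_zero inj_onD)
    then show ?thesis using Affine 1 by (simp add: kcls_def)
  qed (auto simp: kcls_def)
qed

text \<open>Let t be a square root of the class of P attached to a preimage Q. Automorphisms change
  s and t by signs, and the cocycle of Q is the sign of t. So the cocycle condition says that s t is
  Galois invariant, that is, that \<alpha> times the class is a square in K. For the converse, the
  extension generated by a square root already contains a preimage of P.\<close>

lemma kummer_map_eq: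
  fixes K :: "('k, 'm) ring_scheme" (structure)
  assumes K: "field K" and two: "\<one> \<oplus> \<one> \<noteq> \<zero>" and ab: "a \<in> carrier K" "b \<in> carrier K" "b \<noteq> \<zero>"
    and nz: "isog_b K a b \<noteq> \<zero>"
    and P: "P \<in> points K (isog_a K a) (isog_b K a b)"
  shows "kummer_map K a b P = {kcls K a b P \<otimes> (c \<otimes> c) | c. c \<in> Units K}"
proof -
  interpret K: field K by fact
  define M where "M = K.alg_closure"
  define \<iota> :: "'k \<Rightarrow> ('k list \<times> nat) multiset \<Rightarrow> 'k" where "\<iota> = K.indexed_const"
  define F where "F = \<iota> ` carrier K"
  have hom: "\<iota> \<in> ring_hom K M" and cl: "algebraic_closure M F"
    using K.alg_closureE unfolding M_def \<iota>_def F_def by auto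
  have inj: "inj_on \<iota> (carrier K)" unfolding \<iota>_def by (rule K.indexed_const_inj_on)
  interpret M: algebraic_closure M F by (rule cl)
  interpret h: ring_hom_cring K M \<iota>
    using hom by (intro ring_hom_cringI K.cring_axioms M.cring_axioms ring_hom_ring.intro)
      (auto simp: ring_hom_ring_axioms_def ring_hom_ring_def K.ring_axioms M.ring_axioms ring_hom_cring_axioms_def)
  have F: "subfield F M" by (rule M.subfield_axioms)
  have twoM: "\<one>\<^bsub>M\<^esub> \<oplus>\<^bsub>M\<^esub> \<one>\<^bsub>M\<^esub> \<noteq> \<zero>\<^bsub>M\<^esub>"
  proof
    assume "\<one>\<^bsub>M\<^esub> \<oplus>\<^bsub>M\<^esub> \<one>\<^bsub>M\<^esub> = \<zero>\<^bsub>M\<^esub>"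
    then have "\<iota> (\<one> \<oplus> \<one>) = \<iota> \<zero>" by simp
    then show False using inj two by (meson K.a_closed K.one_closed K.zero_closed inj_onD)
  qed
  have isog: "isog_a K a \<in> carrier K" "isog_b K a b \<in> carrier K"
    using ab by (auto simp: isog_a_def isog_b_def)
  note hp = inj_ring_hom_point[OF K M.field_axioms hom inj]
  define P' where "P' = map_point \<iota> P"
  have P'F: "P' \<in> points (M\<lparr>carrier := F\<rparr>) (isog_a M (\<iota> a)) (isog_b M (\<iota> a) (\<iota> b))"
    using hp(3)[OF isog P] hp(1,2)[OF ab(1,2)] unfolding P'_def F_def by simp
  define x0 where "x0 = kcls K a b P"
  have x0c: "x0 \<in> carrier K" "x0 \<noteq> \<zero>"
    using P nz isog(2) K.one_not_zero unfolding x0_def kcls_def by (cases P; auto simp: points_def)+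
  have x0U: "x0 \<in> Units K" using x0c K.field_Units by auto
  have kP': "kcls M (\<iota> a) (\<iota> b) P' = \<iota> x0" using hp(4)[OF ab(1,2) P] unfolding P'_def x0_def by simp
  have \<iota>x0: "\<iota> x0 \<noteq> \<zero>\<^bsub>M\<^esub>" using x0c inj by (metis K.zero_closed h.hom_zero inj_onD)
  have abF: "\<iota> a \<in> F" "\<iota> b \<in> F" using ab by (auto simp: F_def)
  have bM: "\<iota> b \<noteq> \<zero>\<^bsub>M\<^esub>" using ab inj by (metis K.zero_closed h.hom_zero inj_onD)
  have P'xy: "\<And>x y. P' = Affine x y \<Longrightarrow> x \<in> F \<and> y \<in> F" using P'F by (auto simp: points_def)
  have signs: "\<sigma> t = t \<or> \<sigma> t = \<ominus>\<^bsub>M\<^esub> t"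
    if "\<sigma> \<in> relative_auts M F L" "t \<in> L" "L \<subseteq> carrier M" "t \<otimes>\<^bsub>M\<^esub> t \<in> F" for \<sigma> t L
  proof -
    have c: "t \<in> carrier M" "\<sigma> t \<in> carrier M" using that relative_autsD(1)[OF that(1)] by auto
    have "\<sigma> t \<otimes>\<^bsub>M\<^esub> \<sigma> t = t \<otimes>\<^bsub>M\<^esub> t" using relative_autsD(2)[OF that(1), of t t] relative_autsD(4)[OF that(1)] that by simp
    moreover have "(\<sigma> t \<ominus>\<^bsub>M\<^esub> t) \<otimes>\<^bsub>M\<^esub> (\<sigma> t \<oplus>\<^bsub>M\<^esub> t) = \<sigma> t \<otimes>\<^bsub>M\<^esub> \<sigma> t \<ominus>\<^bsub>M\<^esub> t \<otimes>\<^bsub>M\<^esub> t" using c by algebra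
    ultimately have "(\<sigma> t \<ominus>\<^bsub>M\<^esub> t) \<otimes>\<^bsub>M\<^esub> (\<sigma> t \<oplus>\<^bsub>M\<^esub> t) = \<zero>\<^bsub>M\<^esub>" using c by (simp add: M.r_right_minus_eq)
    then have "\<sigma> t \<ominus>\<^bsub>M\<^esub> t = \<zero>\<^bsub>M\<^esub> \<or> \<sigma> t \<oplus>\<^bsub>M\<^esub> t = \<zero>\<^bsub>M\<^esub>" using c M.integral[of "\<sigma> t \<ominus>\<^bsub>M\<^esub> t" "\<sigma> t \<oplus>\<^bsub>M\<^esub> t"] M.minus_closed M.a_closed by blast
    then show ?thesis using c by (metis M.minus_equality M.r_right_minus_eq)
  qed
  have neg_ne: "\<ominus>\<^bsub>M\<^esub> t \<noteq> t" if "t \<in> carrier M" "t \<noteq> \<zero>\<^bsub>M\<^esub>" for t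
  proof
    assume "\<ominus>\<^bsub>M\<^esub> t = t"
    then have "t \<oplus>\<^bsub>M\<^esub> t = \<zero>\<^bsub>M\<^esub> \<oplus>\<^bsub>M\<^esub> \<zero>\<^bsub>M\<^esub>" using that by (metis M.r_neg M.l_zero M.zero_closed)
    then show False using M.double_cancel[OF twoM that(1) M.zero_closed] that(2) by blast
  qed
  show ?thesis
  proof (intro Set.set_eqI iffI)
    fix \<alpha> assume "\<alpha> \<in> kummer_map K a b P"
    then obtain L Q s where \<alpha>: "\<alpha> \<in> Units K" and G: "finite_galois M F L"
      and Q: "Q \<in> points (M\<lparr>carrier := L\<rparr>) (\<iota> a) (\<iota> b)" "isogeny M (\<iota> b) Q = P'"
      and s: "s \<in> L" "s \<otimes>\<^bsub>M\<^esub> s = \<iota> \<alpha>"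
      and coc: "\<And>\<sigma>. \<sigma> \<in> relative_auts M F L \<Longrightarrow> \<sigma> s \<otimes>\<^bsub>M\<^esub> inv\<^bsub>M\<^esub> s =
           mu2_of M (point_add M (\<iota> a) (\<iota> b) (map_point \<sigma> Q) (point_neg M Q))"
      unfolding kummer_map_def Let_def M_def[symmetric] \<iota>_def[symmetric] F_def[symmetric] P'_def[symmetric] by blast
    have L: "subfield L M" "F \<subseteq> L" and fixed: "{x \<in> L. \<forall>\<sigma>\<in>relative_auts M F L. \<sigma> x = x} = F"
      using G unfolding finite_galois_def by auto
    have Lc: "L \<subseteq> carrier M" using subfieldE(3)[OF L(1)] .
    obtain t where t: "t \<in> L" "t \<otimes>\<^bsub>M\<^esub> t = \<iota> x0"
      and t\<sigma>: "\<And>\<sigma>. \<sigma> \<in> relative_auts M F L \<Longrightarrow> map_point \<sigma> Q = Q \<longleftrightarrow> \<sigma> t = t"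
      using M.isogeny_preimage[OF twoM F L abF Q P'xy] kP' by auto
    have c: "s \<in> carrier M" "t \<in> carrier M" using s t Lc by auto
    have \<alpha>c: "\<alpha> \<in> carrier K" "\<alpha> \<noteq> \<zero>" using \<alpha> K.field_Units by auto
    then have "\<iota> \<alpha> \<noteq> \<zero>\<^bsub>M\<^esub>" using inj by (metis K.zero_closed h.hom_zero inj_onD)
    then have s0: "s \<noteq> \<zero>\<^bsub>M\<^esub>" using s c by auto
    note si = M.inv_nonzero[OF c(1) s0]
    have "\<sigma> (s \<otimes>\<^bsub>M\<^esub> t) = s \<otimes>\<^bsub>M\<^esub> t" if \<sigma>: "\<sigma> \<in> relative_auts M F L" for \<sigma>
    proof -
      have \<sigma>c: "\<sigma> s \<in> carrier M" "\<sigma> t \<in> carrier M" using relative_autsD(1)[OF \<sigma>] s t Lc by auto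
      have m: "\<sigma> (s \<otimes>\<^bsub>M\<^esub> t) = \<sigma> s \<otimes>\<^bsub>M\<^esub> \<sigma> t" using relative_autsD(2)[OF \<sigma>] s t by simp
      have "\<sigma> s = (\<sigma> s \<otimes>\<^bsub>M\<^esub> inv\<^bsub>M\<^esub> s) \<otimes>\<^bsub>M\<^esub> s" 
      proof -
        have "(\<sigma> s \<otimes>\<^bsub>M\<^esub> inv\<^bsub>M\<^esub> s) \<otimes>\<^bsub>M\<^esub> s = \<sigma> s \<otimes>\<^bsub>M\<^esub> (s \<otimes>\<^bsub>M\<^esub> inv\<^bsub>M\<^esub> s)" using \<sigma>c c si(1) by algebra
        then show ?thesis using si(2) \<sigma>c by simp
      qed
      then have \<sigma>s: "\<sigma> s = (if \<sigma> t = t then \<one>\<^bsub>M\<^esub> else \<ominus>\<^bsub>M\<^esub> \<one>\<^bsub>M\<^esub>) \<otimes>\<^bsub>M\<^esub> s"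
        using coc[OF \<sigma>] M.mu2_of_diff[OF L(1) Q(1)] t\<sigma>[OF \<sigma>] by simp
      have "t \<otimes>\<^bsub>M\<^esub> t \<in> F" using t(2) x0c by (auto simp: F_def)
      from signs[OF \<sigma> t(1) Lc this] show ?thesis
      proof
        assume "\<sigma> t = t" then show ?thesis using m \<sigma>s c by simp
      next
        assume n: "\<sigma> t = \<ominus>\<^bsub>M\<^esub> t"
        have "t \<noteq> \<zero>\<^bsub>M\<^esub>" using t \<iota>x0 c by auto
        then have "\<sigma> t \<noteq> t" using n neg_ne c by simp
        then show ?thesis using m \<sigma>s n c by (simp add: M.l_minus M.r_minus)
      qed
    qed
    moreover have "s \<otimes>\<^bsub>M\<^esub> t \<in> L" using s t subringE(6)[OF subfieldE(1)[OF L(1)]] by blast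
    ultimately have "s \<otimes>\<^bsub>M\<^esub> t \<in> F" using fixed by blast
    then obtain d where d: "d \<in> carrier K" "s \<otimes>\<^bsub>M\<^esub> t = \<iota> d" unfolding F_def by auto
    have "(s \<otimes>\<^bsub>M\<^esub> t) \<otimes>\<^bsub>M\<^esub> (s \<otimes>\<^bsub>M\<^esub> t) = (s \<otimes>\<^bsub>M\<^esub> s) \<otimes>\<^bsub>M\<^esub> (t \<otimes>\<^bsub>M\<^esub> t)" using c by algebra
    then have "\<iota> (d \<otimes> d) = \<iota> (\<alpha> \<otimes> x0)" using d s t \<alpha>c x0c by simp
    then have dd: "d \<otimes> d = \<alpha> \<otimes> x0" using inj d \<alpha>c x0c by (meson K.m_closed inj_onD)
    note xi = K.inv_nonzero[OF x0c]
    have "d \<noteq> \<zero>" using dd \<alpha>c x0c d K.integral by (metis K.l_null)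
    then have "d \<otimes> inv x0 \<in> Units K" using d K.field_Units x0U K.Units_m_closed K.Units_inv_Units by simp
    moreover have "x0 \<otimes> ((d \<otimes> inv x0) \<otimes> (d \<otimes> inv x0)) = \<alpha>"
    proof -
      have "x0 \<otimes> ((d \<otimes> inv x0) \<otimes> (d \<otimes> inv x0)) = (d \<otimes> d) \<otimes> inv x0 \<otimes> (x0 \<otimes> inv x0)" using d(1) x0c(1) xi(1) by algebra
      also have "\<dots> = \<alpha> \<otimes> (x0 \<otimes> inv x0) \<otimes> (x0 \<otimes> inv x0)" unfolding dd using \<alpha>c(1) x0c(1) xi(1) by algebra
      finally show ?thesis using xi \<alpha>c by simp
    qed
    ultimately show "\<alpha> \<in> {kcls K a b P \<otimes> (c \<otimes> c) | c. c \<in> Units K}" unfolding x0_def[symmetric] by blast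
  next
    fix \<alpha> assume "\<alpha> \<in> {kcls K a b P \<otimes> (c \<otimes> c) | c. c \<in> Units K}"
    then obtain d where d: "d \<in> Units K" "\<alpha> = x0 \<otimes> (d \<otimes> d)" unfolding x0_def by blast
    have dc: "d \<in> carrier K" "d \<noteq> \<zero>" using d K.field_Units by auto
    have \<alpha>: "\<alpha> \<in> Units K" using d x0U by simp
    obtain t where t: "t \<in> carrier M" "t \<otimes>\<^bsub>M\<^esub> t = \<iota> x0" using M.exists_sqrt[of "\<iota> x0"] x0c by auto
    have ttF: "t \<otimes>\<^bsub>M\<^esub> t \<in> F" using t x0c by (auto simp: F_def)
    define L where "L = quad_ext M F t"
    have G: "finite_galois M F L" and tL: "t \<in> L"
      using M.quad_ext_galois[OF F twoM t(1) ttF] unfolding L_def by auto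
    have L: "subfield L M" "F \<subseteq> L" using G unfolding finite_galois_def by auto
    have Lc: "L \<subseteq> carrier M" using subfieldE(3)[OF L(1)] .
    have "P' \<in> points (M\<lparr>carrier := L\<rparr>) (isog_a M (\<iota> a)) (isog_b M (\<iota> a) (\<iota> b))"
      using P'F L(2) by (auto simp: points_def)
    moreover have "\<iota> a \<in> L" "\<iota> b \<in> L" using abF L(2) by auto
    ultimately obtain Q where Q: "Q \<in> points (M\<lparr>carrier := L\<rparr>) (\<iota> a) (\<iota> b)" "isogeny M (\<iota> b) Q = P'"
      using M.isogeny_surj[OF twoM L(1) _ _ bM _ tL, of "\<iota> a" P'] t kP' by auto
    \<comment> \<open>\<open>t\<close> generated the field; \<open>t'\<close> is the square root
      belonging to the chosen \<open>Q\<close>, possibly of the other sign, so the cocycle is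
      computed with \<open>t'\<close>.\<close>
    obtain t' where t': "t' \<in> L" "t' \<otimes>\<^bsub>M\<^esub> t' = \<iota> x0"
      and t\<sigma>: "\<And>\<sigma>. \<sigma> \<in> relative_auts M F L \<Longrightarrow> map_point \<sigma> Q = Q \<longleftrightarrow> \<sigma> t' = t'"
      using M.isogeny_preimage[OF twoM F L abF Q P'xy] kP' by auto
    define s where "s = \<iota> d \<otimes>\<^bsub>M\<^esub> t'"
    have dF: "\<iota> d \<in> F" "\<iota> d \<in> L" using dc L by (auto simp: F_def)
    have sL: "s \<in> L" unfolding s_def using dF t' subringE(6)[OF subfieldE(1)[OF L(1)]] by blast
    have c: "t' \<in> carrier M" "\<iota> d \<in> carrier M" "s \<in> carrier M" using t' dF sL Lc by auto
    have "s \<otimes>\<^bsub>M\<^esub> s = (t' \<otimes>\<^bsub>M\<^esub> t') \<otimes>\<^bsub>M\<^esub> (\<iota> d \<otimes>\<^bsub>M\<^esub> \<iota> d)" unfolding s_def using c by algebra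
    then have ss: "s \<otimes>\<^bsub>M\<^esub> s = \<iota> \<alpha>" using t' d dc x0c by simp
    have t'0: "t' \<noteq> \<zero>\<^bsub>M\<^esub>" using t' c \<iota>x0 by auto
    have "\<alpha> \<noteq> \<zero>" using \<alpha> K.field_Units by auto
    then have "\<iota> \<alpha> \<noteq> \<zero>\<^bsub>M\<^esub>" using inj \<alpha> by (metis K.Units_closed K.zero_closed h.hom_zero inj_onD)
    then have s0: "s \<noteq> \<zero>\<^bsub>M\<^esub>" using ss c by auto
    note si = M.inv_nonzero[OF c(3) s0]
    have "\<sigma> s \<otimes>\<^bsub>M\<^esub> inv\<^bsub>M\<^esub> s = mu2_of M (point_add M (\<iota> a) (\<iota> b) (map_point \<sigma> Q) (point_neg M Q))"
      if \<sigma>: "\<sigma> \<in> relative_auts M F L" for \<sigma>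
    proof -
      have m: "\<sigma> s = \<iota> d \<otimes>\<^bsub>M\<^esub> \<sigma> t'" unfolding s_def using relative_autsD(2,4)[OF \<sigma>] dF t' by simp
      have "t' \<otimes>\<^bsub>M\<^esub> t' \<in> F" using t' x0c by (auto simp: F_def)
      from signs[OF \<sigma> t'(1) Lc this]
      have "\<sigma> s = (if \<sigma> t' = t' then \<one>\<^bsub>M\<^esub> else \<ominus>\<^bsub>M\<^esub> \<one>\<^bsub>M\<^esub>) \<otimes>\<^bsub>M\<^esub> s"
        using m c neg_ne[OF c(1) t'0] by (auto simp: s_def M.l_minus M.r_minus)
      then have "\<sigma> s \<otimes>\<^bsub>M\<^esub> inv\<^bsub>M\<^esub> s = (if \<sigma> t' = t' then \<one>\<^bsub>M\<^esub> else \<ominus>\<^bsub>M\<^esub> \<one>\<^bsub>M\<^esub>)"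
        using c si by (auto simp: M.m_assoc M.l_minus)
      then show ?thesis using M.mu2_of_diff[OF L(1) Q(1)] t\<sigma>[OF \<sigma>] by simp
    qed
    then show "\<alpha> \<in> kummer_map K a b P"
      unfolding kummer_map_def Let_def M_def[symmetric] \<iota>_def[symmetric] F_def[symmetric] P'_def[symmetric]
      using \<alpha> G Q sL ss by blast
  qed
qed

text \<open>Substituting u = x w^2 and y = x w z into y^2 = u ((u - a)^2 - 4b) gives the equation of
  the second disjunct: points of the isogenous curve whose first coordinate has the class of x. The
  first disjunct is the class of the point at infinity.\<close>

definition tors :: "('k, 'm) ring_scheme \<Rightarrow> 'k \<Rightarrow> 'k \<Rightarrow> 'k \<Rightarrow> bool"
  where "tors K x a b \<longleftrightarrow> (\<exists>w\<in>carrier K. x = w \<otimes>\<^bsub>K\<^esub> w) \<or>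
    (\<exists>w\<in>carrier K. \<exists>z\<in>carrier K. x \<otimes>\<^bsub>K\<^esub> (z \<otimes>\<^bsub>K\<^esub> z) =
      (x \<otimes>\<^bsub>K\<^esub> (w \<otimes>\<^bsub>K\<^esub> w) \<ominus>\<^bsub>K\<^esub> a) \<otimes>\<^bsub>K\<^esub> (x \<otimes>\<^bsub>K\<^esub> (w \<otimes>\<^bsub>K\<^esub> w) \<ominus>\<^bsub>K\<^esub> a)
        \<ominus>\<^bsub>K\<^esub> (b \<oplus>\<^bsub>K\<^esub> b \<oplus>\<^bsub>K\<^esub> b \<oplus>\<^bsub>K\<^esub> b))"

lemma (in field) tors_iff_kcls:
  assumes ab: "a \<in> carrier R" "b \<in> carrier R" and nz: "isog_b R a b \<noteq> \<zero>" and x: "x \<in> Units R"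
  shows "tors R x a b \<longleftrightarrow> (\<exists>P\<in>points R (isog_a R a) (isog_b R a b). \<exists>c\<in>Units R. x = kcls R a b P \<otimes> (c \<otimes> c))"
proof -
  define B where "B = a \<otimes> a \<ominus> (b \<oplus> b \<oplus> b \<oplus> b)"
  have B: "isog_b R a b = B" "isog_a R a = \<ominus> (a \<oplus> a)" "B \<in> carrier R"
    using ab by (simp_all add: isog_b_def isog_a_def add_pow_4 add_pow_2 B_def)
  have xc: "x \<in> carrier R" "x \<noteq> \<zero>" using x field_Units by auto
  have f: "(u \<ominus> a) \<otimes> (u \<ominus> a) \<ominus> (b \<oplus> b \<oplus> b \<oplus> b) = u \<otimes> u \<oplus> (\<ominus> (a \<oplus> a)) \<otimes> u \<oplus> B" if "u \<in> carrier R" for u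
    unfolding B_def using that ab by algebra
  show ?thesis
  proof
    assume "tors R x a b"
    then show "\<exists>P\<in>points R (isog_a R a) (isog_b R a b). \<exists>c\<in>Units R. x = kcls R a b P \<otimes> (c \<otimes> c)"
      unfolding tors_def
    proof (elim disjE bexE)
      fix w assume w: "w \<in> carrier R" "x = w \<otimes> w"
      have "w \<noteq> \<zero>"
      proof
        assume "w = \<zero>"
        then have "x = \<zero>" unfolding w(2) by simp
        with xc(2) show False ..
      qed
      then have "w \<in> Units R" using w(1) field_Units by blast
      moreover have "x = kcls R a b Infinity \<otimes> (w \<otimes> w)" unfolding w(2) kcls_def using w(1) by simp
      moreover have "Infinity \<in> points R (isog_a R a) (isog_b R a b)" by (simp add: points_def)
      ultimately show ?thesis by blast
    next
      fix w z assume wz: "w \<in> carrier R" "z \<in> carrier R"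
        and e: "x \<otimes> (z \<otimes> z) = (x \<otimes> (w \<otimes> w) \<ominus> a) \<otimes> (x \<otimes> (w \<otimes> w) \<ominus> a) \<ominus> (b \<oplus> b \<oplus> b \<oplus> b)"
      define u where "u = x \<otimes> (w \<otimes> w)"
      have uc: "u \<in> carrier R" using wz xc by (simp add: u_def)
      have e': "x \<otimes> (z \<otimes> z) = u \<otimes> u \<oplus> (\<ominus> (a \<oplus> a)) \<otimes> u \<oplus> B" using e f[OF uc] unfolding u_def by simp
      show ?thesis
      proof (cases "w = \<zero>")
        \<comment> \<open>The torsor points with w = 0 belong to (0,0): then x z^2 = a^2 - 4b, and
          \<open>nz\<close> makes z invertible.\<close>
        case True
        then have "u = \<zero>" using xc by (simp add: u_def)
        then have xz: "x \<otimes> (z \<otimes> z) = B" using e' ab B by simp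
        then have z0: "z \<noteq> \<zero>" using nz B xc by auto
        note zi = inv_nonzero[OF wz(2) z0]
        have "B \<otimes> (inv z \<otimes> inv z) = x \<otimes> ((z \<otimes> inv z) \<otimes> (z \<otimes> inv z))"
          unfolding xz[symmetric] using xc(1) wz(2) zi(1) by algebra
        then have "x = B \<otimes> (inv z \<otimes> inv z)" using zi xc by simp
        moreover have "inv z \<in> Units R" using z0 wz field_Units Units_inv_Units by auto
        moreover have "Affine \<zero> \<zero> \<in> points R (isog_a R a) (isog_b R a b)"
          using B ab by (auto simp: points_def)
        ultimately show ?thesis
          by (intro bexI[of _ "Affine \<zero> \<zero>"] bexI[of _ "inv z"]) (auto simp: kcls_def B)
      next
        case False
        have u0: "u \<noteq> \<zero>" unfolding u_def using False wz xc integral[of x "w \<otimes> w"] square_eq_zero[of w] by auto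
        note wi = inv_nonzero[OF wz(1) False]
        define y where "y = x \<otimes> (w \<otimes> z)"
        have "y \<otimes> y = u \<otimes> (x \<otimes> (z \<otimes> z))" unfolding y_def u_def using xc(1) wz by algebra
        then have "Affine u y \<in> points R (isog_a R a) (isog_b R a b)"
          using uc wz xc unfolding e' B y_def by (auto simp: points_def)
        moreover have "u \<otimes> (inv w \<otimes> inv w) = x \<otimes> ((w \<otimes> inv w) \<otimes> (w \<otimes> inv w))"
          unfolding u_def using xc(1) wz(1) wi(1) by algebra
        then have "x = u \<otimes> (inv w \<otimes> inv w)" using wi xc by simp
        moreover have "inv w \<in> Units R" using False wz field_Units Units_inv_Units by auto
        ultimately show ?thesis using u0
          by (intro bexI[of _ "Affine u y"] bexI[of _ "inv w"]) (auto simp: kcls_def)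
      qed
    qed
  next
    assume "\<exists>P\<in>points R (isog_a R a) (isog_b R a b). \<exists>c\<in>Units R. x = kcls R a b P \<otimes> (c \<otimes> c)"
    then obtain P c where P: "P \<in> points R (isog_a R a) (isog_b R a b)" and c: "c \<in> Units R"
      and x': "x = kcls R a b P \<otimes> (c \<otimes> c)" by blast
    have cc: "c \<in> carrier R" "c \<noteq> \<zero>" using c field_Units by auto
    note ci = inv_nonzero[OF cc]
    show "tors R x a b"
    proof (cases P)
      case Infinity
      then have "x = c \<otimes> c" using x' cc by (simp add: kcls_def)
      then show ?thesis using cc unfolding tors_def by blast
    next
      case (Affine u y)
      have uy: "u \<in> carrier R" "y \<in> carrier R" "y \<otimes> y = u \<otimes> (u \<otimes> u \<oplus> (\<ominus> (a \<oplus> a)) \<otimes> u \<oplus> B)"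
        using P Affine B by (auto simp: points_def)
      show ?thesis
      proof (cases "u = \<zero>")
        case True
        then have xB: "x = B \<otimes> (c \<otimes> c)" using x' Affine B by (simp add: kcls_def)
        have "x \<otimes> (inv c \<otimes> inv c) = B \<otimes> ((c \<otimes> inv c) \<otimes> (c \<otimes> inv c))"
          unfolding xB using B(3) cc(1) ci(1) by algebra
        also have "\<dots> = B" using ci B by simp
        also have "\<dots> = (x \<otimes> (\<zero> \<otimes> \<zero>) \<ominus> a) \<otimes> (x \<otimes> (\<zero> \<otimes> \<zero>) \<ominus> a) \<ominus> (b \<oplus> b \<oplus> b \<oplus> b)"
        proof -
          have "x \<otimes> (\<zero> \<otimes> \<zero>) = \<zero>" using xc by simp
          then show ?thesis using f[of \<zero>] ab B by simp
        qed
        finally show ?thesis unfolding tors_def using ci by blast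
      next
        case False
        note ui = inv_nonzero[OF uy(1) False]
        have xu: "x = u \<otimes> (c \<otimes> c)" using x' Affine False by (simp add: kcls_def)
        have "x \<otimes> (inv c \<otimes> inv c) = u \<otimes> ((c \<otimes> inv c) \<otimes> (c \<otimes> inv c))"
          unfolding xu using uy(1) cc(1) ci(1) by algebra
        then have w: "x \<otimes> (inv c \<otimes> inv c) = u" using ci uy by simp
        define z where "z = y \<otimes> (inv u \<otimes> inv c)"
        have zc: "z \<in> carrier R" using uy ui ci by (simp add: z_def)
        have "x \<otimes> (z \<otimes> z) = (y \<otimes> y) \<otimes> (inv u \<otimes> (u \<otimes> inv u)) \<otimes> ((c \<otimes> inv c) \<otimes> (c \<otimes> inv c))"
          unfolding xu z_def using uy(1,2) ui(1) ci(1) cc(1) by algebra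
        also have "\<dots> = (y \<otimes> y) \<otimes> inv u" using ui ci uy(1,2) by simp
        also have "\<dots> = (u \<otimes> u \<oplus> (\<ominus> (a \<oplus> a)) \<otimes> u \<oplus> B) \<otimes> (u \<otimes> inv u)"
        proof -
          have "u \<otimes> g \<otimes> inv u = g \<otimes> (u \<otimes> inv u)" if "g \<in> carrier R" for g using that uy(1) ui(1) by algebra
          moreover have "u \<otimes> u \<oplus> (\<ominus> (a \<oplus> a)) \<otimes> u \<oplus> B \<in> carrier R" using uy ab B by simp
          ultimately show ?thesis unfolding uy(3) by blast
        qed
        also have "\<dots> = (u \<ominus> a) \<otimes> (u \<ominus> a) \<ominus> (b \<oplus> b \<oplus> b \<oplus> b)" using f[OF uy(1)] ui uy(1) ab B by simp
        finally have "x \<otimes> (z \<otimes> z) = (x \<otimes> (inv c \<otimes> inv c) \<ominus> a) \<otimes> (x \<otimes> (inv c \<otimes> inv c) \<ominus> a) \<ominus> (b \<oplus> b \<oplus> b \<oplus> b)"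
          unfolding w .
        then show ?thesis unfolding tors_def using zc ci by blast
      qed
    qed
  qed
qed

section \<open>Square classes of rationals and the local conditions they satisfy\<close>

definition sqcls :: "rat \<Rightarrow> rat set"
  where "sqcls \<alpha> = {\<alpha> * c\<^sup>2 | c. c \<noteq> 0}"

lemma Units_rat_field: "Units rat_field = - {0}"
proof -
  interpret field "rat_field :: rat ring" by (rule field_from_type_algebra)
  show ?thesis unfolding field_Units by (auto simp: ring_of_type_algebra_def)
qed

lemma carrier_square_classes: "C \<in> carrier (square_classes rat_field) \<longleftrightarrow> (\<exists>\<alpha>. \<alpha> \<noteq> 0 \<and> C = sqcls \<alpha>)"
proof -
  have "unit_squares rat_field #>\<^bsub>units_of rat_field\<^esub> \<alpha> = sqcls \<alpha>" for \<alpha>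
    unfolding r_coset_def unit_squares_def sqcls_def Units_rat_field units_of_def
    by (auto simp: ring_of_type_algebra_def power2_eq_square mult.commute)
  then show ?thesis
    unfolding square_classes_def FactGroup_def RCOSETS_def
    by (auto simp: units_of_def Units_rat_field)
qed

text \<open>The localized class and the Kummer image of a point are both cosets of the squares, so
  they agree as soon as f(\<alpha>) lies in the latter; the condition becomes a statement about a
  single representative.\<close>

lemma local_condition_iff:
  fixes K :: "('k, 'm) ring_scheme" (structure)
  assumes K: "field K" and two: "\<one> \<oplus> \<one> \<noteq> \<zero>" and f: "f \<in> ring_hom rat_field K"
    and nz: "b \<noteq> 0" "a\<^sup>2 - 4 * b \<noteq> 0" and \<alpha>: "\<alpha> \<noteq> 0"
  shows "local_condition K f a b (sqcls \<alpha>) \<longleftrightarrow> tors K (f \<alpha>) (f (of_int a)) (f (of_int b))"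
proof -
  interpret K: field K by fact
  interpret Q: field "rat_field" by (rule field_from_type_algebra)
  interpret f: ring_hom_cring rat_field K f
    using f by (intro ring_hom_cringI K.cring_axioms Q.cring_axioms ring_hom_ring.intro)
      (auto simp: ring_hom_ring_axioms_def ring_hom_ring_def K.ring_axioms Q.ring_axioms ring_hom_cring_axioms_def)
  have fc [simp]: "f x \<in> carrier K" for x using f.hom_closed[of x] by (simp add: ring_of_type_algebra_def)
  have fm: "f (x * y) = f x \<otimes> f y" and fa: "f (x + y) = f x \<oplus> f y" for x y
    using f.hom_mult[of x y] f.hom_add[of x y] by (simp_all add: ring_of_type_algebra_def)
  have f1: "f 1 = \<one>" and f0: "f 0 = \<zero>" using f.hom_one f.hom_zero by (simp_all add: ring_of_type_algebra_def)
  have fn: "f (- x) = \<ominus> f x" for x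
    using fa[of x "- x"] f0 by (metis K.minus_equality K.minus_minus add.commute fa fc add.right_inverse)
  have fU: "f x \<in> Units K" if "x \<noteq> 0" for x
  proof -
    have "f x \<otimes> f (inverse x) = \<one>" using that fm[of x "inverse x"] f1 by simp
    then show ?thesis using K.Units_one_closed K.unit_factor fc by metis
  qed
  have fnz: "f x \<noteq> \<zero>" if "x \<noteq> 0" for x using fU[OF that] K.field_Units by auto
  let ?a = "f (of_int a)" and ?b = "f (of_int b)"
  have b0: "?b \<noteq> \<zero>" using nz by (intro fnz) simp
  have "isog_b K ?a ?b = f (of_int a * of_int a + - (of_int b + of_int b + of_int b + of_int b))"
    by (simp only: isog_b_def K.add_pow_4[OF fc] fm fa fn a_minus_def)
  moreover have "of_int a * of_int a + - (of_int b + of_int b + of_int b + of_int b) = (of_int (a\<^sup>2 - 4 * b) :: rat)"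
    by (simp add: power2_eq_square)
  ultimately have B0: "isog_b K ?a ?b \<noteq> \<zero>" using nz(2) fnz by (metis of_int_eq_0_iff)
  have loc: "localize_class K f (sqcls \<alpha>) = {f \<alpha> \<otimes> (d \<otimes> d) | d. d \<in> Units K}"
  proof (intro Set.set_eqI iffI)
    fix y assume "y \<in> localize_class K f (sqcls \<alpha>)"
    then obtain e c where e: "e \<in> Units K" "c \<noteq> 0" "y = (e \<otimes> e) \<otimes> f (\<alpha> * c\<^sup>2)"
      unfolding localize_class_def set_mult_def unit_squares_def sqcls_def units_of_def by auto
    have ec: "e \<in> carrier K" using e by auto
    have "y = f \<alpha> \<otimes> ((e \<otimes> f c) \<otimes> (e \<otimes> f c))"
      unfolding e(3) power2_eq_square fm using ec fc[of \<alpha>] fc[of c] by algebra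
    moreover have "e \<otimes> f c \<in> Units K" using e fU by simp
    ultimately show "y \<in> {f \<alpha> \<otimes> (d \<otimes> d) | d. d \<in> Units K}" by blast
  next
    fix y assume "y \<in> {f \<alpha> \<otimes> (d \<otimes> d) | d. d \<in> Units K}"
    then obtain d where d: "d \<in> Units K" "y = f \<alpha> \<otimes> (d \<otimes> d)" by blast
    then have "y = (d \<otimes> d) \<otimes> f \<alpha>" using K.m_comm[of "f \<alpha>" "d \<otimes> d"] K.Units_closed[of d] by simp
    moreover have "\<alpha> \<in> sqcls \<alpha>" unfolding sqcls_def by (auto intro!: exI[of _ 1])
    ultimately show "y \<in> localize_class K f (sqcls \<alpha>)"
      unfolding localize_class_def set_mult_def unit_squares_def units_of_def using d by auto
  qed
  have "localize_class K f (sqcls \<alpha>) = kummer_map K ?a ?b P \<longleftrightarrow> (\<exists>c\<in>Units K. f \<alpha> = kcls K ?a ?b P \<otimes> (c \<otimes> c))"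
    if P: "P \<in> points K (isog_a K ?a) (isog_b K ?a ?b)" for P
  proof -
    define x0 where "x0 = kcls K ?a ?b P"
    have x0c: "x0 \<in> carrier K" using P by (cases P) (auto simp: x0_def kcls_def points_def isog_b_def)
    have kum: "kummer_map K ?a ?b P = {x0 \<otimes> (c \<otimes> c) | c. c \<in> Units K}"
      using kummer_map_eq[OF K two fc fc b0 B0 P] unfolding x0_def .
    show ?thesis unfolding loc kum x0_def[symmetric]
    proof
      assume e: "{f \<alpha> \<otimes> (d \<otimes> d) |d. d \<in> Units K} = {x0 \<otimes> (c \<otimes> c) |c. c \<in> Units K}"
      have "f \<alpha> = f \<alpha> \<otimes> (\<one> \<otimes> \<one>)" by simp
      then have "f \<alpha> \<in> {f \<alpha> \<otimes> (d \<otimes> d) |d. d \<in> Units K}" using K.Units_one_closed by blast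
      then show "\<exists>c\<in>Units K. f \<alpha> = x0 \<otimes> (c \<otimes> c)" unfolding e by blast
    next
      assume "\<exists>c\<in>Units K. f \<alpha> = x0 \<otimes> (c \<otimes> c)"
      then obtain c where c: "c \<in> Units K" "f \<alpha> = x0 \<otimes> (c \<otimes> c)" by blast
      have cc: "c \<in> carrier K" "inv c \<in> carrier K" "c \<otimes> inv c = \<one>" using c by auto
      show "{f \<alpha> \<otimes> (d \<otimes> d) |d. d \<in> Units K} = {x0 \<otimes> (c \<otimes> c) |c. c \<in> Units K}"
      proof (intro Set.set_eqI iffI)
        fix y assume "y \<in> {f \<alpha> \<otimes> (d \<otimes> d) |d. d \<in> Units K}"
        then obtain d where d: "d \<in> Units K" "y = f \<alpha> \<otimes> (d \<otimes> d)" by blast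
        have dc: "d \<in> carrier K" using d by auto
        have "y = x0 \<otimes> ((c \<otimes> d) \<otimes> (c \<otimes> d))" unfolding d(2) c(2) using x0c cc(1) dc by algebra
        then show "y \<in> {x0 \<otimes> (c \<otimes> c) |c. c \<in> Units K}" using c d by blast
      next
        fix y assume "y \<in> {x0 \<otimes> (c \<otimes> c) |c. c \<in> Units K}"
        then obtain d where d: "d \<in> Units K" "y = x0 \<otimes> (d \<otimes> d)" by blast
        have dc: "d \<in> carrier K" using d by auto
        have "f \<alpha> \<otimes> ((inv c \<otimes> d) \<otimes> (inv c \<otimes> d)) = x0 \<otimes> (d \<otimes> d) \<otimes> ((c \<otimes> inv c) \<otimes> (c \<otimes> inv c))"
          unfolding c(2) using x0c cc(1,2) dc by algebra
        then have "y = f \<alpha> \<otimes> ((inv c \<otimes> d) \<otimes> (inv c \<otimes> d))" using cc d dc x0c by simp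
        then show "y \<in> {f \<alpha> \<otimes> (d \<otimes> d) |d. d \<in> Units K}" using c d by blast
      qed
    qed
  qed
  then have "local_condition K f a b (sqcls \<alpha>) \<longleftrightarrow>
      (\<exists>P\<in>points K (isog_a K ?a) (isog_b K ?a ?b). \<exists>c\<in>Units K. f \<alpha> = kcls K ?a ?b P \<otimes> (c \<otimes> c))"
    unfolding local_condition_def local_image_def by blast
  then show ?thesis using K.tors_iff_kcls[OF fc fc B0 fU[OF \<alpha>]] by blast
qed

section \<open>Local images at odd primes\<close>

context odd_padic begin

section \<open>Residues and squares of units at an odd prime\<close>

lemma N_lt_1_prod: "N x < 1 \<Longrightarrow> N y \<le> 1 \<Longrightarrow> N (x * y) < 1"
  unfolding N_mult by (metis N_nonneg mult_left_le mult_le_cancel_left1 order_le_less_trans mult.commute mult_right_le_one_le)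

text \<open>The residue field is that of ordinary integers: the denominator of a p-integral rational
  is prime to p and can be inverted modulo p.\<close>

lemma near_int:
  assumes "N x \<le> 1" shows "\<exists>m::int. N (x - of_int m) < 1"
proof -
  obtain a b where ab: "b > 0" "x = of_int a / of_int b" "coprime a b" by (rule rat_frac)
  have pb: "\<not> int p dvd b"
  proof
    assume pb: "int p dvd b"
    then have "\<not> int p dvd a" using ab(3) prime_int_p by (metis coprime_common_divisor not_prime_unit)
    then have "N (of_int a) = 1" "N (of_int b) < 1" using pb N_of_int_eq_1_iff N_of_int_less_1_iff by auto
    moreover have "N x = N (of_int a) / N (of_int b)" using ab by (simp add: N_divide)
    moreover have "N (of_int b) > 0" using ab by simp
    ultimately show False using assms by (simp add: divide_le_eq)
  qed
  then have Nb: "N (of_int b) = 1" using N_of_int_eq_1_iff by auto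
  have "coprime b (int p)" using pb prime_int_p by (metis coprime_commute prime_imp_coprime)
  then obtain c where c: "[b * c = 1] (mod int p)" using cong_solve_coprime_int by blast
  then have "int p dvd a * (1 - b * c)" by (metis cong_iff_dvd_diff cong_sym dvd_mult)
  then have "N (of_int (a * (1 - b * c))) < 1" using N_of_int_less_1_iff by blast
  moreover have "x - of_int (a * c) = of_int (a * (1 - b * c)) / of_int b"
    using ab by (simp add: field_simps)
  ultimately have "N (x - of_int (a * c)) < 1" by (simp add: N_divide Nb del: of_int_mult)
  then show ?thesis by blast
qed

lemma psq_of_int:
  assumes "\<not> int p dvd m" shows "psq (of_int m) \<longleftrightarrow> QuadRes (int p) m"
proof
  assume "psq (of_int m)"
  then obtain s where s: "s \<noteq> 0" "N (of_int m - s\<^sup>2) < N (s\<^sup>2)" using psq_obtain_near by blast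
  have Ns2: "N (s\<^sup>2) = 1" using N_eq_of_close[OF s(2)] N_of_int_eq_1_iff[of m] assms by simp
  then have Ns: "N s = 1" using N_power[of s 2] by (metis N_nonneg power2_eq_1_iff not_one_le_zero neg_0_le_iff_le)
  then obtain k where k: "N (s - of_int k) < 1" using near_int[of s] by auto
  have "N ((s - of_int k) * (s + of_int k)) < 1"
    using k Ns N_of_int_le_1 by (intro N_lt_1_prod N_add_le) auto
  then have "N (s\<^sup>2 - (of_int k)\<^sup>2) < 1" by (simp add: power2_eq_square algebra_simps)
  then have "N ((of_int m - s\<^sup>2) + (s\<^sup>2 - (of_int k)\<^sup>2)) < 1" using s(2) Ns2 by (intro N_add_less) auto
  then have "N (of_int (m - k\<^sup>2)) < 1" by simp
  then have "int p dvd m - k\<^sup>2" using N_of_int_less_1_iff by blast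
  then have "[k\<^sup>2 = m] (mod int p)" by (metis cong_iff_dvd_diff cong_sym)
  then show "QuadRes (int p) m" unfolding QuadRes_def by blast
next
  assume "QuadRes (int p) m"
  then obtain y where y: "[y\<^sup>2 = m] (mod int p)" unfolding QuadRes_def by blast
  then have "int p dvd m - y\<^sup>2" by (metis cong_iff_dvd_diff cong_sym)
  then have "N (of_int (m - y\<^sup>2)) < 1" using N_of_int_less_1_iff by blast
  moreover have "\<not> int p dvd y\<^sup>2" using \<open>int p dvd m - y\<^sup>2\<close> assms by (metis dvd_diffD diff_add_cancel dvd_add)
  then have "N (of_int (y\<^sup>2)) = 1" using N_of_int_eq_1_iff by blast
  ultimately have "N (of_int m - (of_int y)\<^sup>2) < N ((of_int y)\<^sup>2)" by simp
  moreover have "y \<noteq> 0" using \<open>\<not> int p dvd y\<^sup>2\<close> by auto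
  ultimately show "psq (of_int m)" using psq_near by auto
qed

text \<open>By Euler's criterion both sides are congruent modulo p; as they lie in {-1, 0, 1} and p
  > 2, they are equal.\<close>

lemma Legendre_mult: "Legendre (m * n) (int p) = Legendre m (int p) * Legendre n (int p)"
proof -
  have p2: "2 < p" using p_gt_1 p_ne_2 by linarith
  note e = euler_criterion[OF prime_p p2]
  have "[Legendre (m * n) (int p) = (m * n) ^ ((p - 1) div 2)] (mod int p)" by (rule e)
  moreover have "[Legendre m (int p) * Legendre n (int p) = m ^ ((p - 1) div 2) * n ^ ((p - 1) div 2)] (mod int p)"
    by (intro cong_mult e)
  ultimately have "[Legendre (m * n) (int p) = Legendre m (int p) * Legendre n (int p)] (mod int p)"
    by (metis cong_sym cong_trans power_mult_distrib)
  then have d: "int p dvd Legendre (m * n) (int p) - Legendre m (int p) * Legendre n (int p)"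
    by (simp add: cong_iff_dvd_diff)
  have "\<bar>Legendre (m * n) (int p)\<bar> \<le> 1" "\<bar>Legendre m (int p) * Legendre n (int p)\<bar> \<le> 1"
    by (auto simp: Legendre_def)
  then have "\<bar>Legendre (m * n) (int p) - Legendre m (int p) * Legendre n (int p)\<bar> < int p" using p2 by linarith
  then show ?thesis using d zdvd_imp_le[of "int p" "\<bar>Legendre (m * n) (int p) - Legendre m (int p) * Legendre n (int p)\<bar>"]
    by fastforce
qed

lemma psq_Legendre: "\<not> int p dvd m \<Longrightarrow> psq (of_int m) \<longleftrightarrow> Legendre m (int p) = 1"
  using psq_of_int[of m] by (auto simp: Legendre_def cong_0_iff)

text \<open>Unit squares have index two in the units; integer approximations reduce this to the
  multiplicativity of the Legendre symbol.\<close>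

lemma psq_unit_mult:
  assumes "N x = 1" "N y = 1" shows "psq (x * y) \<longleftrightarrow> (psq x \<longleftrightarrow> psq y)"
proof -
  obtain m n where mn: "N (x - of_int m) < 1" "N (y - of_int n) < 1"
    using near_int[of x] near_int[of y] assms by auto
  have Nm: "N (of_int m) = 1" "N (of_int n) = 1"
    using N_eq_of_close[of "of_int m" x] N_eq_of_close[of "of_int n" y] mn assms by (simp_all add: N_minus_commute)
  have nd: "\<not> int p dvd m" "\<not> int p dvd n" "\<not> int p dvd m * n"
    using Nm N_of_int_eq_1_iff prime_int_p by (auto simp: prime_dvd_mult_iff)
  have "N ((x - of_int m) * y + of_int m * (y - of_int n)) < 1"
    using mn assms Nm by (intro N_add_less) (simp_all add: N_mult)
  then have xy: "N (x * y - of_int (m * n)) < N (of_int (m * n))"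
    using Nm by (simp add: algebra_simps N_mult)
  have L: "Legendre m (int p) = 1 \<or> Legendre m (int p) = - 1" "Legendre n (int p) = 1 \<or> Legendre n (int p) = - 1"
    using nd by (auto simp: Legendre_def cong_0_iff)
  have "psq (x * y) \<longleftrightarrow> Legendre m (int p) * Legendre n (int p) = 1"
    using psq_near_iff[OF xy] psq_Legendre[OF nd(3)] Legendre_mult by simp
  moreover have "psq x \<longleftrightarrow> Legendre m (int p) = 1" using psq_near_iff[of x "of_int m"] mn Nm psq_Legendre[OF nd(1)] by simp
  moreover have "psq y \<longleftrightarrow> Legendre n (int p) = 1" using psq_near_iff[of y "of_int n"] mn Nm psq_Legendre[OF nd(2)] by simp
  ultimately show ?thesis using L by auto
qed

lemma even_val_unit:
  assumes "x \<noteq> 0" "even (v x)" obtains c where "c \<noteq> 0" "N (x * c\<^sup>2) = 1"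
proof -
  define c :: rat where "c = of_nat p powi (- (v x div 2))"
  have p0: "(of_nat p :: rat) \<noteq> 0" using p_gt_1 by simp
  then have c: "c \<noteq> 0" by (simp add: c_def)
  have vc: "v c = - (v x div 2)" unfolding c_def using padic_val_powi[OF p0, of "- (v x div 2)"] by simp
  have "v (x * c\<^sup>2) = 0" using assms c vc by (simp add: padic_val_power)
  then have "N (x * c\<^sup>2) = 1" using assms c by (simp add: N_eq_1_iff)
  then show ?thesis using that c by blast
qed

lemma psq_even_mult:
  assumes "x \<noteq> 0" "y \<noteq> 0" "even (v x)" "even (v y)" shows "psq (x * y) \<longleftrightarrow> (psq x \<longleftrightarrow> psq y)"
proof -
  obtain c where c: "c \<noteq> 0" "N (x * c\<^sup>2) = 1" using even_val_unit assms by blast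
  obtain d where d: "d \<noteq> 0" "N (y * d\<^sup>2) = 1" using even_val_unit assms by blast
  have "x * c\<^sup>2 * (y * d\<^sup>2) = x * y * (c * d)\<^sup>2" by (simp add: power_mult_distrib)
  then have "psq (x * y) \<longleftrightarrow> psq (x * c\<^sup>2 * (y * d\<^sup>2))"
    using c(1) d(1) psq_mult_square[of "c * d" "x * y"] by (metis mult_eq_0_iff)
  then show ?thesis using psq_unit_mult[OF c(2) d(2)] c d by simp
qed

text \<open>The norm form of a nonsquare admits no cancellation: if the difference were smaller than
  its terms, \<beta> x^2 would be close to z^2 and thus \<beta> a square.\<close>

lemma nonsq_norm:
  assumes \<beta>: "\<beta> \<noteq> 0" "\<not> psq \<beta>" shows "N (z\<^sup>2 - \<beta> * x\<^sup>2) = max (N (z\<^sup>2)) (N (\<beta> * x\<^sup>2))"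
proof (rule ccontr)
  assume ne: "N (z\<^sup>2 - \<beta> * x\<^sup>2) \<noteq> max (N (z\<^sup>2)) (N (\<beta> * x\<^sup>2))"
  have eq: "N (z\<^sup>2) = N (\<beta> * x\<^sup>2)"
    using ne N_diff_eq[of "\<beta> * x\<^sup>2" "z\<^sup>2"] N_diff_eq2[of "z\<^sup>2" "\<beta> * x\<^sup>2"]
    by (cases "N (z\<^sup>2)" "N (\<beta> * x\<^sup>2)" rule: linorder_cases) auto
  then have lt: "N (\<beta> * x\<^sup>2 - z\<^sup>2) < N (z\<^sup>2)"
    using ne N_diff_le_max[of "z\<^sup>2" "\<beta> * x\<^sup>2"] by (simp add: N_minus_commute)
  then have "N (z\<^sup>2) > 0" using N_nonneg[of "\<beta> * x\<^sup>2 - z\<^sup>2"] by linarith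
  then have z: "z \<noteq> 0" by auto
  then have "psq (\<beta> * x\<^sup>2)" using psq_near[OF lt] by simp
  moreover have "x \<noteq> 0" using eq z by (auto simp: N_power)
  ultimately show False using \<beta> by simp
qed

section \<open>The local image for coefficients of good reduction\<close>

lemma even_of_N_eq_square:
  assumes "N (\<alpha> * z\<^sup>2) = N (g\<^sup>2)" "g \<noteq> 0" "\<alpha> \<noteq> 0" shows "even (v \<alpha>)"
proof -
  have "g\<^sup>2 \<noteq> 0" using assms by simp
  then have "\<alpha> * z\<^sup>2 \<noteq> 0" using assms(1) by (metis N_eq_0)
  then have z: "z \<noteq> 0" by auto
  have "v (\<alpha> * z\<^sup>2) = v (g\<^sup>2)" using assms z N_eq_iff by simp
  then have "v \<alpha> = 2 * (v g - v z)" using assms z by (simp add: padic_val_power)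
  then show ?thesis by simp
qed

lemma N_eq_of_diff_less: "N (x - y) < e \<Longrightarrow> e \<le> N y \<Longrightarrow> N x = N y"
  by (rule N_eq_of_close) simp

text \<open>If \<alpha> had odd valuation, u = \<alpha> w^2 could not be a unit. For small u the
  right-hand side has the size of the unit a^2 - 4b, for large u that of u^2; either way \<alpha>
  z^2 has even valuation, a contradiction.\<close>

lemma good_ptors_even:
  assumes "ptors \<alpha> a b" "\<alpha> \<noteq> 0" "N a \<le> 1" "N b = 1" "N (a\<^sup>2 - 4 * b) = 1"
  shows "even (v \<alpha>)"
proof (rule ccontr)
  assume odd: "odd (v \<alpha>)"
  then obtain w z where wz: "N (\<alpha> * z\<^sup>2 - ((\<alpha> * w\<^sup>2 - a)\<^sup>2 - 4 * b)) < 1"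
    using ptors_approx[OF assms(1), of 1] psq_even by auto
  define u where "u = \<alpha> * w\<^sup>2"
  have "N u \<noteq> 1"
  proof
    assume "N u = 1"
    then have "u \<noteq> 0" "v u = 0" using N_eq_1_iff by auto
    then have "w \<noteq> 0" by (auto simp: u_def)
    then have "v \<alpha> = - 2 * v w" using \<open>v u = 0\<close> assms(2) by (simp add: u_def padic_val_power)
    then show False using odd by simp
  qed
  then consider "N u < 1" | "N u > 1" by linarith
  then show False
  proof cases
    case 1
    have e: "(u - a)\<^sup>2 - 4 * b = (a\<^sup>2 - 4 * b) + u * (u - 2 * a)" by (simp add: power2_eq_square algebra_simps)
    have "N (u * (u - 2 * a)) < 1" using 1 assms(3) by (intro N_lt_1_prod N_diff_le) (auto simp: N_mult)
    then have "N ((u - a)\<^sup>2 - 4 * b) = 1" unfolding e using assms(5) N_add_eq by simp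
    then have "N (\<alpha> * z\<^sup>2) = N (1\<^sup>2)" using N_eq_of_diff_less[OF wz] unfolding u_def by simp
    then show False using even_of_N_eq_square[of \<alpha> z 1] assms(2) odd by simp
  next
    case 2
    have "N (u - a) = N u" using 2 assms(3) by (intro N_diff_eq) simp
    then have g: "N ((u - a)\<^sup>2) = N (u\<^sup>2)" by (simp add: N_power)
    have "N (u\<^sup>2) > 1" using 2 by (simp add: N_power)
    then have "N ((u - a)\<^sup>2 - 4 * b) = N (u\<^sup>2)" using g assms(4) N_diff_eq[of "4 * b" "(u - a)\<^sup>2"] by (simp add: N_mult)
    then have "N (\<alpha> * z\<^sup>2) = N (u\<^sup>2)" using N_eq_of_diff_less[OF wz] \<open>N (u\<^sup>2) > 1\<close> unfolding u_def by simp
    moreover have "u \<noteq> 0" using 2 by auto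
    ultimately show False using even_of_N_eq_square assms(2) odd by blast
  qed
qed

text \<open>Since k and p - k have equal squares, the nonzero squares all arise from 1, ...,
  (p-1)/2. Zero is counted together with the nonresidues, which raises the bound from (p-1)/2 to
  (p+1)/2; the counting argument depends on this extra element.\<close>

lemma nonres_card: "(p + 1) div 2 \<le> card {c \<in> {0..<int p}. c = 0 \<or> \<not> QuadRes (int p) c}"
proof -
  define h where "h = (p - 1) div 2"
  have ph: "p = 2 * h + 1" using odd_p p_gt_1 by (auto simp: h_def elim!: oddE)
  let ?S = "{c \<in> {0..<int p}. c = 0 \<or> \<not> QuadRes (int p) c}"
  have sub: "{0..<int p} - ?S \<subseteq> (\<lambda>k. k\<^sup>2 mod int p) ` {1..int h}"
  proof
    fix c assume "c \<in> {0..<int p} - ?S"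
    then have c: "0 < c" "c < int p" "QuadRes (int p) c" by auto
    then obtain y where y: "[y\<^sup>2 = c] (mod int p)" unfolding QuadRes_def by blast
    define k where "k = y mod int p"
    have k: "[k\<^sup>2 = c] (mod int p)" "0 \<le> k" "k < int p" using y p_gt_1 by (auto simp: k_def unique_euclidean_semiring_class.cong_def power_mod)
    have "k \<noteq> 0" using k(1) c by (auto simp: unique_euclidean_semiring_class.cong_def)
    have c': "k'\<^sup>2 mod int p = c" if "[k'\<^sup>2 = c] (mod int p)" for k' using that c by (simp add: unique_euclidean_semiring_class.cong_def)
    show "c \<in> (\<lambda>k. k\<^sup>2 mod int p) ` {1..int h}"
    proof (cases "k \<le> int h")
      case True
      then show ?thesis using c'[OF k(1)] k \<open>k \<noteq> 0\<close> by (intro image_eqI[of _ _ k]) auto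
    next
      case False
      have "(int p - k)\<^sup>2 = k\<^sup>2 + int p * (int p - 2 * k)" by (simp add: power2_eq_square algebra_simps)
      then have "[(int p - k)\<^sup>2 = k\<^sup>2] (mod int p)" by (simp add: unique_euclidean_semiring_class.cong_def)
      then have "[(int p - k)\<^sup>2 = c] (mod int p)" using k(1) cong_trans by blast
      then show ?thesis using c' False k ph by (intro image_eqI[of _ _ "int p - k"]) auto
    qed
  qed
  have "card ({0..<int p} - ?S) \<le> card ((\<lambda>k. k\<^sup>2 mod int p) ` {1..int h})" by (intro card_mono sub) auto
  also have "\<dots> \<le> h" using card_image_le[of "{1..int h}"] by simp
  finally have "card ({0..<int p} - ?S) \<le> h" .
  moreover have "card ({0..<int p} - ?S) = card {0..<int p} - card ?S"
    by (rule card_Diff_subset) (auto intro: finite_subset[of _ "{0..<int p}"])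
  ultimately show ?thesis using ph by simp
qed

text \<open>A residue \<open>c\<close> for which \<open>(c - A)\<^sup>2 - 4 B\<close> is a nonzero square has two preimages under the map
  \<open>x \<mapsto> x + B/x + A\<close> on the nonzero residues, so there are at most \<open>(p - 1)/2\<close> of them.\<close>

lemma exists_nonres_value:
  assumes B: "\<not> int p dvd B"
  shows "\<exists>c. (c = 0 \<or> \<not> QuadRes (int p) c) \<and>
    \<not> (QuadRes (int p) ((c - A)\<^sup>2 - 4 * B) \<and> \<not> int p dvd (c - A)\<^sup>2 - 4 * B)"
proof (rule ccontr)
  assume assms2: "\<not> ?thesis"
  have all: "QuadRes (int p) ((c - A)\<^sup>2 - 4 * B) \<and> \<not> int p dvd (c - A)\<^sup>2 - 4 * B"
    if "c = 0 \<or> \<not> QuadRes (int p) c" for c using assms2 that by blast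
  define S where "S = {c \<in> {0..<int p}. c = 0 \<or> \<not> QuadRes (int p) c}"
  define T where "T c = {x \<in> {1..<int p}. [x * (c - A - x) = B] (mod int p)}" for c
  obtain i where i: "[2 * i = 1] (mod int p)"
    using cong_solve_coprime_int[of 2 "int p"] odd_p by (auto simp: coprime_commute)
  have fin: "finite S" "\<And>c. finite (T c)" 
    by (auto intro: finite_subset[of _ "{0..<int p}"] simp: S_def T_def)
  have two: "card (T c) \<ge> 2" if "c \<in> S" for c
  proof -
    have cS: "c = 0 \<or> \<not> QuadRes (int p) c" using that by (auto simp: S_def)
    obtain h where h: "[h\<^sup>2 = (c - A)\<^sup>2 - 4 * B] (mod int p)" using all[OF cS] unfolding QuadRes_def by blast
    have hp: "\<not> int p dvd h"
    proof
      assume "int p dvd h"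
      then have "int p dvd h\<^sup>2" by (simp add: power2_eq_square)
      then have "int p dvd (c - A)\<^sup>2 - 4 * B" using h by (simp add: cong_dvd_iff)
      then show False using all[OF cS] by blast
    qed
    \<comment> \<open>Since \<open>i\<close> is the inverse of 2, this is the root (c - A + k)/2 of
      X (c - A - X) = B. The two signs of k give two different roots.\<close>
    have mem: "((c - A + k) * i) mod int p \<in> T c" if k: "[k\<^sup>2 = (c - A)\<^sup>2 - 4 * B] (mod int p)" for k
    proof -
      define x where "x = ((c - A + k) * i) mod int p"
      have x: "[x = (c - A + k) * i] (mod int p)" by (simp add: x_def)
      have "[2 * x = 2 * ((c - A + k) * i)] (mod int p)" using x by (intro cong_mult) auto
      moreover have "2 * ((c - A + k) * i) = (c - A + k) * (2 * i)" by simp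
      moreover have "[(c - A + k) * (2 * i) = (c - A + k) * 1] (mod int p)" using i by (intro cong_mult) auto
      ultimately have x2: "[2 * x = c - A + k] (mod int p)" using cong_trans by fastforce
      have "[2 * x * (2 * (c - A) - 2 * x) = (c - A + k) * (2 * (c - A) - (c - A + k))] (mod int p)"
        by (rule cong_mult[OF x2 cong_diff[OF cong_refl x2]])
      moreover have "(c - A + k) * (2 * (c - A) - (c - A + k)) = (c - A)\<^sup>2 - k\<^sup>2" by (simp add: power2_eq_square algebra_simps)
      ultimately have "[2 * x * (2 * (c - A) - 2 * x) = (c - A)\<^sup>2 - k\<^sup>2] (mod int p)" by (simp only:)
      from cong_trans[OF this cong_diff[OF cong_refl k]]
      have "[2 * x * (2 * (c - A) - 2 * x) = 4 * B] (mod int p)" by simp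
      moreover have "2 * x * (2 * (c - A) - 2 * x) = 4 * (x * (c - A - x))" by (simp add: algebra_simps)
      ultimately have "[4 * (x * (c - A - x)) = 4 * B] (mod int p)" by (simp only:)
      moreover have "coprime 4 (int p)" using odd_p coprime_mult_left_iff[of 2 2 "int p"] by simp
      ultimately have xB: "[x * (c - A - x) = B] (mod int p)" using cong_mult_lcancel by blast
      have "x \<noteq> 0" using xB B by (auto simp: cong_iff_dvd_diff cong_0_iff dest: cong_sym)
      moreover have "0 \<le> x" "x < int p" using p_gt_1 by (auto simp: x_def)
      ultimately show ?thesis using xB unfolding T_def x_def by auto
    qed
    have "((c - A + h) * i) mod int p \<noteq> ((c - A + (- h)) * i) mod int p"
    proof
      assume "((c - A + h) * i) mod int p = ((c - A + (- h)) * i) mod int p"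
      then have "int p dvd (c - A + h) * i - (c - A + (- h)) * i" by (simp add: mod_eq_dvd_iff)
      then have "int p dvd h * (2 * i)" by (simp add: algebra_simps)
      then have "int p dvd 2 * i" using hp prime_int_p by (simp add: prime_dvd_mult_iff)
      then have "int p dvd 1" using i by (metis cong_dvd_iff)
      then show False using p_gt_1 by auto
    qed
    then have "card {((c - A + h) * i) mod int p, ((c - A + (- h)) * i) mod int p} = 2" by simp
    moreover have "{((c - A + h) * i) mod int p, ((c - A + (- h)) * i) mod int p} \<subseteq> T c" using mem[OF h] mem[of "- h"] h by simp
    ultimately show ?thesis using card_mono[OF fin(2)] by metis
  qed
  have disj: "T c \<inter> T c' = {}" if "c \<in> S" "c' \<in> S" "c \<noteq> c'" for c c'
  proof (rule ccontr)
    assume "T c \<inter> T c' \<noteq> {}"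
    then obtain x where x: "1 \<le> x" "x < int p" "[x * (c - A - x) = B] (mod int p)" "[x * (c' - A - x) = B] (mod int p)"
      by (auto simp: T_def)
    then have "int p dvd x * (c - A - x) - x * (c' - A - x)" by (metis cong_iff_dvd_diff cong_sym cong_trans)
    then have "int p dvd x * (c - c')" by (simp add: algebra_simps)
    moreover have "\<not> int p dvd x" using x zdvd_not_zless[of x "int p"] by linarith
    ultimately have "int p dvd c - c'" using prime_int_p by (simp add: prime_dvd_mult_iff)
    then have "c mod int p = c' mod int p" by (simp add: mod_eq_dvd_iff)
    then show False using that by (auto simp: S_def)
  qed
  \<comment> \<open>The disjoint sets \<open>T c\<close> fit into p - 1 nonzero residues, so 2 |S|
    would be at most p - 1, whereas it is at least p + 1.\<close>
  have "2 * card S \<le> (\<Sum>c\<in>S. card (T c))" using sum_mono[of S "\<lambda>_. 2" "\<lambda>c. card (T c)"] two by simp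
  also have "\<dots> = card (\<Union>c\<in>S. T c)" using fin disj by (intro card_UN_disjoint[symmetric]) auto
  also have "\<dots> \<le> card {1..<int p}" by (intro card_mono) (auto simp: T_def)
  finally have "2 * card S \<le> p - 1" by simp
  moreover have "(p + 1) div 2 \<le> card S" using nonres_card unfolding S_def .
  ultimately show False using odd_p p_gt_1 by (auto elim!: oddE)
qed

text \<open>For a nonsquare unit \<alpha>, the residue c of \<alpha> w^2 has to be 0 or a
  nonresidue, and any such c is available. If f(c) = (c - a)^2 - 4b is a nonsquare unit, then
  \<alpha> f(c) is a square and the torsor has a point there. If f(c) vanishes modulo p, c lifts to
  an exact root of f, and the point has z = 0. The counting lemma supplies a c of one of these two
  kinds.\<close>

lemma good_even_ptors_unit:
  assumes \<alpha>: "N \<alpha> = 1" and ab: "N a \<le> 1" "N b = 1" "N (a\<^sup>2 - 4 * b) = 1"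
  shows "ptors \<alpha> a b"
proof (cases "psq \<alpha>")
  case True
  then show ?thesis by (simp add: ptors_def)
next
  case nsq: False
  have \<alpha>0: "\<alpha> \<noteq> 0" using \<alpha> by auto
  have combine: "psq (\<alpha> * x)" if "N x = 1" "\<not> psq x" for x using psq_unit_mult[OF \<alpha> that(1)] that nsq by simp
  obtain A B where AB: "N (a - of_int A) < 1" "N (b - of_int B) < 1" using near_int[of a] near_int[of b] ab by auto
  have "N (of_int B) = 1" using N_eq_of_close[of "of_int B" b] AB ab by (simp add: N_minus_commute)
  then have "\<not> int p dvd B" using N_of_int_eq_1_iff by blast
  then obtain c where c: "c = 0 \<or> \<not> QuadRes (int p) c"
    and fc: "\<not> (QuadRes (int p) ((c - A)\<^sup>2 - 4 * B) \<and> \<not> int p dvd (c - A)\<^sup>2 - 4 * B)"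
    using exists_nonres_value by blast
  have close: "N (((u - a)\<^sup>2 - 4 * b) - of_int ((c - A)\<^sup>2 - 4 * B)) < 1" if u: "N (u - of_int c) < 1" for u
  proof -
    define k where "k = (u - of_int c) - (a - of_int A)"
    have k: "N k < 1" unfolding k_def by (rule N_diff_less[OF u AB(1)])
    have e: "((u - a)\<^sup>2 - 4 * b) - of_int ((c - A)\<^sup>2 - 4 * B) = k * (k + 2 * (of_int (c - A))) - 4 * (b - of_int B)"
      by (simp add: k_def power2_eq_square algebra_simps)
    have "N (2 * of_int (c - A)) \<le> 1" unfolding N_mult N_2 using N_of_int_le_1[of "c - A"] by simp
    then have "N (k + 2 * of_int (c - A)) \<le> 1" using k by (intro N_add_le) auto
    then have "N (k * (k + 2 * of_int (c - A))) < 1" using k N_lt_1_prod by blast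
    moreover have "N (4 * (b - of_int B)) < 1" unfolding N_mult N_4 using AB by simp
    ultimately show ?thesis unfolding e by (rule N_diff_less)
  qed
  show ?thesis
  proof (cases "c = 0")
    case True
    have n: "N ((a\<^sup>2 - 4 * b) - of_int ((c - A)\<^sup>2 - 4 * B)) < 1" using close[of 0] True by simp
    then have N1: "N (of_int ((c - A)\<^sup>2 - 4 * B)) = 1"
      using N_eq_of_close[of "of_int ((c - A)\<^sup>2 - 4 * B)" "a\<^sup>2 - 4 * b"] ab(3) by (simp add: N_minus_commute)
    then have nd: "\<not> int p dvd (c - A)\<^sup>2 - 4 * B" using N_of_int_eq_1_iff by blast
    then have "\<not> psq (of_int ((c - A)\<^sup>2 - 4 * B))" using fc psq_of_int[OF nd] by blast
    then have "\<not> psq (a\<^sup>2 - 4 * b)" using psq_near_iff[of "a\<^sup>2 - 4 * b" "of_int ((c - A)\<^sup>2 - 4 * B)"] n N1 by simp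
    then have "psq (\<alpha> * ((\<alpha> * 0\<^sup>2 - a)\<^sup>2 - 4 * b))" using combine[OF ab(3)] by simp
    then show ?thesis by (rule ptorsI[OF \<alpha>0])
  next
    case False
    then have cn: "\<not> QuadRes (int p) c" using c by blast
    have cd: "\<not> int p dvd c"
    proof
      assume "int p dvd c"
      then have "[c = 0\<^sup>2] (mod int p)" by (simp add: cong_0_iff)
      then have "[0\<^sup>2 = c] (mod int p)" by (rule cong_sym)
      then show False using cn unfolding QuadRes_def by blast
    qed
    then have Nc: "N (of_int c) = 1" using N_of_int_eq_1_iff by blast
    have "\<not> psq (of_int c)" using psq_of_int[OF cd] cn by blast
    then have \<alpha>c: "psq (\<alpha> * of_int c)" using combine Nc by blast
    show ?thesis
    proof (cases "int p dvd (c - A)\<^sup>2 - 4 * B")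
      case True
      \<comment> \<open>As f(c) = 4 (r^2 - b) vanishes modulo p, r approximates a square root of b,
        with a + 2r = c.\<close>
      define r where "r = (of_int c - a) / 2"
      have "N (of_int ((c - A)\<^sup>2 - 4 * B)) < 1" using True N_of_int_less_1_iff by blast
      then have "N ((((of_int c - a)\<^sup>2 - 4 * b) - of_int ((c - A)\<^sup>2 - 4 * B)) + of_int ((c - A)\<^sup>2 - 4 * B)) < 1"
        using close[of "of_int c"] by (intro N_add_less) simp_all
      then have "N ((of_int c - a)\<^sup>2 - 4 * b) < 1" by simp
      moreover have "(of_int c - a)\<^sup>2 - 4 * b = 4 * (r\<^sup>2 - b)" by (simp add: r_def field_simps power2_eq_square)
      ultimately have "N (4 * (r\<^sup>2 - b)) < 1" by (simp only:)
      then have rb: "N (r\<^sup>2 - b) < 1" unfolding N_mult N_4 by simp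
      then have Nr2: "N (r\<^sup>2) = 1" using N_eq_of_close[of "r\<^sup>2" b] ab by simp
      then have Nr: "N r = 1" using N_power[of r 2] by (metis N_nonneg power2_eq_1_iff not_one_le_zero neg_0_le_iff_le)
      have "a + 2 * r = of_int c" by (simp add: r_def)
      then show ?thesis using \<alpha>c Nc Nr Nr2 rb by (intro ptorsI_root[OF \<alpha>0, of r]) auto
    next
      case nd: False
      then have nsqf: "\<not> psq (of_int ((c - A)\<^sup>2 - 4 * B))" using fc psq_of_int[OF nd] by blast
      obtain s where s: "s \<noteq> 0" "N (\<alpha> * of_int c - s\<^sup>2) < N (s\<^sup>2)" using psq_obtain_near[OF \<alpha>c] by blast
      have Ns: "N (s\<^sup>2) = 1" using N_eq_of_close[OF s(2)] \<alpha> Nc by (simp add: N_mult)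
      \<comment> \<open>Chosen so that \<alpha> w^2 = s^2/\<alpha> is close to c.\<close>
      define w where "w = s / \<alpha>"
      have "\<alpha> * w\<^sup>2 - of_int c = (s\<^sup>2 - \<alpha> * of_int c) / \<alpha>" using \<alpha>0 by (simp add: w_def field_simps power2_eq_square)
      then have "N (\<alpha> * w\<^sup>2 - of_int c) < 1" using s(2) Ns \<alpha> by (simp add: N_divide N_minus_commute)
      from close[OF this] have n: "N (((\<alpha> * w\<^sup>2 - a)\<^sup>2 - 4 * b) - of_int ((c - A)\<^sup>2 - 4 * B)) < N (of_int ((c - A)\<^sup>2 - 4 * B))"
        using nd N_of_int_eq_1_iff[of "(c - A)\<^sup>2 - 4 * B"] by simp
      have "\<not> psq ((\<alpha> * w\<^sup>2 - a)\<^sup>2 - 4 * b)" using psq_near_iff[OF n] nsqf by blast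
      moreover have "N ((\<alpha> * w\<^sup>2 - a)\<^sup>2 - 4 * b) = 1" using N_eq_of_close[OF n] nd N_of_int_eq_1_iff[of "(c - A)\<^sup>2 - 4 * B"] by simp
      ultimately show ?thesis using combine ptorsI[OF \<alpha>0] by blast
    qed
  qed
qed

lemma good_ptors_iff:
  assumes "\<alpha> \<noteq> 0" "N a \<le> 1" "N b = 1" "N (a\<^sup>2 - 4 * b) = 1"
  shows "ptors \<alpha> a b \<longleftrightarrow> even (v \<alpha>)"
proof
  assume "even (v \<alpha>)"
  then obtain c where "c \<noteq> 0" "N (\<alpha> * c\<^sup>2) = 1" using even_val_unit assms(1) by blast
  then show "ptors \<alpha> a b" using good_even_ptors_unit[of "\<alpha> * c\<^sup>2" a b] ptors_mult_square[of c \<alpha> a b] assms by simp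
qed (use good_ptors_even assms in blast)

section \<open>Twists by an element of odd valuation\<close>

lemma twist_ptors_even:
  assumes "ptors \<alpha> (a * D) (b * D\<^sup>2)" "\<alpha> \<noteq> 0" "N b = 1" "\<not> psq b" "D \<noteq> 0"
  shows "even (v \<alpha>)"
proof -
  have "N (D\<^sup>2) > 0" using assms by simp
  from ptors_approx[OF assms(1) this] show ?thesis
  proof (elim disjE exE)
    fix w z assume wz: "N (\<alpha> * z\<^sup>2 - ((\<alpha> * w\<^sup>2 - a * D)\<^sup>2 - 4 * (b * D\<^sup>2))) < N (D\<^sup>2)"
    define g where "g = \<alpha> * w\<^sup>2 - a * D"
    \<comment> \<open>The right-hand side g^2 - 4b D^2 is a value of the norm form of the nonsquare
      4b. Without cancellation it has the absolute value of g^2 or of D^2, which forces \<alpha> to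
      have even valuation.\<close>
    have n4: "\<not> psq (b * 2\<^sup>2)" "b * 2\<^sup>2 \<noteq> 0" using assms psq_mult_square[of 2 b] by auto
    have "N (g\<^sup>2 - (b * 2\<^sup>2) * D\<^sup>2) = max (N (g\<^sup>2)) (N ((b * 2\<^sup>2) * D\<^sup>2))" by (rule nonsq_norm[OF n4(2,1)])
    then have Nf: "N (g\<^sup>2 - 4 * (b * D\<^sup>2)) = max (N (g\<^sup>2)) (N (D\<^sup>2))"
      using assms(3) by (simp add: N_mult N_power algebra_simps)
    then have e: "N (\<alpha> * z\<^sup>2) = max (N (g\<^sup>2)) (N (D\<^sup>2))"
      using N_eq_of_diff_less[OF wz] unfolding g_def[symmetric] by simp
    show ?thesis
    proof (cases "N (g\<^sup>2) \<le> N (D\<^sup>2)")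
      case True
      then have "N (\<alpha> * z\<^sup>2) = N (D\<^sup>2)" using e by simp
      then show ?thesis using even_of_N_eq_square assms by blast
    next
      case False
      then have "N (\<alpha> * z\<^sup>2) = N (g\<^sup>2)" "g \<noteq> 0" using e by auto
      then show ?thesis using even_of_N_eq_square assms by blast
    qed
  qed (rule psq_even)
qed

lemma ptors_twist_root:
  assumes "\<alpha> \<noteq> 0" "D \<noteq> 0" "N r = 1" "N (r\<^sup>2 - b) < 1" "N (a + 2 * r) = 1" "psq (\<alpha> * D * (a + 2 * r))"
  shows "ptors \<alpha> (a * D) (b * D\<^sup>2)"
proof (rule ptorsI_root[where r = "r * D"])
  have "(r * D)\<^sup>2 - b * D\<^sup>2 = (r\<^sup>2 - b) * D\<^sup>2" by (simp add: algebra_simps power_mult_distrib)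
  then have "N ((r * D)\<^sup>2 - b * D\<^sup>2) = N (r\<^sup>2 - b) * N (D\<^sup>2)" by (simp only: N_mult)
  also have "\<dots> < 1 * N (D\<^sup>2)" using assms by (intro mult_strict_right_mono) auto
  finally show "N ((r * D)\<^sup>2 - b * D\<^sup>2) < N ((r * D)\<^sup>2)" using assms by (simp add: N_power N_mult)
  have e: "a * D + 2 * (r * D) = D * (a + 2 * r)" by (simp add: algebra_simps)
  show "N (r * D) \<le> N (a * D + 2 * (r * D))" unfolding e using assms by (simp add: N_mult)
  show "psq (\<alpha> * (a * D + 2 * (r * D)))" unfolding e using assms(6) by (simp add: mult.assoc)
qed (use assms in auto)

text \<open>For even valuation, w = 0 works: the right-hand side is D^2 times the nonsquare unit a^2
  - 4b. For odd valuation, \<alpha> D has even valuation; the units a + 2r and a - 2r have a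
  nonsquare product, so exactly one of them makes \<alpha> D (a + 2r) or \<alpha> D (a - 2r) a
  square, and the corresponding root gives a point with z = 0.\<close>

lemma twist_ptors_all:
  assumes "\<alpha> \<noteq> 0" "D \<noteq> 0" "odd (v D)" "N a \<le> 1" "N b = 1" "N (a\<^sup>2 - 4 * b) = 1" "psq b" "\<not> psq (a\<^sup>2 - 4 * b)"
  shows "ptors \<alpha> (a * D) (b * D\<^sup>2)"
proof (cases "even (v \<alpha>)")
  case True
  have nz: "a\<^sup>2 - 4 * b \<noteq> 0" "v (a\<^sup>2 - 4 * b) = 0" using assms(6) N_eq_1_iff by auto
  show ?thesis
  proof (cases "psq \<alpha>")
    case False
    then have "psq (\<alpha> * (a\<^sup>2 - 4 * b))" using psq_even_mult[OF assms(1) nz(1) True] nz assms(8) by simp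
    then have "psq (\<alpha> * (a\<^sup>2 - 4 * b) * D\<^sup>2)" using assms(2) by simp
    moreover have "\<alpha> * (a\<^sup>2 - 4 * b) * D\<^sup>2 = \<alpha> * ((\<alpha> * 0\<^sup>2 - a * D)\<^sup>2 - 4 * (b * D\<^sup>2))"
      by (simp add: power_mult_distrib algebra_simps)
    ultimately show ?thesis using ptorsI[OF assms(1)] by metis
  qed (simp add: ptors_def)
next
  case odd: False
  obtain r where r: "r \<noteq> 0" "N (b - r\<^sup>2) < N (r\<^sup>2)" using psq_obtain_near[OF assms(7)] by blast
  have Nr2: "N (r\<^sup>2) = 1" using N_eq_of_close[OF r(2)] assms(5) by simp
  then have Nr: "N r = 1" using N_power[of r 2] by (metis N_nonneg power2_eq_1_iff not_one_le_zero neg_0_le_iff_le)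
  have rb: "N (r\<^sup>2 - b) < 1" using r Nr2 by (simp add: N_minus_commute)
  have "(a + 2 * r) * (a - 2 * r) - (a\<^sup>2 - 4 * b) = - (4 * (r\<^sup>2 - b))" by (simp add: power2_eq_square algebra_simps)
  then have "N ((a + 2 * r) * (a - 2 * r) - (a\<^sup>2 - 4 * b)) = N (4 * (r\<^sup>2 - b))" by (simp only: N_minus)
  also have "\<dots> = N (r\<^sup>2 - b)" by (simp only: N_mult N_4 mult_1_left)
  finally have n: "N ((a + 2 * r) * (a - 2 * r) - (a\<^sup>2 - 4 * b)) < N (a\<^sup>2 - 4 * b)"
    using rb assms(6) by simp
  have prod: "\<not> psq ((a + 2 * r) * (a - 2 * r))" "N ((a + 2 * r) * (a - 2 * r)) = 1"
    using psq_near_iff[OF n] N_eq_of_close[OF n] assms by auto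
  have "N (a + 2 * r) \<le> 1" "N (a - 2 * r) \<le> 1" using assms(4) Nr by (auto intro!: N_add_le N_diff_le simp: N_mult)
  then have Nab: "N (a + 2 * r) = 1" "N (a - 2 * r) = 1"
    using prod(2) unfolding N_mult
    by (smt (verit) N_nonneg mult_le_cancel_left1 mult_left_le mult_le_cancel_right1)+
  have one: "psq (a + 2 * r) \<longleftrightarrow> \<not> psq (a - 2 * r)" using psq_unit_mult[OF Nab] prod(1) by blast
  have \<alpha>D: "\<alpha> * D \<noteq> 0" "even (v (\<alpha> * D))" using assms odd by auto
  have ev: "a + 2 * r \<noteq> 0" "v (a + 2 * r) = 0" "a - 2 * r \<noteq> 0" "v (a - 2 * r) = 0" using Nab N_eq_1_iff by auto
  have "psq (\<alpha> * D * (a + 2 * r)) \<or> psq (\<alpha> * D * (a - 2 * r))"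
    using psq_even_mult[OF \<alpha>D(1) ev(1) \<alpha>D(2)] psq_even_mult[OF \<alpha>D(1) ev(3) \<alpha>D(2)] ev one by auto
  then show ?thesis
  proof
    assume "psq (\<alpha> * D * (a + 2 * r))"
    then show ?thesis using ptors_twist_root[OF assms(1,2) Nr rb Nab(1)] by blast
  next
    assume "psq (\<alpha> * D * (a - 2 * r))"
    then show ?thesis using ptors_twist_root[OF assms(1,2), of "- r" b a] Nr rb Nab(2) by simp
  qed
qed

text \<open>Put c = \<alpha> w^2/D and \<zeta> = \<alpha> (z/D)^2; then \<zeta> is close to (c -
  \<beta>)(c - \<beta>'), where \<beta>\<beta>' is a square. If c is large, \<zeta> is close to c^2,
  and if c is small, to \<beta>\<beta>'; in both cases \<alpha> would be a square. If c is a unit,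
  \<alpha> has odd valuation like D. But \<alpha> D c is a square while \<alpha> D \<beta> and
  \<alpha> D \<beta>' are not, so c is far from both roots, \<zeta> is a unit, and the valuation of
  \<alpha> is even.\<close>

lemma twist_ptors_split:
  assumes \<alpha>: "\<alpha> \<noteq> 0" and D: "D \<noteq> 0" "odd (v D)" and ab: "N a \<le> 1" "N b = 1" "N (a\<^sup>2 - 4 * b) = 1" "psq (a\<^sup>2 - 4 * b)"
    and r: "N (r\<^sup>2 - b) < 1"
  shows "ptors \<alpha> (a * D) (b * D\<^sup>2) \<longleftrightarrow> psq \<alpha> \<or> psq (\<alpha> * D * (a + 2 * r))"
proof -
  have Nr2: "N (r\<^sup>2) = 1" using N_eq_of_close[of "r\<^sup>2" b] r ab(2) by simp
  then have Nr: "N r = 1" using N_power[of r 2] by (metis N_nonneg power2_eq_1_iff not_one_le_zero neg_0_le_iff_le)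
  define \<beta> \<beta>' where "\<beta> = a + 2 * r" and "\<beta>' = a - 2 * r"
  have "\<beta> * \<beta>' - (a\<^sup>2 - 4 * b) = - (4 * (r\<^sup>2 - b))" by (simp add: \<beta>_def \<beta>'_def power2_eq_square algebra_simps)
  then have "N (\<beta> * \<beta>' - (a\<^sup>2 - 4 * b)) = N (4 * (r\<^sup>2 - b))" by (simp only: N_minus)
  also have "\<dots> = N (r\<^sup>2 - b)" by (simp only: N_mult N_4 mult_1_left)
  finally have n: "N (\<beta> * \<beta>' - (a\<^sup>2 - 4 * b)) < N (a\<^sup>2 - 4 * b)" using r ab(3) by simp
  have prod: "psq (\<beta> * \<beta>')" "N (\<beta> * \<beta>') = 1" using psq_near_iff[OF n] N_eq_of_close[OF n] ab by auto
  have le: "N \<beta> \<le> 1" "N \<beta>' \<le> 1" unfolding \<beta>_def \<beta>'_def using ab(1) Nr by (auto intro!: N_add_le N_diff_le simp: N_mult)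
  then have N1: "N \<beta> = 1" "N \<beta>' = 1" using prod(2) unfolding N_mult
    by (smt (verit) N_nonneg mult_le_cancel_left1 mult_left_le mult_le_cancel_right1)+
  show ?thesis
  proof
    assume t: "ptors \<alpha> (a * D) (b * D\<^sup>2)"
    show "psq \<alpha> \<or> psq (\<alpha> * D * (a + 2 * r))"
    proof (rule ccontr)
      assume "\<not> (psq \<alpha> \<or> psq (\<alpha> * D * (a + 2 * r)))"
      then have ns: "\<not> psq \<alpha>" "\<not> psq (\<alpha> * D * \<beta>)" by (auto simp: \<beta>_def)
      have ns': "\<not> psq (\<alpha> * D * \<beta>')"
      proof
        assume h: "psq (\<alpha> * D * \<beta>')"
        have "\<beta> \<noteq> 0" "\<beta>' \<noteq> 0" using N1 by auto
        have "psq (\<beta> * \<beta>' * (\<alpha> * D * \<beta>'))" using psq_mult[OF prod(1) h] .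
        then have "psq (\<alpha> * D * \<beta> * \<beta>'\<^sup>2)" by (simp add: power2_eq_square algebra_simps)
        then show False using ns(2) \<open>\<beta>' \<noteq> 0\<close> by simp
      qed
      have "N (D\<^sup>2) > 0" using D by simp
      then obtain w z where wz: "N (\<alpha> * z\<^sup>2 - ((\<alpha> * w\<^sup>2 - a * D)\<^sup>2 - 4 * (b * D\<^sup>2))) < N (D\<^sup>2)"
        using ptors_approx[OF t] ns by blast
      define c \<zeta> where "c = \<alpha> * w\<^sup>2 / D" and "\<zeta> = \<alpha> * (z / D)\<^sup>2"
      have "\<zeta> - ((c - a)\<^sup>2 - 4 * b) = (\<alpha> * z\<^sup>2 - ((\<alpha> * w\<^sup>2 - a * D)\<^sup>2 - 4 * (b * D\<^sup>2))) / D\<^sup>2"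
        using D by (simp add: c_def \<zeta>_def field_simps power2_eq_square)
      then have "N (\<zeta> - ((c - a)\<^sup>2 - 4 * b)) < 1" using wz D by (simp add: N_divide divide_less_eq)
      moreover have "(c - a)\<^sup>2 - 4 * b = (c - \<beta>) * (c - \<beta>') + 4 * (r\<^sup>2 - b)"
        by (simp add: \<beta>_def \<beta>'_def power2_eq_square algebra_simps)
      ultimately have "N (\<zeta> - ((c - \<beta>) * (c - \<beta>') + 4 * (r\<^sup>2 - b))) < 1" by simp
      moreover have "N (4 * (r\<^sup>2 - b)) < 1" unfolding N_mult N_4 using r by simp
      ultimately have "N ((\<zeta> - ((c - \<beta>) * (c - \<beta>') + 4 * (r\<^sup>2 - b))) + 4 * (r\<^sup>2 - b)) < 1"
        by (rule N_add_less)
      then have \<zeta>: "N (\<zeta> - (c - \<beta>) * (c - \<beta>')) < 1" by simp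
      have \<zeta>sq: False if "psq \<zeta>"
      proof -
        have "z / D \<noteq> 0" using psq_nonzero[OF that] by (auto simp: \<zeta>_def)
        then show False using that ns(1) psq_mult_square[of "z / D" \<alpha>] by (simp add: \<zeta>_def)
      qed
      consider "N c > 1" | "N c < 1" | "N c = 1" by linarith
      then show False
      proof cases
        case 1
        have "0 < N c" using 1 by linarith
        from mult_strict_left_mono[OF 1 this] have lt: "N c < N (c\<^sup>2)" "1 < N (c\<^sup>2)"
          using less_1_mult[OF 1 1] unfolding power2_eq_square N_mult by simp_all
        have "N (\<beta> * \<beta>' - c * (\<beta> + \<beta>')) \<le> N c"
          using 1 prod(2) le mult_left_le[of "N (\<beta> + \<beta>')" "N c"] by (intro N_diff_le) (auto simp: N_mult intro: N_add_le)
        moreover have "N (\<zeta> - (c - \<beta>) * (c - \<beta>')) < N (c\<^sup>2)" using \<zeta> lt by linarith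
        ultimately have "N ((\<zeta> - (c - \<beta>) * (c - \<beta>')) + (\<beta> * \<beta>' - c * (\<beta> + \<beta>'))) < N (c\<^sup>2)"
          using lt by (intro N_add_less) auto
        then have "N (\<zeta> - c\<^sup>2) < N (c\<^sup>2)" by (simp add: power2_eq_square algebra_simps)
        moreover have "c \<noteq> 0" using 1 by auto
        ultimately show False using psq_near \<zeta>sq by blast
      next
        case 2
        have "N (c * (c - (\<beta> + \<beta>'))) < 1" using 2 le by (intro N_lt_1_prod N_diff_le N_add_le) auto
        then have "N ((\<zeta> - (c - \<beta>) * (c - \<beta>')) + c * (c - (\<beta> + \<beta>'))) < 1" using \<zeta> by (intro N_add_less)
        then have "N (\<zeta> - \<beta> * \<beta>') < N (\<beta> * \<beta>')" using prod(2) by (simp add: algebra_simps)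
        then show False using psq_near prod(1) \<zeta>sq by blast
      next
        case 3
        have c0: "c \<noteq> 0" using 3 by auto
        then have w0: "w \<noteq> 0" by (auto simp: c_def)
        have "\<alpha> * D * c = (\<alpha> * w)\<^sup>2" using D by (simp add: c_def power2_eq_square)
        then have sqc: "psq (\<alpha> * D * c)" using \<alpha> w0 by simp
        have far: "N (c - \<gamma>) = 1" if "N \<gamma> = 1" "\<not> psq (\<alpha> * D * \<gamma>)" for \<gamma>
        proof (rule ccontr)
          assume "N (c - \<gamma>) \<noteq> 1"
          moreover have "N (c - \<gamma>) \<le> 1" using 3 that by (intro N_diff_le) auto
          ultimately have "N (c - \<gamma>) < N \<gamma>" using that by simp
          then have "N (\<alpha> * D * c - \<alpha> * D * \<gamma>) < N (\<alpha> * D * \<gamma>)" using \<alpha> D by (intro near_mult) auto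
          then show False using psq_near_iff sqc that(2) by blast
        qed
        have "N ((c - \<beta>) * (c - \<beta>')) = 1" using far N1 ns(2) ns' by (simp add: N_mult)
        then have "N \<zeta> = N (1\<^sup>2)" using N_eq_of_close[of \<zeta> "(c - \<beta>) * (c - \<beta>')"] \<zeta> by simp
        then have "even (v \<alpha>)" unfolding \<zeta>_def using even_of_N_eq_square[of \<alpha> "z / D" 1] \<alpha> by simp
        moreover have "v c = 0" using 3 N_eq_1_iff by blast
        then have "v \<alpha> + 2 * v w = v D" using \<alpha> D w0 by (simp add: c_def padic_val_divide padic_val_power)
        ultimately show False using D(2) by presburger
      qed
    qed
  next
    assume "psq \<alpha> \<or> psq (\<alpha> * D * (a + 2 * r))"
    then show "ptors \<alpha> (a * D) (b * D\<^sup>2)"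
      using ptors_twist_root[OF \<alpha> D(1) Nr r, of a] N1(1) unfolding \<beta>_def by (auto simp: ptors_def)
  qed
qed

end

section \<open>The local conditions and the Hilbert symbol\<close>

context padic begin

text \<open>Elements of \<open>Qp\<close> are classes of Cauchy sequences, so the equation in the
  field becomes, for representatives, the null condition of \<open>ptors\<close>.\<close>

lemma tors_Qp_iff:
  assumes "\<alpha> \<noteq> 0"
  shows "tors Qp (padic_of_rat p \<alpha>) (padic_of_rat p a) (padic_of_rat p b) \<longleftrightarrow> ptors \<alpha> a b"
proof -
  note pc = pcauchy_intros
  have 1: "(\<exists>w\<in>carrier Qp. padic_of_rat p \<alpha> = w \<otimes>\<^bsub>Qp\<^esub> w) \<longleftrightarrow> psq \<alpha>"
  proof -
    have e: "padic_of_rat p \<alpha> = cls t \<otimes>\<^bsub>Qp\<^esub> cls t \<longleftrightarrow> pnull (\<lambda>n. (t n)\<^sup>2 - \<alpha>)" if t: "pcauchy t" for t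
    proof -
      have "padic_of_rat p \<alpha> = cls t \<otimes>\<^bsub>Qp\<^esub> cls t \<longleftrightarrow> cls (\<lambda>n. t n * t n) = cls (\<lambda>_. \<alpha>)"
        unfolding padic_of_rat_eq cls_mult[OF t t] by auto
      also have "\<dots> \<longleftrightarrow> pnull (\<lambda>n. t n * t n - \<alpha>)" by (intro cls_eq_iff pc t)
      finally show ?thesis by (simp add: power2_eq_square)
    qed
    show ?thesis unfolding psq_iff[OF assms] carrier_Qp using e by auto
  qed
  have 2: "padic_of_rat p \<alpha> \<otimes>\<^bsub>Qp\<^esub> (cls t \<otimes>\<^bsub>Qp\<^esub> cls t) =
      (padic_of_rat p \<alpha> \<otimes>\<^bsub>Qp\<^esub> (cls s \<otimes>\<^bsub>Qp\<^esub> cls s) \<ominus>\<^bsub>Qp\<^esub> padic_of_rat p a) \<otimes>\<^bsub>Qp\<^esub>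
      (padic_of_rat p \<alpha> \<otimes>\<^bsub>Qp\<^esub> (cls s \<otimes>\<^bsub>Qp\<^esub> cls s) \<ominus>\<^bsub>Qp\<^esub> padic_of_rat p a)
        \<ominus>\<^bsub>Qp\<^esub> (padic_of_rat p b \<oplus>\<^bsub>Qp\<^esub> padic_of_rat p b \<oplus>\<^bsub>Qp\<^esub> padic_of_rat p b \<oplus>\<^bsub>Qp\<^esub> padic_of_rat p b)
    \<longleftrightarrow> pnull (\<lambda>n. \<alpha> * (t n)\<^sup>2 - ((\<alpha> * (s n)\<^sup>2 - a)\<^sup>2 - 4 * b))" (is "?l = ?r \<longleftrightarrow> _")
    if st: "pcauchy s" "pcauchy t" for s t
  proof -
    have l: "?l = cls (\<lambda>n. \<alpha> * (t n * t n))"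
      unfolding padic_of_rat_eq by (subst cls_mult, (intro pc st)+)+ (rule refl)
    have ss: "padic_of_rat p \<alpha> \<otimes>\<^bsub>Qp\<^esub> (cls s \<otimes>\<^bsub>Qp\<^esub> cls s) \<ominus>\<^bsub>Qp\<^esub> padic_of_rat p a = cls (\<lambda>n. \<alpha> * (s n * s n) - a)"
      unfolding padic_of_rat_eq
      by (subst cls_mult cls_minus, (intro pc st)+)+ (rule refl)
    have bb: "padic_of_rat p b \<oplus>\<^bsub>Qp\<^esub> padic_of_rat p b \<oplus>\<^bsub>Qp\<^esub> padic_of_rat p b \<oplus>\<^bsub>Qp\<^esub> padic_of_rat p b = cls (\<lambda>_. b + b + b + b)"
      unfolding padic_of_rat_eq by (simp add: cls_add)
    have r: "?r = cls (\<lambda>n. (\<alpha> * (s n * s n) - a) * (\<alpha> * (s n * s n) - a) - (b + b + b + b))"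
      unfolding ss bb by (subst cls_mult cls_minus, (intro pc st)+)+ (rule refl)
    show ?thesis unfolding l r
      by (subst cls_eq_iff, (intro pc st)+) (simp add: power2_eq_square algebra_simps)
  qed
  have bex: "(\<exists>w\<in>carrier Qp. \<exists>z\<in>carrier Qp. E w z) \<longleftrightarrow> (\<exists>s t. pcauchy s \<and> pcauchy t \<and> E (cls s) (cls t))" for E
    unfolding carrier_Qp by blast
  show ?thesis
    unfolding tors_def ptors_def 1 bex using 2 by (simp cong: conj_cong)
qed

lemma two_Qp: "\<one>\<^bsub>Qp\<^esub> \<oplus>\<^bsub>Qp\<^esub> \<one>\<^bsub>Qp\<^esub> \<noteq> \<zero>\<^bsub>Qp\<^esub>"
  by (simp add: cls_one cls_zero cls_add cls_eq_iff)

lemma local_condition_padic: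
  assumes "b \<noteq> 0" "a\<^sup>2 - 4 * b \<noteq> 0" "\<alpha> \<noteq> 0"
  shows "local_condition Qp (padic_of_rat p) a b (sqcls \<alpha>) \<longleftrightarrow> ptors \<alpha> (of_int a) (of_int b)"
  using local_condition_iff[OF field_Qp two_Qp padic_of_rat_hom assms] tors_Qp_iff[OF assms(3)] by simp

end

section \<open>The Hilbert symbol of an element of even valuation with p\<close>

context odd_padic begin

text \<open>For a nonsquare \<beta> of even valuation, z^2 - \<beta> x^2 has even valuation or
  vanishes, while p y^2 has odd valuation for nonzero y; hence there is no cancellation. The
  anisotropy is stated quantitatively because zeros of the form over Q_p appear only as null
  sequences.\<close>

lemma hilbert_bound:
  assumes \<beta>: "\<beta> \<noteq> 0" "even (v \<beta>)" "\<not> psq \<beta>"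
  shows "N (z\<^sup>2 - (\<beta> * x\<^sup>2 + of_nat p * y\<^sup>2)) \<ge> (N z)\<^sup>2"
    "N (z\<^sup>2 - (\<beta> * x\<^sup>2 + of_nat p * y\<^sup>2)) \<ge> N \<beta> * (N x)\<^sup>2"
    "N (z\<^sup>2 - (\<beta> * x\<^sup>2 + of_nat p * y\<^sup>2)) \<ge> (N y)\<^sup>2 / real p"
proof -
  define A where "A = z\<^sup>2 - \<beta> * x\<^sup>2"
  have A: "N A = max (N (z\<^sup>2)) (N (\<beta> * x\<^sup>2))"
    unfolding A_def by (rule nonsq_norm[OF \<beta>(1,3)])
  have evA: "A = 0 \<or> even (v A)"
  proof (cases "A = 0")
    case False
    have "N A = N (z\<^sup>2) \<or> N A = N (\<beta> * x\<^sup>2)" using A by (auto simp: max_def)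
    moreover have "z\<^sup>2 \<noteq> 0" if "N A = N (z\<^sup>2)" using that False by (metis N_eq_0)
    moreover have "\<beta> * x\<^sup>2 \<noteq> 0" if "N A = N (\<beta> * x\<^sup>2)" using that False by (metis N_eq_0)
    ultimately have "v A = v (z\<^sup>2) \<and> z \<noteq> 0 \<or> v A = v (\<beta> * x\<^sup>2) \<and> x \<noteq> 0" using False N_eq_iff by fastforce
    then show ?thesis using \<beta> by (auto simp: padic_val_power)
  qed auto
  have ne: "N A \<noteq> N (of_nat p * y\<^sup>2)" if "y \<noteq> 0"
  proof
    assume e: "N A = N (of_nat p * y\<^sup>2)"
    have nz: "of_nat p * y\<^sup>2 \<noteq> 0" using that p_gt_1 by simp
    then have "A \<noteq> 0" using e by (metis N_eq_0)
    then have "v A = v (of_nat p * y\<^sup>2)" using e nz N_eq_iff by blast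
    then have "odd (v A)" using that p_gt_1 by (simp add: padic_val_power)
    then show False using evA \<open>A \<noteq> 0\<close> by blast
  qed
  have e: "z\<^sup>2 - (\<beta> * x\<^sup>2 + of_nat p * y\<^sup>2) = A - of_nat p * y\<^sup>2" by (simp add: A_def)
  have "N (A - of_nat p * y\<^sup>2) \<ge> max (N A) (N (of_nat p * y\<^sup>2))"
  proof (cases "y = 0")
    case False
    then show ?thesis using ne N_diff_eq[of "of_nat p * y\<^sup>2" A] N_diff_eq2[of A "of_nat p * y\<^sup>2"]
      by (cases "N A < N (of_nat p * y\<^sup>2)") auto
  qed simp
  then show "N (z\<^sup>2 - (\<beta> * x\<^sup>2 + of_nat p * y\<^sup>2)) \<ge> (N z)\<^sup>2"
    "N (z\<^sup>2 - (\<beta> * x\<^sup>2 + of_nat p * y\<^sup>2)) \<ge> N \<beta> * (N x)\<^sup>2"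
    "N (z\<^sup>2 - (\<beta> * x\<^sup>2 + of_nat p * y\<^sup>2)) \<ge> (N y)\<^sup>2 / real p"
    unfolding e using A by (auto simp: N_mult N_power N_p)
qed

text \<open>A sequence that stays close to \<beta> has the square class of \<beta>. If that class is
  trivial, (1, 0, z) with z a square root of the first entry is a zero of the form; otherwise the
  bounds force x, y, z to be null sequences.\<close>

lemma hilbert_symbol_iff:
  assumes s: "pcauchy s" and \<beta>: "\<beta> \<noteq> 0" "even (v \<beta>)" and near: "\<And>n. n \<ge> M \<Longrightarrow> N (s n - \<beta>) < N \<beta>"
  shows "hilbert_symbol Qp (cls s) (padic_of_rat p (of_nat p)) = (if psq \<beta> then 1 else - 1)"
proof -
  have e: "cls z \<otimes>\<^bsub>Qp\<^esub> cls z = cls s \<otimes>\<^bsub>Qp\<^esub> (cls x \<otimes>\<^bsub>Qp\<^esub> cls x) \<oplus>\<^bsub>Qp\<^esub> padic_of_rat p (of_nat p) \<otimes>\<^bsub>Qp\<^esub> (cls y \<otimes>\<^bsub>Qp\<^esub> cls y)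
    \<longleftrightarrow> pnull (\<lambda>n. (z n)\<^sup>2 - (s n * (x n)\<^sup>2 + of_nat p * (y n)\<^sup>2))" if c: "pcauchy x" "pcauchy y" "pcauchy z" for x y z
  proof -
    have l: "cls z \<otimes>\<^bsub>Qp\<^esub> cls z = cls (\<lambda>n. z n * z n)" by (intro cls_mult c)
    have r: "cls s \<otimes>\<^bsub>Qp\<^esub> (cls x \<otimes>\<^bsub>Qp\<^esub> cls x) \<oplus>\<^bsub>Qp\<^esub> padic_of_rat p (of_nat p) \<otimes>\<^bsub>Qp\<^esub> (cls y \<otimes>\<^bsub>Qp\<^esub> cls y)
      = cls (\<lambda>n. s n * (x n * x n) + of_nat p * (y n * y n))"
      unfolding padic_of_rat_eq by (subst cls_mult cls_add, (intro pcauchy_intros c s)+)+ (rule refl)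
    show ?thesis unfolding l r
      by (subst cls_eq_iff, (intro pcauchy_intros c s)+) (simp add: power2_eq_square)
  qed
  have "(\<exists>x\<in>carrier Qp. \<exists>y\<in>carrier Qp. \<exists>z\<in>carrier Qp. (x, y, z) \<noteq> (\<zero>\<^bsub>Qp\<^esub>, \<zero>\<^bsub>Qp\<^esub>, \<zero>\<^bsub>Qp\<^esub>) \<and>
      z \<otimes>\<^bsub>Qp\<^esub> z = cls s \<otimes>\<^bsub>Qp\<^esub> (x \<otimes>\<^bsub>Qp\<^esub> x) \<oplus>\<^bsub>Qp\<^esub> padic_of_rat p (of_nat p) \<otimes>\<^bsub>Qp\<^esub> (y \<otimes>\<^bsub>Qp\<^esub> y)) \<longleftrightarrow> psq \<beta>"
  proof
    assume sq: "psq \<beta>"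
    obtain c where c: "c \<noteq> 0" "N (\<beta> - c\<^sup>2) < N (c\<^sup>2)" using psq_obtain_near[OF sq] by blast
    have "N (s n / c\<^sup>2 - 1) \<le> N (4 * of_nat p)" if "n \<ge> M" for n
    proof -
      have "N ((s n - \<beta>) + (\<beta> - c\<^sup>2)) < N (c\<^sup>2)"
        using near[OF that] c N_eq_of_close[OF c(2)] by (intro N_add_less) auto
      then have "N (s n - c\<^sup>2) < N (c\<^sup>2)" by simp
      moreover have "s n / c\<^sup>2 - 1 = (s n - c\<^sup>2) / c\<^sup>2" using c by (simp add: field_simps)
      ultimately have "N (s n / c\<^sup>2 - 1) < 1" using c by (simp add: N_divide divide_less_eq)
      then show ?thesis unfolding N_4p by (rule N_less_1_imp)
    qed
    then obtain t where t: "pcauchy t" "pnull (\<lambda>n. (t n)\<^sup>2 - s n)" using hensel_seq'[OF s c(1)] by blast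
    have "cls t \<otimes>\<^bsub>Qp\<^esub> cls t = cls s \<otimes>\<^bsub>Qp\<^esub> (cls (\<lambda>_. 1) \<otimes>\<^bsub>Qp\<^esub> cls (\<lambda>_. 1)) \<oplus>\<^bsub>Qp\<^esub>
        padic_of_rat p (of_nat p) \<otimes>\<^bsub>Qp\<^esub> (cls (\<lambda>_. 0) \<otimes>\<^bsub>Qp\<^esub> cls (\<lambda>_. 0))"
      using t by (simp add: e)
    moreover have "(cls (\<lambda>_. 1), cls (\<lambda>_. 0), cls t) \<noteq> (\<zero>\<^bsub>Qp\<^esub>, \<zero>\<^bsub>Qp\<^esub>, \<zero>\<^bsub>Qp\<^esub>)"
      by (simp add: cls_zero cls_eq_iff)
    ultimately show "\<exists>x\<in>carrier Qp. \<exists>y\<in>carrier Qp. \<exists>z\<in>carrier Qp. (x, y, z) \<noteq> (\<zero>\<^bsub>Qp\<^esub>, \<zero>\<^bsub>Qp\<^esub>, \<zero>\<^bsub>Qp\<^esub>) \<and>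
      z \<otimes>\<^bsub>Qp\<^esub> z = cls s \<otimes>\<^bsub>Qp\<^esub> (x \<otimes>\<^bsub>Qp\<^esub> x) \<oplus>\<^bsub>Qp\<^esub> padic_of_rat p (of_nat p) \<otimes>\<^bsub>Qp\<^esub> (y \<otimes>\<^bsub>Qp\<^esub> y)"
      using cls_in_Qp[OF pcauchy_const] cls_in_Qp[OF t(1)] by blast
  next
    assume "\<exists>x\<in>carrier Qp. \<exists>y\<in>carrier Qp. \<exists>z\<in>carrier Qp. (x, y, z) \<noteq> (\<zero>\<^bsub>Qp\<^esub>, \<zero>\<^bsub>Qp\<^esub>, \<zero>\<^bsub>Qp\<^esub>) \<and>
      z \<otimes>\<^bsub>Qp\<^esub> z = cls s \<otimes>\<^bsub>Qp\<^esub> (x \<otimes>\<^bsub>Qp\<^esub> x) \<oplus>\<^bsub>Qp\<^esub> padic_of_rat p (of_nat p) \<otimes>\<^bsub>Qp\<^esub> (y \<otimes>\<^bsub>Qp\<^esub> y)"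
    then obtain x' y' z' where xyz: "x' \<in> carrier Qp" "y' \<in> carrier Qp" "z' \<in> carrier Qp"
      "(x', y', z') \<noteq> (\<zero>\<^bsub>Qp\<^esub>, \<zero>\<^bsub>Qp\<^esub>, \<zero>\<^bsub>Qp\<^esub>)"
      "z' \<otimes>\<^bsub>Qp\<^esub> z' = cls s \<otimes>\<^bsub>Qp\<^esub> (x' \<otimes>\<^bsub>Qp\<^esub> x') \<oplus>\<^bsub>Qp\<^esub> padic_of_rat p (of_nat p) \<otimes>\<^bsub>Qp\<^esub> (y' \<otimes>\<^bsub>Qp\<^esub> y')"
      by blast
    obtain x where x: "pcauchy x" "x' = cls x" using xyz(1) by (rule Qp_cases)
    obtain y where y: "pcauchy y" "y' = cls y" using xyz(2) by (rule Qp_cases)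
    obtain z where z: "pcauchy z" "z' = cls z" using xyz(3) by (rule Qp_cases)
    note c = x(1) y(1) z(1)
    have ne: "(cls x, cls y, cls z) \<noteq> (\<zero>\<^bsub>Qp\<^esub>, \<zero>\<^bsub>Qp\<^esub>, \<zero>\<^bsub>Qp\<^esub>)" using xyz(4) unfolding x y z .
    have null: "pnull (\<lambda>n. (z n)\<^sup>2 - (s n * (x n)\<^sup>2 + of_nat p * (y n)\<^sup>2))"
      using xyz(5) e[OF c] unfolding x y z by blast
    show "psq \<beta>"
    proof (rule ccontr)
      assume nsq: "\<not> psq \<beta>"
      have b: "(N (z n))\<^sup>2 \<le> N ((z n)\<^sup>2 - (s n * (x n)\<^sup>2 + of_nat p * (y n)\<^sup>2))"
        "N \<beta> * (N (x n))\<^sup>2 \<le> N ((z n)\<^sup>2 - (s n * (x n)\<^sup>2 + of_nat p * (y n)\<^sup>2))"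
        "(N (y n))\<^sup>2 / real p \<le> N ((z n)\<^sup>2 - (s n * (x n)\<^sup>2 + of_nat p * (y n)\<^sup>2))" if "n \<ge> M" for n
      proof -
        have Ns: "N (s n) = N \<beta>" using N_eq_of_close[OF near[OF that]] .
        then have s0: "s n \<noteq> 0" using \<beta> by (metis N_eq_0)
        then have "v (s n) = v \<beta>" using Ns N_eq_iff \<beta> by blast
        moreover have "\<not> psq (s n)" using psq_near_iff[OF near[OF that]] nsq by blast
        ultimately show "(N (z n))\<^sup>2 \<le> N ((z n)\<^sup>2 - (s n * (x n)\<^sup>2 + of_nat p * (y n)\<^sup>2))"
        "N \<beta> * (N (x n))\<^sup>2 \<le> N ((z n)\<^sup>2 - (s n * (x n)\<^sup>2 + of_nat p * (y n)\<^sup>2))"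
        "(N (y n))\<^sup>2 / real p \<le> N ((z n)\<^sup>2 - (s n * (x n)\<^sup>2 + of_nat p * (y n)\<^sup>2))"
          using hilbert_bound[OF s0] \<beta>(2) Ns by simp_all
      qed
      have nullI: "pnull t" if k: "k > 0" "\<And>n. n \<ge> M \<Longrightarrow> k * (N (t n))\<^sup>2 \<le> N ((z n)\<^sup>2 - (s n * (x n)\<^sup>2 + of_nat p * (y n)\<^sup>2))" for t k
        unfolding pnull_iff
      proof (intro allI impI)
        fix \<epsilon> :: real assume \<epsilon>: "\<epsilon> > 0"
        obtain M' where M': "\<forall>n\<ge>M'. N ((z n)\<^sup>2 - (s n * (x n)\<^sup>2 + of_nat p * (y n)\<^sup>2)) < k * \<epsilon>\<^sup>2"
          using pnullD[OF null, of "k * \<epsilon>\<^sup>2"] k \<epsilon> by auto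
        have "N (t n) < \<epsilon>" if "n \<ge> max M M'" for n
        proof -
          have "k * (N (t n))\<^sup>2 < k * \<epsilon>\<^sup>2" using M' k(2)[of n] that by force
          then have "(N (t n))\<^sup>2 < \<epsilon>\<^sup>2" using k by simp
          then show ?thesis using \<epsilon> power2_less_imp_less by fastforce
        qed
        then show "\<exists>M. \<forall>n\<ge>M. N (t n) < \<epsilon>" by blast
      qed
      have "pnull z" by (rule nullI[of 1]) (use b in auto)
      moreover have "pnull x" by (rule nullI[of "N \<beta>"]) (use b \<beta> in auto)
      moreover have "pnull y" by (rule nullI[of "1 / real p"]) (use b p_gt_1 in auto)
      ultimately show False using ne c by (simp add: cls_zero cls_eq_iff)
    qed
  qed
  then show ?thesis unfolding hilbert_symbol_def by simp
qed

end

section \<open>The real place\<close>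

lemma of_rat_hom: "of_rat \<in> ring_hom rat_field real_field"
  by (rule ring_hom_memI) (auto simp: ring_of_type_algebra_def of_rat_mult of_rat_add)

text \<open>For negative \<alpha> the torsor asks for w with (\<alpha> w^2 - a)^2 at most 4b. As
  \<alpha> w^2 runs through the nonpositive reals, the left side has minimum 0 if a is nonpositive,
  and a^2, attained at w = 0, if a is positive.\<close>

lemma local_condition_real:
  assumes "b \<noteq> 0" "a\<^sup>2 - 4 * b \<noteq> 0" "\<alpha> \<noteq> 0"
  shows "local_condition real_field of_rat a b (sqcls \<alpha>) \<longleftrightarrow> \<alpha> > 0 \<or> (b > 0 \<and> (a \<le> 0 \<or> a\<^sup>2 \<le> 4 * b))"
proof -
  interpret field "real_field" by (rule field_from_type_algebra)
  have minus: "x \<ominus>\<^bsub>real_field\<^esub> y = x - y" for x y :: real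
  proof -
    have "\<ominus>\<^bsub>real_field\<^esub> y = - y"
      by (rule minus_equality) (auto simp: ring_of_type_algebra_def)
    then show ?thesis by (simp add: a_minus_def ring_of_type_algebra_def)
  qed
  have two: "\<one>\<^bsub>real_field\<^esub> \<oplus>\<^bsub>real_field\<^esub> \<one>\<^bsub>real_field\<^esub> \<noteq> \<zero>\<^bsub>real_field\<^esub>" by (simp add: ring_of_type_algebra_def)
  define x :: real where "x = of_rat \<alpha>"
  have x: "x \<noteq> 0" "x > 0 \<longleftrightarrow> \<alpha> > 0" using assms by (auto simp: x_def)
  have "local_condition real_field of_rat a b (sqcls \<alpha>) \<longleftrightarrow> tors real_field x (of_int a) (of_int b)"
    using local_condition_iff[OF field_axioms two of_rat_hom assms] by (simp add: x_def)
  also have "\<dots> \<longleftrightarrow> (\<exists>w. x = w * w) \<or> (\<exists>w z. x * (z * z) = (x * (w * w) - of_int a) * (x * (w * w) - of_int a) - 4 * of_int b)"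
    unfolding tors_def minus by (simp add: ring_of_type_algebra_def)
  also have "\<dots> \<longleftrightarrow> x > 0 \<or> (b > 0 \<and> (a \<le> 0 \<or> a\<^sup>2 \<le> 4 * b))"
  proof (cases "x > 0")
    case True
    then have "x = sqrt x * sqrt x" by simp
    then show ?thesis using True by blast
  next
    case False
    then have neg: "x < 0" using x by simp
    have 1: "\<not> (\<exists>w. x = w * w)" using neg by (metis not_less zero_le_square)
    have "(\<exists>w z. x * (z * z) = (x * (w * w) - of_int a) * (x * (w * w) - of_int a) - 4 * of_int b) \<longleftrightarrow>
      (\<exists>w. (x * (w * w) - of_int a)\<^sup>2 \<le> 4 * of_int b)"
    proof
      assume "\<exists>w z. x * (z * z) = (x * (w * w) - of_int a) * (x * (w * w) - of_int a) - 4 * of_int b"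
      then obtain w z where "x * (z * z) = (x * (w * w) - of_int a) * (x * (w * w) - of_int a) - 4 * of_int b" by blast
      moreover have "x * (z * z) \<le> 0" using neg by (simp add: mult_nonpos_nonneg)
      ultimately show "\<exists>w. (x * (w * w) - of_int a)\<^sup>2 \<le> 4 * of_int b"
        by (intro exI[of _ w]) (simp add: power2_eq_square)
    next
      assume "\<exists>w. (x * (w * w) - of_int a)\<^sup>2 \<le> 4 * of_int b"
      then obtain w where w: "(x * (w * w) - of_int a)\<^sup>2 \<le> 4 * of_int b" by blast
      define g where "g = (x * (w * w) - of_int a)\<^sup>2 - 4 * of_int b"
      have "g / x \<ge> 0" using w neg by (simp add: g_def divide_nonpos_neg)
      moreover have "g \<le> 0" using w by (simp add: g_def)
      ultimately have "x * (sqrt (g / x) * sqrt (g / x)) = g" using neg by simp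
      then show "\<exists>w z. x * (z * z) = (x * (w * w) - of_int a) * (x * (w * w) - of_int a) - 4 * of_int b"
        unfolding g_def power2_eq_square by blast
    qed
    also have "\<dots> \<longleftrightarrow> b > 0 \<and> (a \<le> 0 \<or> a\<^sup>2 \<le> 4 * b)"
    proof
      assume "\<exists>w. (x * (w * w) - of_int a)\<^sup>2 \<le> 4 * of_int b"
      then obtain w where w: "(x * (w * w) - of_int a)\<^sup>2 \<le> 4 * of_int b" by blast
      have "0 \<le> (4 * of_int b :: real)" using w zero_le_power2 order_trans by blast
      then have b: "b > 0" using assms(1) by auto
      have "a\<^sup>2 \<le> 4 * b" if "a > 0"
      proof -
        have "x * (w * w) \<le> 0" using neg by (simp add: mult_nonpos_nonneg)
        then have "(of_int a :: real) \<le> of_int a - x * (w * w)" by simp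
        then have "(of_int a :: real)\<^sup>2 \<le> (of_int a - x * (w * w))\<^sup>2" using that by (intro power_mono) auto
        then have "(of_int a :: real)\<^sup>2 \<le> 4 * of_int b" using w by (simp add: power2_commute)
        then have "(of_int (a\<^sup>2) :: real) \<le> of_int (4 * b)" by simp
        then show ?thesis by (simp only: of_int_le_iff)
      qed
      then show "b > 0 \<and> (a \<le> 0 \<or> a\<^sup>2 \<le> 4 * b)" using b by auto
    next
      assume h: "b > 0 \<and> (a \<le> 0 \<or> a\<^sup>2 \<le> 4 * b)"
      show "\<exists>w. (x * (w * w) - of_int a)\<^sup>2 \<le> 4 * of_int b"
      proof (cases "a \<le> 0")
        case True
        have "of_int a / x \<ge> 0" using True neg by (simp add: divide_nonpos_neg)
        then have "x * (sqrt (of_int a / x) * sqrt (of_int a / x)) - of_int a = 0" using neg True by simp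
        then show ?thesis using h by (intro exI[of _ "sqrt (of_int a / x)"]) simp
      next
        case False
        then have "a\<^sup>2 \<le> 4 * b" using h by auto
        then have "(of_int (a\<^sup>2) :: real) \<le> of_int (4 * b)" by (simp only: of_int_le_iff)
        then show ?thesis by (intro exI[of _ 0]) simp
      qed
    qed
    finally show ?thesis using 1 neg by auto
  qed
  finally show ?thesis using x by simp
qed

section \<open>Good reduction and the conductor\<close>

context padic begin

lemma ppow_dvd_0_iff: "ppow_dvd p 0 x \<longleftrightarrow> N x \<le> 1"
  by (simp add: ppow_dvd_def N_le_1_iff)

lemma integral_at_curve: "integral_at p (curve a b)"
  by (simp add: integral_at_def curve_def ppow_dvd_0_iff N_of_int_le_1)

lemma weierstrass_iso_refl: "weierstrass_iso E E"
  unfolding weierstrass_iso_def by (intro exI[of _ 1] exI[of _ 0]) simp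

lemma padic_val_of_int_nonneg: "v (of_int m) \<ge> 0"
  by (cases "m = 0") (simp_all add: padic_val_of_int padic_val_def)

text \<open>The given integral model has nonnegative discriminant valuation, so the set under
  \<open>LEAST\<close> is nonempty and the minimum is 0 only if 0 is attained.\<close>

lemma good_reduction_iff:
  "good_reduction p (curve a b) \<longleftrightarrow>
    (\<exists>E'. weierstrass_iso (curve a b) E' \<and> integral_at p E' \<and> padic_val p (discriminant E') = 0)"
proof -
  define P where "P n \<longleftrightarrow>
    (\<exists>E'. weierstrass_iso (curve a b) E' \<and> integral_at p E' \<and> padic_val p (discriminant E') = int n)" for n
  have "padic_val p (discriminant (curve a b)) \<ge> 0"
    unfolding discriminant_curve by (rule padic_val_of_int_nonneg)
  then have "P (nat (padic_val p (discriminant (curve a b))))"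
    unfolding P_def using weierstrass_iso_refl integral_at_curve by (intro exI[of _ "curve a b"]) auto
  then have "P (LEAST n. P n)" by (rule LeastI)
  then have "(LEAST n. P n) = 0 \<longleftrightarrow> P 0" using Least_le[of P 0] by auto
  then show ?thesis unfolding good_reduction_def min_disc_exponent_def P_def by simp
qed

lemma good_reduction_of_not_dvd:
  assumes "\<not> int p dvd 16 * b\<^sup>2 * (a\<^sup>2 - 4 * b)" shows "good_reduction p (curve a b)"
proof -
  have "N (discriminant (curve a b)) = 1" unfolding discriminant_curve using assms N_of_int_eq_1_iff by blast
  then show ?thesis unfolding good_reduction_iff
    using weierstrass_iso_refl integral_at_curve N_eq_1_iff by blast
qed

end

text \<open>Every bad prime has exponent 1 or at least 2. Finiteness of the set of bad primes has to
  be shown, since a product over an infinite set is 1 by convention.\<close>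

lemma bad_prime_dvd_conductor:
  assumes "b \<noteq> 0" "a\<^sup>2 - 4 * b \<noteq> 0" "Factorial_Ring.prime p" "\<not> good_reduction p (curve a b)"
  shows "p dvd conductor (curve a b)"
proof -
  let ?D = "16 * b\<^sup>2 * (a\<^sup>2 - 4 * b)" and ?S = "{p. Factorial_Ring.prime p \<and> \<not> good_reduction p (curve a b)}"
  have D: "nat \<bar>?D\<bar> \<noteq> 0" using assms by simp
  have "?S \<subseteq> {q. q dvd nat \<bar>?D\<bar>}"
  proof
    fix q assume q: "q \<in> ?S"
    then interpret padic q by unfold_locales auto
    have "int q dvd ?D" using good_reduction_of_not_dvd q by blast
    then show "q \<in> {q. q dvd nat \<bar>?D\<bar>}" by (simp add: int_dvd_int_iff[symmetric] del: int_dvd_int_iff)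
  qed
  moreover have "finite {q. q dvd nat \<bar>?D\<bar>}" using D finite_divisors_nat by blast
  ultimately have "finite ?S" using finite_subset by blast
  moreover have "p \<in> ?S" using assms by blast
  ultimately have "p ^ conductor_exponent p (curve a b) dvd conductor (curve a b)"
    unfolding conductor_def by (rule dvd_prodI)
  moreover have "conductor_exponent p (curve a b) > 0" using assms(4) by (simp add: conductor_exponent_def)
  then have "p dvd p ^ conductor_exponent p (curve a b)" by (simp add: dvd_power)
  ultimately show ?thesis using dvd_trans by blast
qed

context odd_padic begin

text \<open>A model of unit discriminant need not have the shape x (x^2 + a' x + b'). As 2 is a
  unit, completing the square gives an integral monic cubic, and the 2-torsion point (0,0) of the
  given curve becomes a root of it, hence integral. Moving this root to 0 restores the shape and
  leaves the discriminant 16 b'^2 (a'^2 - 4b') a unit, so both factors are units.\<close>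

lemma good_reduction_model:
  assumes nz: "b \<noteq> 0" "a\<^sup>2 - 4 * b \<noteq> 0" and good: "good_reduction p (curve a b)"
  obtains u a' b' where "u \<noteq> 0" "of_int a = a' * u\<^sup>2" "of_int b = b' * (u\<^sup>2)\<^sup>2"
    "N a' \<le> 1" "N b' = 1" "N (a'\<^sup>2 - 4 * b') = 1"
proof -
  obtain E' where iso: "weierstrass_iso (curve a b) E'" and int: "integral_at p E'"
    and disc: "padic_val p (discriminant E') = 0" using good good_reduction_iff by blast
  obtain a1 a2 a3 a4 a6 where E': "E' = Weierstrass a1 a2 a3 a4 a6" by (cases E')
  have le: "N a1 \<le> 1" "N a2 \<le> 1" "N a3 \<le> 1" "N a4 \<le> 1" "N a6 \<le> 1"
    using int by (auto simp: integral_at_def E' ppow_dvd_0_iff)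
  obtain u r s t where u: "u \<noteq> 0" and
    eqs: "u * a1 = 2 * s" "u\<^sup>2 * a2 = of_int a + 3 * r - s\<^sup>2" "u ^ 3 * a3 = 2 * t"
      "u ^ 4 * a4 = of_int b + 2 * r * of_int a + 3 * r\<^sup>2 - 2 * s * t"
      "u ^ 6 * a6 = r * of_int b + r\<^sup>2 * of_int a + r ^ 3 - t\<^sup>2"
    using iso unfolding weierstrass_iso_def E' curve_def by auto
  define A2 A4 A6 where "A2 = a2 + a1\<^sup>2 / 4" and "A4 = a4 + a1 * a3 / 2" and "A6 = a6 + a3\<^sup>2 / 4"
  have N3: "N 3 \<le> 1" by (rule N_numeral_le_1)
  have A: "N A2 \<le> 1" "N A4 \<le> 1" "N A6 \<le> 1"
    unfolding A2_def A4_def A6_def using le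
    by (auto intro!: N_add_le simp: N_divide N_mult N_power power_le_one mult_le_one)
  define i where "i = inverse u"
  have i: "u * i = 1" using u by (simp add: i_def)
  \<comment> \<open>By x = u^2 x' + r, the point with x = 0 has x' = -r/u^2; this is the root \<rho>
    of the cubic with coefficients A2, A4, A6.\<close>
  define \<rho> a' b' where "\<rho> = - (r * i\<^sup>2)" and "a' = of_int a * i\<^sup>2" and "b' = of_int b * i ^ 4"
  have a1: "a1 = 2 * s * i" and a2: "a2 = (of_int a + 3 * r - s\<^sup>2) * i\<^sup>2" and a3: "a3 = 2 * t * i ^ 3"
    and a4: "a4 = (of_int b + 2 * r * of_int a + 3 * r\<^sup>2 - 2 * s * t) * i ^ 4"
    and a6: "a6 = (r * of_int b + r\<^sup>2 * of_int a + r ^ 3 - t\<^sup>2) * i ^ 6"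
    using eqs u by (auto simp: i_def field_simps)
  have A2: "A2 = a' - 3 * \<rho>" unfolding A2_def a1 a2 \<rho>_def a'_def by (simp add: power2_eq_square algebra_simps)
  have A4: "A4 = b' - 2 * \<rho> * a' + 3 * \<rho>\<^sup>2" unfolding A4_def a1 a3 a4 \<rho>_def a'_def b'_def
    by (simp add: power2_eq_square power4_eq_xxxx power3_eq_cube algebra_simps)
  have A6: "A6 = - \<rho> * b' + \<rho>\<^sup>2 * a' - \<rho> ^ 3" unfolding A6_def a3 a6 \<rho>_def a'_def b'_def
    by (simp add: power2_eq_square power4_eq_xxxx power3_eq_cube numeral_eq_Suc algebra_simps)
  have root: "\<rho> ^ 3 = - (A2 * \<rho>\<^sup>2 + A4 * \<rho> + A6)" unfolding A2 A4 A6
    by (simp add: power2_eq_square power3_eq_cube algebra_simps)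
  \<comment> \<open>Integrality of a root of a monic integral cubic: for |\<rho>| > 1 the cube would
    dominate the remaining terms.\<close>
  have N\<rho>: "N \<rho> \<le> 1"
  proof (rule ccontr)
    assume "\<not> N \<rho> \<le> 1"
    then have gt: "N \<rho> > 1" by simp
    have sq: "(N \<rho>)\<^sup>2 \<ge> N \<rho>" "(N \<rho>)\<^sup>2 \<ge> 1" 
      using gt mult_left_mono[of 1 "N \<rho>" "N \<rho>"] by (auto simp: power2_eq_square)
    have "N (A2 * \<rho>\<^sup>2 + A4 * \<rho> + A6) \<le> (N \<rho>)\<^sup>2"
    proof (intro N_add_le)
      show "N (A2 * \<rho>\<^sup>2) \<le> (N \<rho>)\<^sup>2" using A(1) by (simp add: N_mult N_power mult_left_le_one_le)
      have "N (A4 * \<rho>) \<le> N \<rho>" using A(2) by (simp add: N_mult mult_left_le_one_le)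
      then show "N (A4 * \<rho>) \<le> (N \<rho>)\<^sup>2" using sq by linarith
      show "N A6 \<le> (N \<rho>)\<^sup>2" using A(3) sq by linarith
    qed
    then have "N (\<rho> ^ 3) \<le> (N \<rho>)\<^sup>2" unfolding root N_minus .
    then have "N \<rho> * (N \<rho>)\<^sup>2 \<le> 1 * (N \<rho>)\<^sup>2" by (simp add: N_mult power3_eq_cube power2_eq_square mult.assoc)
    moreover have "0 < (N \<rho>)\<^sup>2" using sq(2) by linarith
    ultimately show False using mult_strict_right_mono[OF gt, of "(N \<rho>)\<^sup>2"] by linarith
  qed
  have "a' = A2 + 3 * \<rho>" using A2 by simp
  then have Na: "N a' \<le> 1" using A N\<rho> N3 by (auto intro!: N_add_le simp: N_mult mult_le_one)
  have "b' = A4 + 2 * \<rho> * a' - 3 * \<rho>\<^sup>2" using A4 by simp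
  then have Nb: "N b' \<le> 1" using A N\<rho> N3 Na
    by (auto intro!: N_add_le N_diff_le simp: N_mult N_power power_le_one mult_le_one)
  have NB: "N (a'\<^sup>2 - 4 * b') \<le> 1" using Na Nb by (intro N_diff_le) (auto simp: N_mult N_power power_le_one)
  have "wb2 E' = 4 * A2" "wb4 E' = 2 * A4" "wb6 E' = 4 * A6" "wb8 E' = 4 * A2 * A6 - A4\<^sup>2"
  proof -
    define c1 c3 where "c1 = a1 / 2" and "c3 = a3 / 2"
    have c: "a1 = 2 * c1" "a3 = 2 * c3" by (simp_all add: c1_def c3_def)
    have A': "A2 = a2 + c1\<^sup>2" "A4 = a4 + 2 * c1 * c3" "A6 = a6 + c3\<^sup>2"
      by (simp_all add: A2_def A4_def A6_def c1_def c3_def power_divide)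
    show "wb2 E' = 4 * A2" "wb4 E' = 2 * A4" "wb6 E' = 4 * A6" "wb8 E' = 4 * A2 * A6 - A4\<^sup>2"
      unfolding wb2_def wb4_def wb6_def wb8_def E' weierstrass.sel c A' by Groebner_Basis.algebra+
  qed
  then have dE: "discriminant E' = 16 * (b'\<^sup>2 * (a'\<^sup>2 - 4 * b'))"
    unfolding discriminant_def A2 A4 A6 by Groebner_Basis.algebra
  have b'0: "b' \<noteq> 0" using nz u by (simp add: b'_def i_def)
  have ab': "of_int a = a' * u\<^sup>2" "of_int b = b' * (u\<^sup>2)\<^sup>2"
    unfolding a'_def b'_def i_def using u by (simp_all add: field_simps flip: power_mult)
  have "of_int (a\<^sup>2 - 4 * b) = (a'\<^sup>2 - 4 * b') * (u\<^sup>2)\<^sup>2" using ab' by (simp add: power_mult_distrib algebra_simps)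
  then have B0: "a'\<^sup>2 - 4 * b' \<noteq> 0" using nz(2) by (metis mult_zero_left of_int_eq_0_iff)
  have "N (discriminant E') = 1" using disc b'0 B0 unfolding dE N_eq_1_iff by simp
  moreover have "N 16 = 1" using N_mult[of 4 4] by simp
  ultimately have prod: "N b' * (N b' * N (a'\<^sup>2 - 4 * b')) = 1" unfolding dE N_mult[of 16] by (simp add: N_mult power2_eq_square)
  have x1: "N b' * N (a'\<^sup>2 - 4 * b') \<le> 1" using Nb NB by (simp add: mult_le_one)
  have "N b' = 1"
  proof (rule ccontr)
    assume "N b' \<noteq> 1"
    then have "N b' < 1" using Nb by simp
    then have "N b' * (N b' * N (a'\<^sup>2 - 4 * b')) < 1"
      using x1 mult_left_le[OF x1, of "N b'"] by simp
    then show False using prod by simp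
  qed
  then have "N (a'\<^sup>2 - 4 * b') = 1" using prod by simp
  then show ?thesis using that[OF u ab' Na \<open>N b' = 1\<close>] by blast
qed

end

section \<open>Splitting in imaginary quadratic fields\<close>

text \<open>If all powers of t have denominators dividing K, then every power of the denominator of
  t divides K, so that denominator is 1.\<close>

lemma rat_int_of_bounded_denominator:
  fixes t :: rat
  assumes K: "K \<noteq> 0" and pow: "\<And>i. of_int K * t ^ i \<in> \<int>"
  shows "t \<in> \<int>"
proof -
  obtain m n where mn: "quotient_of t = (m, n)" by fastforce
  have n: "n > 0" and t: "t = of_int m / of_int n" and cop: "coprime m n"
    using quotient_of_denom_pos[OF mn] quotient_of_div[OF mn] quotient_of_coprime[OF mn] by auto
  have dvd: "n ^ i dvd K" for i
  proof -
    obtain k where k: "of_int K * t ^ i = (of_int k :: rat)" using pow[of i] by (auto elim: Ints_cases)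
    then have "(of_int (K * m ^ i) :: rat) = of_int (k * n ^ i)" using n by (simp add: t power_divide field_simps)
    then have "K * m ^ i = k * n ^ i" by (simp only: of_int_eq_iff)
    then have "n ^ i dvd K * m ^ i" by simp
    then show ?thesis using cop by (metis coprime_commute coprime_dvd_mult_left_iff coprime_power_left_iff coprime_power_right_iff)
  qed
  have "n = 1"
  proof (rule ccontr)
    assume "n \<noteq> 1"
    then have "n \<ge> 2" using n by simp
    \<comment> \<open>The exponent |K| is large enough because 2^k > k for every k.\<close>
    then have "(2::int) ^ nat \<bar>K\<bar> \<le> n ^ nat \<bar>K\<bar>" by (intro power_mono) auto
    also have "\<dots> \<le> \<bar>K\<bar>" using dvd_imp_le_int[OF K dvd[of "nat \<bar>K\<bar>"]] n by simp
    finally have "(2::int) ^ nat \<bar>K\<bar> \<le> int (nat \<bar>K\<bar>)" by simp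
    moreover have "int (nat \<bar>K\<bar>) < 2 ^ nat \<bar>K\<bar>" using of_nat_less_two_power[of "nat \<bar>K\<bar>", where 'a = int] by simp
    ultimately show False by linarith
  qed
  then show ?thesis using t by simp
qed

lemma of_rat_complex: "(of_rat t :: complex) = of_real (of_rat t)"
  by (cases t) (simp add: of_rat_rat)

section \<open>Integrality in the field generated by a square root of -q\<close>

context
  fixes q :: nat and \<omega> :: complex
  assumes q: "Factorial_Ring.prime q" and \<omega>_def: "\<omega> = csqrt (of_int (- int q))"
begin

lemma omega_square: "\<omega> * \<omega> = - of_nat q"
  using power2_csqrt[of "of_int (- int q)"] by (simp add: \<omega>_def power2_eq_square)

lemma omega_eq: "\<omega> = \<i> * of_real (sqrt (real q))"
proof -
  have "\<omega> = csqrt (- of_real (real q))" by (simp add: \<omega>_def)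
  also have "\<dots> = \<i> * csqrt (of_real (real q))" by (rule csqrt_minus) (use prime_gt_0_nat[OF q] in simp)
  finally show ?thesis by (simp add: csqrt_of_real_nonneg)
qed

lemma cnj_omega: "cnj \<omega> = - \<omega>"
  by (simp add: omega_eq)

text \<open>The order Z[\<omega>], possibly of index two in the ring of integers. Measuring
  denominators against it makes an integral basis of the full ring unnecessary.\<close>

definition Zom :: "complex set" where "Zom = {of_int a + of_int b * \<omega> | a b. True}"

lemma Zom_add: "x \<in> Zom \<Longrightarrow> y \<in> Zom \<Longrightarrow> x + y \<in> Zom"
  unfolding Zom_def
proof clarify
  fix a b c d
  have "of_int a + of_int b * \<omega> + (of_int c + of_int d * \<omega>) = of_int (a + c) + of_int (b + d) * \<omega>" by (simp add: algebra_simps)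
  then show "\<exists>a' b'. of_int a + of_int b * \<omega> + (of_int c + of_int d * \<omega>) = of_int a' + of_int b' * \<omega> \<and> True" by blast
qed

lemma Zom_mult: "x \<in> Zom \<Longrightarrow> y \<in> Zom \<Longrightarrow> x * y \<in> Zom"
  unfolding Zom_def
proof clarify
  fix a b c d
  have "(of_int a + of_int b * \<omega>) * (of_int c + of_int d * \<omega>) = of_int (a * c) + of_int (a * d + b * c) * \<omega> + of_int (b * d) * (\<omega> * \<omega>)"
    by (simp add: algebra_simps)
  also have "\<dots> = of_int (a * c - b * d * int q) + of_int (a * d + b * c) * \<omega>"
    unfolding omega_square by (simp add: algebra_simps)
  finally show "\<exists>a' b'. (of_int a + of_int b * \<omega>) * (of_int c + of_int d * \<omega>) = of_int a' + of_int b' * \<omega> \<and> True" by blast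
qed

lemma Zom_int: "of_int a \<in> Zom"
proof -
  have "of_int a = of_int a + of_int 0 * \<omega>" by simp
  then show ?thesis unfolding Zom_def by blast
qed

lemma Zom_power: "x \<in> Zom \<Longrightarrow> x ^ n \<in> Zom"
  using Zom_int[of 1] by (induction n) (auto intro: Zom_mult)

lemma Zom_sum: "(\<And>i. i \<in> A \<Longrightarrow> f i \<in> Zom) \<Longrightarrow> sum f A \<in> Zom"
  using Zom_int[of 0] by (induction A rule: infinite_finite_induct) (auto intro: Zom_add)

lemma Zom_cnj: "x \<in> Zom \<Longrightarrow> cnj x \<in> Zom"
  unfolding Zom_def
proof clarify
  fix a b
  have "cnj (of_int a + of_int b * \<omega>) = of_int a + of_int (- b) * \<omega>" by (simp add: cnj_omega)
  then show "\<exists>a' b'. cnj (of_int a + of_int b * \<omega>) = of_int a' + of_int b' * \<omega> \<and> True" by blast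
qed

lemma Zom_rat:
  fixes t :: rat
  assumes "of_rat t \<in> Zom" shows "t \<in> \<int>"
proof -
  obtain a b where ab: "of_rat t = of_int a + of_int b * \<omega>" using assms unfolding Zom_def by blast
  have "Im (of_rat t) = 0" by (simp add: of_rat_complex)
  then have "real_of_int b * sqrt (real q) = 0" unfolding ab omega_eq by simp
  then have "b = 0" using prime_gt_0_nat[OF q] by simp
  then have "(of_rat t :: complex) = of_rat (of_int a)" using ab by simp
  then have "t = of_int a" by (simp only: of_rat_eq_iff)
  then show ?thesis by simp
qed

lemma quadratic_field_frac:
  assumes "z \<in> quadratic_field (- int q)"
  obtains k w where "k \<noteq> 0" "w \<in> Zom" "of_int k * z = w"
proof -
  obtain x y where z: "z = of_rat x + of_rat y * \<omega>" using assms unfolding quadratic_field_def \<omega>_def by auto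
  obtain a b where ab: "quotient_of x = (a, b)" by fastforce
  obtain c d where cd: "quotient_of y = (c, d)" by fastforce
  have bd: "b > 0" "d > 0" and x: "x = of_int a / of_int b" and y: "y = of_int c / of_int d"
    using quotient_of_denom_pos[OF ab] quotient_of_denom_pos[OF cd] quotient_of_div[OF ab] quotient_of_div[OF cd] by auto
  have "of_int (b * d) * z = of_int (a * d) + of_int (b * c) * \<omega>"
    using bd unfolding z x y by (simp add: of_rat_divide field_simps)
  then show ?thesis using that[of "b * d"] bd unfolding Zom_def by (metis (mono_tags, lifting) less_irrefl mem_Collect_eq mult_eq_0_iff)
qed

text \<open>A monic integral equation of degree d expresses z^i for i >= d by lower powers with
  integer coefficients, so the factor k^d that clears the first d powers clears all of them.\<close>

lemma powers_bounded_denominator: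
  assumes z: "z \<in> quadratic_field (- int q)" and int: "algebraic_int z"
  obtains K where "K \<noteq> 0" "\<And>i. of_int K * z ^ i \<in> Zom"
proof -
  obtain f :: "int poly" where f: "poly (map_poly of_int f) z = 0" "lead_coeff f = 1"
    using int unfolding algebraic_int_altdef_ipoly by blast
  obtain k w where k: "k \<noteq> 0" "w \<in> Zom" "of_int k * z = w" using quadratic_field_frac[OF z] by blast
  define d where "d = degree f"
  have zd: "z ^ d = - (\<Sum>j<d. of_int (coeff f j) * z ^ j)"
  proof -
    have "(\<Sum>j\<le>d. of_int (coeff f j) * z ^ j) = 0"
      using f(1) by (simp add: poly_altdef d_def degree_map_poly coeff_map_poly)
    then have "(\<Sum>j<d. of_int (coeff f j) * z ^ j) + of_int (coeff f d) * z ^ d = 0"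
      by (simp add: lessThan_Suc_atMost[symmetric])
    then show ?thesis using f(2) by (simp add: d_def add_eq_0_iff add.commute)
  qed
  have "of_int (k ^ d) * z ^ i \<in> Zom" for i
  proof (induction i rule: less_induct)
    case (less i)
    show ?case
    proof (cases "i < d")
      case True
      then have "d = (d - i) + i" by simp
      then have "of_int (k ^ d) * z ^ i = of_int (k ^ (d - i)) * (of_int k * z) ^ i"
        by (metis (no_types, lifting) mult.assoc of_int_power power_add power_mult_distrib)
      also have "\<dots> \<in> Zom" unfolding k(3) by (intro Zom_mult Zom_int Zom_power k(2))
      finally show ?thesis .
    next
      case False
      then have i: "i = d + (i - d)" by simp
      have "of_int (k ^ d) * z ^ i = of_int (k ^ d) * (z ^ d * z ^ (i - d))" by (metis i power_add)
      also have "\<dots> = (\<Sum>j<d. of_int (- coeff f j) * (of_int (k ^ d) * z ^ (j + (i - d))))"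
        unfolding zd by (simp add: sum_distrib_left sum_distrib_right sum_negf power_add mult_ac)
      also have "\<dots> \<in> Zom" using False by (intro Zom_sum Zom_mult[OF Zom_int] less) auto
      finally show ?thesis .
    qed
  qed
  then show ?thesis using that[of "k ^ d"] k(1) by simp
qed

text \<open>Powers of the trace and of the norm expand into products of powers of z and its
  conjugate, whose denominators all divide K^2. A rational number with this property is an
  integer.\<close>

lemma trace_norm_int:
  fixes x y :: rat
  assumes z: "z = of_rat x + of_rat y * \<omega>" and int: "algebraic_int z"
  shows "2 * x \<in> \<int>" "x\<^sup>2 + of_nat q * y\<^sup>2 \<in> \<int>"
proof -
  have "z \<in> quadratic_field (- int q)" using z unfolding quadratic_field_def \<omega>_def by blast
  then obtain K where K: "K \<noteq> 0" "\<And>i. of_int K * z ^ i \<in> Zom" using powers_bounded_denominator int by blast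
  have Kc: "of_int K * cnj z ^ i \<in> Zom" for i using Zom_cnj[OF K(2)[of i]] by simp
  have "cnj (of_rat r) = of_rat r" for r :: rat by (simp add: of_rat_complex)
  then have cz: "cnj z = of_rat x - of_rat y * \<omega>" unfolding z by (simp add: cnj_omega)
  have tr: "z + cnj z = of_rat (2 * x)" unfolding cz unfolding z by (simp add: of_rat_mult)
  have "z * cnj z = of_rat x * of_rat x - of_rat y * of_rat y * (\<omega> * \<omega>)" unfolding cz unfolding z by (simp add: algebra_simps)
  then have no: "z * cnj z = of_rat (x\<^sup>2 + of_nat q * y\<^sup>2)"
    unfolding omega_square by (simp add: of_rat_mult of_rat_add power2_eq_square)
  have K2: "K * K \<noteq> 0" using K(1) by simp
  have "of_int (K * K) * (2 * x) ^ i \<in> \<int>" for i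
  proof -
    have "of_rat (of_int (K * K) * (2 * x) ^ i) = of_int K * of_int K * (z + cnj z) ^ i"
      unfolding tr by (simp add: of_rat_mult of_rat_power)
    also have "\<dots> = (\<Sum>j\<le>i. of_int (int (i choose j)) * ((of_int K * z ^ j) * (of_int K * cnj z ^ (i - j))))"
      unfolding binomial_ring by (simp add: sum_distrib_left mult_ac)
    also have "\<dots> \<in> Zom" by (intro Zom_sum Zom_mult[OF Zom_int] Zom_mult K Kc)
    finally show ?thesis by (rule Zom_rat)
  qed
  then show "2 * x \<in> \<int>" by (rule rat_int_of_bounded_denominator[OF K2])
  have "of_int (K * K) * (x\<^sup>2 + of_nat q * y\<^sup>2) ^ i \<in> \<int>" for i
  proof -
    have "of_rat (of_int (K * K) * (x\<^sup>2 + of_nat q * y\<^sup>2) ^ i) = of_int K * of_int K * (z * cnj z) ^ i"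
      unfolding no by (simp add: of_rat_mult of_rat_power)
    also have "\<dots> = (of_int K * z ^ i) * (of_int K * cnj z ^ i)" by (simp add: power_mult_distrib mult_ac)
    also have "\<dots> \<in> Zom" by (intro Zom_mult K Kc)
    finally show ?thesis by (rule Zom_rat)
  qed
  then show "x\<^sup>2 + of_nat q * y\<^sup>2 \<in> \<int>" by (rule rat_int_of_bounded_denominator[OF K2])
qed

text \<open>For \<open>z\<close> in one of the two primes above \<open>v\<close> but not in the other, \<open>v\<close> divides the norm \<open>v m\<close> of \<open>z\<close> but
  not the trace \<open>T\<close>, for otherwise \<open>z\<^sup>2 = T z - v m\<close> would lie in both. So the discriminant \<open>- q n\<^sup>2\<close> of \<open>z\<close>
  is a nonzero square modulo \<open>4 v\<close>.\<close>

lemma splits_in_imp: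
  assumes v: "Factorial_Ring.prime v" and split: "splits_in v (- int q)"
  obtains T n m :: int where "\<not> int v dvd T" "- int q * n\<^sup>2 = T\<^sup>2 - 4 * int v * m"
proof -
  define R where "R = quadratic_integers (- int q)"
  have R: "carrier R = {z \<in> quadratic_field (- int q). algebraic_int z}" "x \<otimes>\<^bsub>R\<^esub> y = x * y" "x \<oplus>\<^bsub>R\<^esub> y = x + y"
    "\<one>\<^bsub>R\<^esub> = 1" "\<zero>\<^bsub>R\<^esub> = 0" for x y
    by (simp_all add: R_def quadratic_integers_def ring_of_type_algebra_def)
  obtain P Q where PQ: "primeideal P R" "primeideal Q R" "P \<noteq> Q" "P \<cdot>\<^bsub>R\<^esub> Q = PIdl\<^bsub>R\<^esub> (of_nat v)"
    using split unfolding splits_in_def R_def by blast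
  interpret R: cring R by (rule primeideal.axioms(2)[OF PQ(1)])
  interpret P: primeideal P R by fact
  interpret Q: primeideal Q R by fact
  have intR: "of_int k \<in> carrier R" for k
  proof -
    have "(of_int k :: complex) = of_rat (of_int k) + of_rat 0 * csqrt (of_int (- int q))" by simp
    then have "(of_int k :: complex) \<in> quadratic_field (- int q)" unfolding quadratic_field_def by blast
    then show ?thesis using algebraic_int_of_int by (simp add: R)
  qed
  have "of_nat v \<in> PIdl\<^bsub>R\<^esub> (of_nat v)" using R.cgenideal_self[of "of_nat v"] intR[of "int v"] by simp
  then have "of_nat v \<in> P \<cdot>\<^bsub>R\<^esub> Q" using PQ(4) by simp
  then have vPQ: "of_nat v \<in> P" "of_nat v \<in> Q"
    using R.ideal_prod_inter[OF P.is_ideal Q.is_ideal] by auto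
  \<comment> \<open>Stated for an abstract pair, since it is not known which of the distinct primes
    P and Q has an element outside the other.\<close>
  have key: thesis if I: "primeideal A R" "primeideal B R" "of_nat v \<in> A" "of_nat v \<in> B" "z \<in> A" "z \<notin> B" for A B z
  proof -
    interpret A: primeideal A R by fact
    interpret B: primeideal B R by fact
    have zR: "z \<in> carrier R" using I(5) A.Icarr by blast
    then obtain x y where z: "z = of_rat x + of_rat y * \<omega>" and ai: "algebraic_int z"
      unfolding R quadratic_field_def \<omega>_def by blast
    obtain T where T: "2 * x = of_int T" using trace_norm_int(1)[OF z ai] by (auto elim: Ints_cases)
    obtain M where M: "x\<^sup>2 + of_nat q * y\<^sup>2 = of_int M" using trace_norm_int(2)[OF z ai] by (auto elim: Ints_cases)
    have cr: "cnj (of_rat r) = of_rat r" for r :: rat by (simp add: of_rat_complex)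
    have cz: "cnj z = of_rat x + of_rat (- y) * \<omega>" unfolding z by (simp add: cnj_omega cr of_rat_minus)
    then have "cnj z \<in> quadratic_field (- int q)" unfolding quadratic_field_def \<omega>_def by blast
    then have czR: "cnj z \<in> carrier R" using ai by (simp add: R)
    have "z * cnj z = of_rat x * of_rat x - of_rat y * of_rat y * (\<omega> * \<omega>)" unfolding cz unfolding z by (simp add: algebra_simps of_rat_minus)
    also have "\<dots> = of_rat (x\<^sup>2 + of_nat q * y\<^sup>2)" unfolding omega_square by (simp add: of_rat_mult of_rat_add power2_eq_square)
    finally have no: "z * cnj z = of_int M" unfolding M by simp
    have "z + cnj z = of_rat (2 * x)" unfolding cz unfolding z by (simp add: of_rat_mult of_rat_minus)
    then have tr: "z + cnj z = of_int T" unfolding T by simp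
    have "z * cnj z \<in> A" using A.I_r_closed[OF I(5) czR] by (simp add: R)
    then have MA: "of_int M \<in> A" using no by simp
    \<comment> \<open>The norm lies in the proper ideal A, which cannot contain the coprime integers
      v and M.\<close>
    have vM: "int v dvd M"
    proof (rule ccontr)
      assume "\<not> int v dvd M"
      then have "coprime (int v) M" using v by (simp add: prime_imp_coprime)
      then obtain s t where st: "s * int v + t * M = 1" by (metis bezout_int coprime_imp_gcd_eq_1)
      have "of_int s \<otimes>\<^bsub>R\<^esub> of_nat v \<oplus>\<^bsub>R\<^esub> of_int t \<otimes>\<^bsub>R\<^esub> of_int M \<in> A"
        using A.I_l_closed[OF I(3) intR] A.I_l_closed[OF MA intR] A.a_closed by blast
      moreover have "of_int s \<otimes>\<^bsub>R\<^esub> of_nat v \<oplus>\<^bsub>R\<^esub> of_int t \<otimes>\<^bsub>R\<^esub> of_int M = \<one>\<^bsub>R\<^esub>"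
        using arg_cong[OF st, of "of_int :: int \<Rightarrow> complex"] by (simp add: R)
      ultimately have "A = carrier R" using A.one_imp_carrier by simp
      then show False using A.I_notcarr by simp
    qed
    then obtain m where m: "M = int v * m" by blast
    have vT: "\<not> int v dvd T"
    proof
      assume "int v dvd T"
      then obtain k where k: "T = int v * k" by blast
      have "z * z = (z + cnj z) * z - z * cnj z" by (simp add: algebra_simps)
      also have "\<dots> = (of_int k * z + of_int (- m)) * of_nat v" unfolding tr no k m by (simp add: algebra_simps)
      finally have zz: "z \<otimes>\<^bsub>R\<^esub> z = (of_int k \<otimes>\<^bsub>R\<^esub> z \<oplus>\<^bsub>R\<^esub> of_int (- m)) \<otimes>\<^bsub>R\<^esub> of_nat v" by (simp add: R)
      have "of_int k \<otimes>\<^bsub>R\<^esub> z \<oplus>\<^bsub>R\<^esub> of_int (- m) \<in> carrier R" using intR zR R.m_closed R.add.m_closed by blast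
      then have "z \<otimes>\<^bsub>R\<^esub> z \<in> B" unfolding zz using B.I_l_closed[OF I(4)] by blast
      then show False using B.I_prime[OF zR zR] I(6) by blast
    qed
    have "(of_int T)\<^sup>2 - 4 * of_int M = - (of_nat q * (2 * y)\<^sup>2)"
      unfolding T[symmetric] M[symmetric] by (simp add: power2_eq_square algebra_simps)
    then have e: "of_nat q * (2 * y)\<^sup>2 = (of_int (4 * M - T\<^sup>2) :: rat)" by simp
    \<comment> \<open>Here q (2y)^2 is an integer and q is prime, so the square of the denominator
      of 2y divides q and the denominator is 1.\<close>
    have "2 * y \<in> \<int>"
    proof -
      obtain c d where cd: "quotient_of (2 * y) = (c, d)" by fastforce
      have d: "d > 0" and yc: "2 * y = of_int c / of_int d" and cop: "coprime c d"
        using quotient_of_denom_pos[OF cd] quotient_of_div[OF cd] quotient_of_coprime[OF cd] by auto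
      have "(of_int (int q * c\<^sup>2) :: rat) = of_int ((4 * M - T\<^sup>2) * d\<^sup>2)"
      proof -
        have "of_nat q * (of_int c)\<^sup>2 / (of_int d)\<^sup>2 = (of_int (4 * M - T\<^sup>2) :: rat)"
          using e unfolding yc power_divide times_divide_eq_right .
        moreover have "(of_int d :: rat)\<^sup>2 \<noteq> 0" using d by simp
        ultimately have "of_nat q * (of_int c)\<^sup>2 = (of_int (4 * M - T\<^sup>2) :: rat) * (of_int d)\<^sup>2"
          by (simp only: divide_eq_eq not_False_eq_True if_True)
        then show ?thesis by simp
      qed
      then have e2: "int q * c\<^sup>2 = (4 * M - T\<^sup>2) * d\<^sup>2" by (simp only: of_int_eq_iff)
      then have "d\<^sup>2 dvd int q * c\<^sup>2" by simp
      moreover have "coprime (d\<^sup>2) (c\<^sup>2)" using cop by (simp add: coprime_commute)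
      ultimately have "d\<^sup>2 dvd int q" by (simp add: coprime_dvd_mult_left_iff)
      then obtain e where "int q = d\<^sup>2 * e" by (rule dvdE)
      then have e: "int q = d * (d * e)" by (simp add: power2_eq_square mult.assoc)
      have "d = 1"
      proof (rule ccontr)
        assume "d \<noteq> 1"
        have qi: "Factorial_Ring.prime (int q)" using q by simp
        have "d dvd int q" using e by simp
        then have "d = int q" using d \<open>d \<noteq> 1\<close> qi[unfolded prime_int_iff] less_imp_le by blast
        then have "d * (d * e) = d * 1" using e by (simp only: mult_1_right)
        then have "d * e = 1" using d by (simp only: mult_cancel_left) auto
        then have "int q dvd 1" using \<open>d = int q\<close> by (metis dvd_triv_left)
        then show False using qi by (simp add: prime_int_iff)
      qed
      then show ?thesis using yc by simp
    qed
    then obtain n where n: "2 * y = of_int n" by (auto elim: Ints_cases)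
    have "(of_int (int q * n\<^sup>2) :: rat) = of_int (4 * M - T\<^sup>2)" using e unfolding n by simp
    then have "int q * n\<^sup>2 = 4 * M - T\<^sup>2" by (simp only: of_int_eq_iff)
    then have "- int q * n\<^sup>2 = T\<^sup>2 - 4 * int v * m" using m by simp
    then show thesis using that vT \<open>\<And>T n m. \<lbrakk>\<not> int v dvd T; - int q * n\<^sup>2 = T\<^sup>2 - 4 * int v * m\<rbrakk> \<Longrightarrow> thesis\<close> by blast
  qed
  show thesis
  proof (cases "P \<subseteq> Q")
    case True
    then obtain z where "z \<in> Q" "z \<notin> P" using PQ(3) by blast
    then show thesis using key[OF PQ(2,1) vPQ(2,1)] by blast
  next
    case False
    then obtain z where "z \<in> P" "z \<notin> Q" by blast
    then show thesis using key[OF PQ(1,2) vPQ] by blast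
  qed
qed

end

text \<open>Modulo v the relation says that -q n^2 is the nonzero square T^2; hence v divides
  neither q nor n, and n can be inverted.\<close>

lemma splits_in_odd:
  assumes q: "Factorial_Ring.prime q" and v: "Factorial_Ring.prime v" "v \<noteq> 2" and split: "splits_in v (- int q)"
  shows "v \<noteq> q" "QuadRes (int v) (- int q)"
proof -
  obtain T n m where T: "\<not> int v dvd T" "- int q * n\<^sup>2 = T\<^sup>2 - 4 * int v * m"
    using splits_in_imp[OF q refl v(1) split] by blast
  have vi: "Factorial_Ring.prime (int v)" using v by simp
  have T2: "\<not> int v dvd T\<^sup>2" using T(1) vi by (simp add: prime_dvd_power_iff)
  have nd: "\<not> int v dvd - int q * n\<^sup>2"
  proof
    assume "int v dvd - int q * n\<^sup>2"
    then have "int v dvd T\<^sup>2 - 4 * int v * m" unfolding T(2) .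
    then have "int v dvd (T\<^sup>2 - 4 * int v * m) + 4 * int v * m" by (intro dvd_add) auto
    then show False using T2 by simp
  qed
  then show "v \<noteq> q" by auto
  have "coprime n (int v)" using nd vi by (metis coprime_commute dvd_mult dvd_power prime_imp_coprime zero_less_numeral dvd_trans)
  then obtain i where i: "[n * i = 1] (mod int v)" using cong_solve_coprime_int by blast
  have "[(T * i)\<^sup>2 = - int q] (mod int v)"
  proof -
    have "[T\<^sup>2 = - int q * n\<^sup>2] (mod int v)" unfolding T(2) by (simp add: cong_iff_dvd_diff)
    then have "[T\<^sup>2 * i\<^sup>2 = - int q * n\<^sup>2 * i\<^sup>2] (mod int v)" by (intro cong_mult) auto
    moreover have "- int q * n\<^sup>2 * i\<^sup>2 = - int q * (n * i)\<^sup>2" by (simp add: power_mult_distrib)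
    moreover have "[- int q * (n * i)\<^sup>2 = - int q * 1\<^sup>2] (mod int v)" using i by (intro cong_mult cong_pow) auto
    ultimately show ?thesis by (metis (no_types, lifting) cong_trans mult.right_neutral one_power2 power_mult_distrib)
  qed
  then show "QuadRes (int v) (- int q)" unfolding QuadRes_def by blast
qed

lemma odd_square_mod_8: fixes n :: int assumes "odd n" shows "n\<^sup>2 mod 8 = 1"
proof -
  obtain k where k: "n = 2 * k + 1" using assms by (auto elim: oddE)
  have "even (k * (k + 1))" by simp
  then obtain j where j: "k * (k + 1) = 2 * j" by (rule evenE)
  have "n\<^sup>2 = 4 * (k * (k + 1)) + 1" unfolding k by (simp add: power2_eq_square algebra_simps)
  then have "n\<^sup>2 = 8 * j + 1" unfolding j by simp
  then show ?thesis by simp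
qed

text \<open>At v = 2 the relation reads -q n^2 = T^2 - 8m with T odd. Odd squares are 1 modulo 8, so
  n is odd and -q is 1 modulo 8.\<close>

lemma splits_in_2:
  assumes q: "Factorial_Ring.prime q" and split: "splits_in 2 (- int q)"
  shows "q mod 8 = 7"
proof -
  obtain T n m where T: "\<not> int 2 dvd T" "- int q * n\<^sup>2 = T\<^sup>2 - 4 * int 2 * m"
    using splits_in_imp[OF q refl two_is_prime_nat split] by blast
  have T8: "T\<^sup>2 mod 8 = 1" using T(1) odd_square_mod_8 by simp
  have e: "- int q * n\<^sup>2 = T\<^sup>2 + 8 * (- m)" using T(2) by simp
  have m8: "(- int q * n\<^sup>2) mod 8 = 1" unfolding e mod_mult_self2 by (rule T8)
  have "odd k" if "k mod 8 = 1" for k :: int using that by presburger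
  from this[OF m8] have "odd (- int q * n\<^sup>2)" .
  then have "odd n" by simp
  then have "n\<^sup>2 mod 8 = 1" by (rule odd_square_mod_8)
  then have "(- int q * n\<^sup>2) mod 8 = (- int q * 1) mod 8" by (metis mod_mult_right_eq)
  then have "(- int q) mod 8 = 1" using m8 by simp
  then show ?thesis by presburger
qed

section \<open>Quadratic residues\<close>

text \<open>By Gauss's lemma: with q = 8k + 7, the doubles of 1, ..., 4k + 3 that exceed 4k + 3 come
  from 2k + 2, ..., 4k + 3, which is an even number of elements.\<close>

lemma Legendre_2:
  assumes q: "Factorial_Ring.prime q" "q mod 8 = 7"
  shows "Legendre 2 (int q) = 1"
proof -
  have q2: "2 < q" using q(2) by presburger
  obtain k where k: "q = 8 * k + 7" using q(2) by (metis mod_div_decomp mult.commute)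
  have "\<not> [2 = 0] (mod int q)"
  proof
    assume "[2 = 0] (mod int q)"
    then have "int q dvd 2" by (simp add: cong_0_iff)
    then show False using q2 zdvd_imp_le[of "int q" 2] by simp
  qed
  then interpret G: GAUSS q 2 using q q2 by unfold_locales auto
  have h: "(int q - 1) div 2 = 4 * int k + 3" using k by simp
  have "G.E = (\<lambda>x. 2 * x) ` {2 * int k + 2..4 * int k + 3}"
  proof (intro Set.set_eqI iffI)
    fix y assume "y \<in> G.E"
    then obtain x where x: "0 < x" "x \<le> 4 * int k + 3" "y = (x * 2) mod int q" "y > 4 * int k + 3"
      unfolding G.E_def G.C_def G.B_def G.A_def h by auto
    have "(x * 2) mod int q = x * 2" using x k by (intro mod_pos_pos_trivial) auto
    then show "y \<in> (\<lambda>x. 2 * x) ` {2 * int k + 2..4 * int k + 3}" using x by (intro image_eqI[of _ _ x]) auto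
  next
    fix y assume "y \<in> (\<lambda>x. 2 * x) ` {2 * int k + 2..4 * int k + 3}"
    then obtain x where x: "2 * int k + 2 \<le> x" "x \<le> 4 * int k + 3" "y = 2 * x" by auto
    have "(x * 2) mod int q = x * 2" using x k by (intro mod_pos_pos_trivial) auto
    moreover have "x \<in> G.A" unfolding G.A_def h using x by simp
    ultimately have "y \<in> G.C" unfolding G.C_def G.B_def using x(3) by (metis imageI mult.commute)
    then show "y \<in> G.E" unfolding G.E_def h using x by simp
  qed
  then have "card G.E = card {2 * int k + 2..4 * int k + 3}" by (simp add: card_image inj_on_def)
  also have "\<dots> = 2 * k + 2" by simp
  finally show ?thesis using G.gauss_lemma by simp
qed

lemma Legendre_minus_one:
  assumes "odd_padic q" shows "Legendre (- 1) (int q) = (- 1) ^ ((q - 1) div 2)"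
proof -
  interpret odd_padic q by fact
  have q2: "2 < q" using p_gt_1 p_ne_2 by linarith
  have "int q dvd Legendre (- 1) (int q) - (- 1) ^ ((q - 1) div 2)"
    using euler_criterion[OF prime_p q2, of "- 1"] by (simp add: cong_iff_dvd_diff)
  moreover have "\<bar>Legendre (- 1) (int q)\<bar> \<le> 1" "\<bar>(- 1) ^ ((q - 1) div 2) :: int\<bar> \<le> 1" by (auto simp: Legendre_def power_abs)
  then have "\<bar>Legendre (- 1) (int q) - (- 1) ^ ((q - 1) div 2)\<bar> < int q" using q2 by linarith
  ultimately show ?thesis
    using zdvd_imp_le[of "int q" "\<bar>Legendre (- 1) (int q) - (- 1) ^ ((q - 1) div 2)\<bar>"] by fastforce
qed

section \<open>Admissible twists\<close>

lemma (in padic) psq_prod: "finite A \<Longrightarrow> (\<And>x. x \<in> A \<Longrightarrow> psq (f x)) \<Longrightarrow> psq (prod f A)"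
proof (induction A rule: finite_induct)
  case empty
  then show ?case using psq_square[of 1] by simp
qed (auto intro: psq_mult)

section \<open>Values of lambda and gamma on square classes\<close>

lemma of_int_bit_eq_0_iff: "(of_int k :: bit) = 0 \<longleftrightarrow> even k"
  by (cases "even k") (auto elim!: evenE oddE)

lemma the_elem_constant: "x \<in> A \<Longrightarrow> (\<And>y. y \<in> A \<Longrightarrow> f y = c) \<Longrightarrow> the_elem (f ` A) = c"
proof -
  assume "x \<in> A" "\<And>y. y \<in> A \<Longrightarrow> f y = c"
  then have "f ` A = {c}" by blast
  then show ?thesis by simp
qed

lemma self_in_sqcls: "\<alpha> \<in> sqcls \<alpha>"
  unfolding sqcls_def by (auto intro!: exI[of _ 1])

lemma sqcls_pos_iff: "\<alpha> \<noteq> 0 \<Longrightarrow> (\<exists>x\<in>sqcls \<alpha>. x > 0) \<longleftrightarrow> \<alpha> > 0"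
proof
  assume "\<alpha> \<noteq> 0" "\<exists>x\<in>sqcls \<alpha>. x > 0"
  then show "\<alpha> > 0" unfolding sqcls_def by (auto simp: zero_less_mult_iff)
qed (use self_in_sqcls in blast)

lemma (in padic) lambda_val_sqcls:
  assumes "\<alpha> \<noteq> 0" shows "lambda_val p (sqcls \<alpha>) = of_int (v \<alpha>)"
  unfolding lambda_val_def
proof (rule the_elem_constant[OF self_in_sqcls])
  fix x assume "x \<in> sqcls \<alpha>"
  then obtain c where c: "c \<noteq> 0" "x = \<alpha> * c\<^sup>2" by (auto simp: sqcls_def)
  then have "v x = v \<alpha> + 2 * v c" using assms by (simp add: padic_val_power)
  then show "(of_int (v x) :: bit) = of_int (v \<alpha>)" by simp
qed

context odd_padic begin

lemma rat_Legendre_eq_1_iff: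
  assumes "N x = 1" shows "rat_Legendre x p = 1 \<longleftrightarrow> psq x"
proof -
  obtain m n where mn: "quotient_of x = (m, n)" by fastforce
  have n: "n > 0" and x: "x = of_int m / of_int n" and cop: "coprime m n"
    using quotient_of_denom_pos[OF mn] quotient_of_div[OF mn] quotient_of_coprime[OF mn] by auto
  have e: "N (of_int m) = N (of_int n)" using assms n unfolding x N_divide by (simp add: divide_eq_eq)
  have nd: "\<not> int p dvd m" "\<not> int p dvd n"
    using e N_of_int_less_1_iff[of m] N_of_int_less_1_iff[of n] cop prime_int_p
    by (metis coprime_common_divisor not_prime_unit)+
  then have nd': "\<not> int p dvd m * n" using prime_int_p by (simp add: prime_dvd_mult_iff)
  have "of_int (m * n) = x * (of_int n)\<^sup>2" using n by (simp add: x power2_eq_square)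
  then have "psq x \<longleftrightarrow> psq (of_int (m * n))" using n by simp
  also have "\<dots> \<longleftrightarrow> Legendre (m * n) (int p) = 1" by (rule psq_Legendre[OF nd'])
  finally show ?thesis by (simp add: rat_Legendre_def mn Legendre_mult)
qed

lemma unit_part:
  assumes "\<alpha> \<noteq> 0" shows "N (\<alpha> / of_nat p powi v \<alpha>) = 1"
proof -
  have p0: "(of_nat p :: rat) \<noteq> 0" using p_gt_1 by simp
  have "v (\<alpha> / of_nat p powi v \<alpha>) = 0" using assms p0 by (simp add: padic_val_divide padic_val_powi)
  then show ?thesis using assms p0 by (simp add: N_eq_1_iff)
qed

lemma gamma_val_sqcls:
  assumes "\<alpha> \<noteq> 0" shows "gamma_val p (sqcls \<alpha>) = (if psq (\<alpha> / of_nat p powi v \<alpha>) then 0 else 1)"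
  unfolding gamma_val_def
proof (rule the_elem_constant[OF self_in_sqcls])
  fix x assume "x \<in> sqcls \<alpha>"
  then obtain c where c: "c \<noteq> 0" "x = \<alpha> * c\<^sup>2" by (auto simp: sqcls_def)
  have p0: "(of_nat p :: rat) \<noteq> 0" using p_gt_1 by simp
  have x0: "x \<noteq> 0" using assms c by simp
  have "v x = v \<alpha> + (v c + v c)" using assms c by (simp add: padic_val_power)
  then have "(of_nat p :: rat) powi v x = of_nat p powi v \<alpha> * (of_nat p powi v c * of_nat p powi v c)"
    by (simp only: power_int_add[OF disjI1[OF p0]])
  then have "x / of_nat p powi v x = \<alpha> / of_nat p powi v \<alpha> * (c / of_nat p powi v c)\<^sup>2"
    using p0 c(2) by (simp add: power2_eq_square)
  moreover have "c / of_nat p powi v c \<noteq> 0" using c(1) p0 by simp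
  ultimately have "psq (x / of_nat p powi v x) \<longleftrightarrow> psq (\<alpha> / of_nat p powi v \<alpha>)"
    by (simp only: psq_mult_square not_False_eq_True)
  then show "(if rat_Legendre (x / of_nat p powi v x) p = 1 then 0 else 1) = (if psq (\<alpha> / of_nat p powi v \<alpha>) then 0 else 1 :: bit)"
    using rat_Legendre_eq_1_iff[OF unit_part[OF x0]] by simp
qed

lemma psq_unit_part:
  assumes "\<alpha> \<noteq> 0" shows "psq \<alpha> \<longleftrightarrow> even (v \<alpha>) \<and> psq (\<alpha> / of_nat p powi v \<alpha>)"
proof (cases "even (v \<alpha>)")
  case True
  then obtain k where k: "v \<alpha> = k + k" by (metis evenE mult_2)
  have p0: "(of_nat p :: rat) \<noteq> 0" using p_gt_1 by simp
  have "(of_nat p :: rat) powi v \<alpha> = of_nat p powi k * of_nat p powi k"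
    unfolding k by (simp only: power_int_add[OF disjI1[OF p0]])
  then have "\<alpha> = \<alpha> / of_nat p powi v \<alpha> * (of_nat p powi k)\<^sup>2"
    using p0 by (simp add: power2_eq_square)
  then have "psq \<alpha> \<longleftrightarrow> psq (\<alpha> / of_nat p powi v \<alpha>)" using p0 psq_mult_square[of "of_nat p powi k" "\<alpha> / of_nat p powi v \<alpha>"] by simp
  then show ?thesis using True by simp
qed (auto dest: psq_even)

end

section \<open>Primes dividing the twist and primes dividing 2 N_E\<close>

locale admissible_twist =
  fixes a b :: int and d :: nat
  assumes nz: "b \<noteq> 0" "a\<^sup>2 - 4 * b \<noteq> 0" and d_in: "d \<in> twist_set (curve a b)"
begin

definition S :: "nat set" where "S = prime_factors d"

text \<open>These are the primes at which -d becomes a square. As 2 is among them, every other prime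
  is odd and of good reduction.\<close>

definition Bad :: "nat set" where "Bad = {v. Factorial_Ring.prime v \<and> v dvd 2 * conductor (curve a b)}"

abbreviation D :: int where "D \<equiv> - int d"

lemma S_props: "finite S" "odd (card S)" "d = \<Prod>S" "q \<in> S \<Longrightarrow> Factorial_Ring.prime q"
  "q \<in> S \<Longrightarrow> v \<in> Bad \<Longrightarrow> splits_in v (- int q)" "d > 0"
  "Factorial_Ring.prime p \<Longrightarrow> p dvd d \<longleftrightarrow> p \<in> S"
proof -
  obtain A where A: "finite A" "odd (card A)" "d = \<Prod>A"
    "\<And>q. q \<in> A \<Longrightarrow> Factorial_Ring.prime q \<and> (\<forall>v. Factorial_Ring.prime v \<and> v dvd 2 * conductor (curve a b) \<longrightarrow> splits_in v (- int q))"
    using d_in unfolding twist_set_def by blast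
  have d0: "d \<noteq> 0" unfolding A(3) using A(1,4) prime_gt_0_nat by (metis less_numeral_extra(3) prod_zero_iff)
  have mem: "p dvd d \<longleftrightarrow> p \<in> A" if "Factorial_Ring.prime p" for p
  proof -
    have "p dvd d \<longleftrightarrow> (\<exists>q\<in>A. p dvd q)" unfolding A(3) using A(1) that by (simp add: prime_dvd_prod_iff)
    also have "\<dots> \<longleftrightarrow> p \<in> A"
    proof
      assume "\<exists>q\<in>A. p dvd q"
      then obtain q where "q \<in> A" "p dvd q" by blast
      then show "p \<in> A" using primes_dvd_imp_eq[OF that, of q] A(4)[of q] by simp
    qed (auto intro: bexI[of _ p])
    finally show ?thesis .
  qed
  have "S = A" unfolding S_def using mem A(4) d0 by (auto simp: in_prime_factors_iff)
  then show "finite S" "odd (card S)" "d = \<Prod>S" "q \<in> S \<Longrightarrow> Factorial_Ring.prime q"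
    "q \<in> S \<Longrightarrow> v \<in> Bad \<Longrightarrow> splits_in v (- int q)" "d > 0"
    "Factorial_Ring.prime p \<Longrightarrow> p dvd d \<longleftrightarrow> p \<in> S"
    using A(1,2) apply simp_all
    subgoal by (rule A(3))
    subgoal using A(4) by blast
    subgoal using A(4) by (simp add: Bad_def)
    subgoal using d0 by simp
    subgoal by (rule mem)
    done
qed

lemma two_Bad: "2 \<in> Bad" by (simp add: Bad_def)

lemma S_mod_8: "q \<in> S \<Longrightarrow> q mod 8 = 7"
  using splits_in_2 S_props(4,5) two_Bad by blast

lemma S_odd_padic: "q \<in> S \<Longrightarrow> odd_padic q"
  using S_mod_8[of q] S_props(4)[of q] by unfold_locales auto

lemma Bad_odd: "q \<in> S \<Longrightarrow> v \<in> Bad \<Longrightarrow> v \<noteq> 2 \<Longrightarrow> v \<noteq> q \<and> QuadRes (int v) (- int q)"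
  using splits_in_odd[of q v] S_props(4,5) by (auto simp: Bad_def)

text \<open>A prime q of S dividing 2 N_E would have to split in the field of its own square root of
  -q, where it ramifies. So the curve has good reduction at every prime dividing d.\<close>

lemma S_not_Bad: "q \<in> S \<Longrightarrow> q \<notin> Bad"
  using Bad_odd[of q q] S_mod_8[of q] by (cases "q = 2") auto

lemma not_Bad: 
  assumes "Factorial_Ring.prime p" "p \<notin> Bad" shows "odd_padic p" "good_reduction p (curve a b)"
proof -
  show "odd_padic p" using assms two_Bad by unfold_locales auto
  show "good_reduction p (curve a b)" using bad_prime_dvd_conductor[OF nz assms(1)] assms by (auto simp: Bad_def intro: dvd_mult)
qed

lemma prod_S: "\<Prod>S = d" using S_props(3) by (rule sym)

lemma minus_d_psq:
  assumes p: "p \<in> Bad" shows "padic.psq p (of_int D)"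
proof -
  interpret padic p using p by unfold_locales (simp add: Bad_def)
  have "(\<Prod>q\<in>S. - (of_nat q :: rat)) = (- 1) ^ card S * (\<Prod>q\<in>S. of_nat q)"
    using prod.distrib[of "\<lambda>_. - 1 :: rat" of_nat S] by simp
  also have "\<dots> = of_int D" using S_props(2) prod_S by (simp flip: of_nat_prod)
  finally have e: "of_int D = (\<Prod>q\<in>S. - (of_nat q :: rat))" by simp
  show ?thesis unfolding e
  proof (rule psq_prod[OF S_props(1)])
    fix q assume q: "q \<in> S"
    have q0: "q > 0" using S_props(4)[OF q] prime_gt_0_nat by blast
    show "psq (- of_nat q)"
    proof (cases "p = 2")
      case True
      have "q mod 8 = 7" using S_mod_8[OF q] .
      then obtain k where "q = 8 * k + 7" by (metis mod_div_decomp mult.commute)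
      \<comment> \<open>For q = 8k + 7 the difference -q - 1 is -8 (k + 1), which is just the
        precision |8| that \<open>psq\<close> demands at 2.\<close>
      then have k: "- of_nat q / 1\<^sup>2 - 1 = - ((4 * of_nat p) * (of_nat (k + 1) :: rat))" using True by simp
      have "N (- of_nat q / 1\<^sup>2 - 1) \<le> N (4 * of_nat p)"
        unfolding k N_minus N_mult[of "4 * of_nat p"] using N_of_nat_le_1[of "k + 1"] by (intro mult_left_le) auto
      then show ?thesis unfolding psq_def using q0 by (intro conjI exI[of _ 1]) auto
    next
      case False
      then interpret odd_padic p by unfold_locales
      have "p \<noteq> q" "QuadRes (int p) (- int q)" using Bad_odd[OF q p False] by auto
      moreover have "\<not> int p dvd - int q" using \<open>p \<noteq> q\<close> prime_p S_props(4)[OF q] primes_dvd_imp_eq by auto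
      ultimately show ?thesis using psq_of_int[of "- int q"] by simp
    qed
  qed
qed

lemma twist_coeffs: "(of_int (a * D) :: rat) = of_int a * of_int D" "(of_int (b * D\<^sup>2) :: rat) = of_int b * (of_int D)\<^sup>2"
  by simp_all

lemma twist_nz: "b * D\<^sup>2 \<noteq> 0" "(a * D)\<^sup>2 - 4 * (b * D\<^sup>2) \<noteq> 0"
proof -
  have D0: "D \<noteq> 0" using S_props(6) by simp
  then show "b * D\<^sup>2 \<noteq> 0" using nz by simp
  have "(a * D)\<^sup>2 - 4 * (b * D\<^sup>2) = (a\<^sup>2 - 4 * b) * D\<^sup>2" by (simp add: power_mult_distrib algebra_simps)
  then show "(a * D)\<^sup>2 - 4 * (b * D\<^sup>2) \<noteq> 0" using nz D0 by simp
qed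

lemma val_d:
  assumes "Factorial_Ring.prime p" shows "padic_val p (of_int D) = (if p \<in> S then 1 else 0)"
proof -
  interpret padic p using assms by unfold_locales
  have d0: "int d \<noteq> 0" using S_props(6) by simp
  have vd: "v (of_int D) = int (multiplicity (int p) (int d))" using padic_val_of_int[OF d0] by simp
  show ?thesis
  proof (cases "p \<in> S")
    case True
    have e: "d = p * \<Prod>(S - {p})" using prod.remove[OF S_props(1) True, of "\<lambda>x. x"] prod_S by simp
    have nd: "\<not> p dvd \<Prod>(S - {p})"
    proof
      assume "p dvd \<Prod>(S - {p})"
      then obtain q where "q \<in> S - {p}" "p dvd q" using S_props(1) assms by (auto simp: prime_dvd_prod_iff)
      then show False using primes_dvd_imp_eq[OF assms S_props(4)] by auto
    qed
    define m where "m = \<Prod>(S - {p})"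
    have m: "\<not> int p dvd int m" "m \<noteq> 0" using nd unfolding m_def[symmetric] by (auto intro: Nat.gr0I)
    then have "multiplicity (int p) (int m) = 0" by (intro not_dvd_imp_multiplicity_0)
    then have "multiplicity (int p) (int p * int m) = 1"
      using multiplicity_int_mult[of "int p" "int m"] prime_int_p p_gt_1 m by (simp add: multiplicity_prime)
    moreover have "int d = int p * int m" using e unfolding m_def by (metis of_nat_mult)
    ultimately show ?thesis using vd True by simp
  next
    case False
    then have "\<not> int p dvd int d" using S_props(7)[OF assms] by simp
    then show ?thesis using vd False by (simp add: not_dvd_imp_multiplicity_0)
  qed
qed

text \<open>The good model differs from the given coefficients by the square u^2, which
  \<open>ptors_scale\<close> removes. Away from S the number D is a unit, so the twisted
  coefficients are good as well. Finally b and a^2 - 4b are units times u^4.\<close>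

lemma good_local:
  assumes p: "Factorial_Ring.prime p" "p \<notin> Bad" and \<alpha>: "\<alpha> \<noteq> 0"
  shows "padic.ptors p \<alpha> (of_int a) (of_int b) \<longleftrightarrow> even (padic_val p \<alpha>)"
    "p \<notin> S \<Longrightarrow> padic.ptors p \<alpha> (of_int (a * D)) (of_int (b * D\<^sup>2)) \<longleftrightarrow> even (padic_val p \<alpha>)"
    "even (padic_val p (of_int b))" "even (padic_val p (of_int (a\<^sup>2 - 4 * b)))"
proof -
  interpret odd_padic p by (rule not_Bad[OF p])
  obtain u a' b' where u: "u \<noteq> 0" and ab: "of_int a = a' * u\<^sup>2" "of_int b = b' * (u\<^sup>2)\<^sup>2"
    and N': "N a' \<le> 1" "N b' = 1" "N (a'\<^sup>2 - 4 * b') = 1"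
    using good_reduction_model[OF nz not_Bad(2)[OF p]] by blast
  have u2: "psq (u\<^sup>2)" using u by simp
  show "ptors \<alpha> (of_int a) (of_int b) \<longleftrightarrow> even (v \<alpha>)"
    unfolding ab ptors_scale[OF u2] using good_ptors_iff[OF \<alpha> N'] .
  show "ptors \<alpha> (of_int (a * D)) (of_int (b * D\<^sup>2)) \<longleftrightarrow> even (v \<alpha>)" if "p \<notin> S"
  proof -
    have ND: "N (of_int D) = 1" using val_d[OF p(1)] that S_props(6) unfolding N_eq_1_iff by simp
    have e: "(of_int (a * D) :: rat) = (a' * of_int D) * u\<^sup>2" "(of_int (b * D\<^sup>2) :: rat) = (b' * (of_int D)\<^sup>2) * (u\<^sup>2)\<^sup>2"
      unfolding twist_coeffs ab by (simp_all add: mult_ac)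
    have "(a' * of_int D)\<^sup>2 - 4 * (b' * (of_int D)\<^sup>2) = (a'\<^sup>2 - 4 * b') * (of_int D)\<^sup>2" by (simp add: power_mult_distrib algebra_simps)
    then have "N ((a' * of_int D)\<^sup>2 - 4 * (b' * (of_int D)\<^sup>2)) = 1" using ND N' by (simp only: N_mult N_power) simp
    then show ?thesis unfolding e ptors_scale[OF u2] using N' ND by (intro good_ptors_iff[OF \<alpha>]) (simp_all add: N_mult N_power)
  qed
  have b0: "b' \<noteq> 0" "v b' = 0" "a'\<^sup>2 - 4 * b' \<noteq> 0" "v (a'\<^sup>2 - 4 * b') = 0" using N' N_eq_1_iff by auto
  show "even (v (of_int b))" unfolding ab using b0 u by (simp add: padic_val_power)
  have "of_int (a\<^sup>2 - 4 * b) = (a'\<^sup>2 - 4 * b') * (u\<^sup>2)\<^sup>2" using ab by (simp add: power_mult_distrib algebra_simps)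
  then show "even (v (of_int (a\<^sup>2 - 4 * b)))" using b0 u by (simp add: padic_val_power)
qed

lemma twist_local_iff:
  assumes p: "Factorial_Ring.prime p" "p \<notin> S" and \<alpha>: "\<alpha> \<noteq> 0"
  shows "padic.ptors p \<alpha> (of_int (a * D)) (of_int (b * D\<^sup>2)) \<longleftrightarrow> padic.ptors p \<alpha> (of_int a) (of_int b)"
proof (cases "p \<in> Bad")
  case True
  interpret padic p using p by unfold_locales
  show ?thesis unfolding twist_coeffs using ptors_scale[OF minus_d_psq[OF True]] .
next
  case False
  then show ?thesis using good_local[OF p(1) False \<alpha>] p(2) by blast
qed

text \<open>That -q is a square modulo p means that the symbols of q and of -1 at p agree. As (q -
  1)/2 is odd, the sign in the reciprocity law is again the symbol of -1 at p, and the two signs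
  cancel.\<close>

lemma Legendre_Bad:
  assumes q: "q \<in> S" and p: "p \<in> Bad" shows "Legendre (int p) (int q) = 1"
proof (cases "p = 2")
  case True
  then show ?thesis using Legendre_2[OF S_props(4)[OF q] S_mod_8[OF q]] by simp
next
  case False
  have pp: "Factorial_Ring.prime p" using p by (simp add: Bad_def)
  interpret Q: odd_padic q by (rule S_odd_padic[OF q])
  interpret P: odd_padic p using pp False by unfold_locales
  have ne: "p \<noteq> q" and qr: "QuadRes (int p) (- int q)" using Bad_odd[OF q p False] by auto
  have nd: "\<not> int p dvd - int q" using ne pp S_props(4)[OF q] primes_dvd_imp_eq by auto
  have "Legendre (- int q) (int p) = 1" using qr nd by (simp add: Legendre_def cong_0_iff)
  then have "Legendre (- 1) (int p) * Legendre (int q) (int p) = 1" using P.Legendre_mult[of "- 1" "int q"] by simp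
  then have 1: "(- 1) ^ ((p - 1) div 2) * Legendre (int q) (int p) = 1" unfolding Legendre_minus_one[OF P.odd_padic_axioms] .
  have p2: "2 < p" "2 < q" using P.p_gt_1 P.p_ne_2 Q.p_gt_1 Q.p_ne_2 by linarith+
  have 2: "Legendre (int p) (int q) * Legendre (int q) (int p) = (- 1) ^ ((p - 1) div 2 * ((q - 1) div 2))"
    using Quadratic_Reciprocity[OF pp p2(1) S_props(4)[OF q] p2(2) ne] .
  have "odd ((q - 1) div 2)" using S_mod_8[OF q] by presburger
  then have "(- 1 :: int) ^ ((p - 1) div 2 * ((q - 1) div 2)) = (- 1) ^ ((p - 1) div 2)"
    by (cases "even ((p - 1) div 2)") auto
  with 2 have 3: "Legendre (int p) (int q) * Legendre (int q) (int p) = (- 1) ^ ((p - 1) div 2)" by (simp only:)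
  have "(- 1 :: int) ^ ((p - 1) div 2) = 1 \<or> (- 1 :: int) ^ ((p - 1) div 2) = - 1"
    by (cases "even ((p - 1) div 2)") auto
  then show ?thesis
  proof
    assume e: "(- 1 :: int) ^ ((p - 1) div 2) = 1"
    show ?thesis using 1 3 unfolding e by simp
  next
    assume e: "(- 1 :: int) ^ ((p - 1) div 2) = - 1"
    have "Legendre (int q) (int p) = - 1" using 1 unfolding e by linarith
    then show ?thesis using 3 unfolding e by simp
  qed
qed

text \<open>Up to a square, r is a positive integer. Its prime factors in \<open>Bad\<close> are
  squares in Q_q by reciprocity, and all others occur to an even power.\<close>

lemma psq_S_of_even:
  assumes q: "q \<in> S" and r: "r > 0" "\<And>p. Factorial_Ring.prime p \<Longrightarrow> p \<notin> Bad \<Longrightarrow> even (padic_val p r)"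
  shows "padic.psq q r"
proof -
  interpret Q: odd_padic q by (rule S_odd_padic[OF q])
  obtain m n where mn: "quotient_of r = (m, n)" by fastforce
  have n: "n > 0" and rr: "r = of_int m / of_int n"
    using quotient_of_denom_pos[OF mn] quotient_of_div[OF mn] by auto
  have m: "m > 0" using r(1) n unfolding rr by (simp add: zero_less_divide_iff)
  define k where "k = nat (m * n)"
  have k: "int k = m * n" "k > 0" using m n by (auto simp: k_def)
  have rk: "(of_nat k :: rat) = r * (of_int n)\<^sup>2"
  proof -
    have "(of_nat k :: rat) = of_int (int k)" by simp
    also have "\<dots> = r * (of_int n)\<^sup>2" unfolding k(1) rr using n by (simp add: power2_eq_square)
    finally show ?thesis .
  qed
  have "Q.psq (of_nat (\<Prod>p\<in>prime_factors k. p ^ multiplicity p k))"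
    unfolding of_nat_prod
  proof (rule Q.psq_prod)
    fix p assume "p \<in> prime_factors k"
    then have pp: "Factorial_Ring.prime p" by auto
    interpret P: padic p using pp by unfold_locales
    show "Q.psq (of_nat (p ^ multiplicity p k))"
    proof (cases "p \<in> Bad")
      case True
      have "Legendre (int p) (int q) = 1" by (rule Legendre_Bad[OF q True])
      moreover have "\<not> int q dvd int p" using pp S_props(4)[OF q] S_not_Bad[OF q] True primes_dvd_imp_eq by auto
      ultimately have "Q.psq (of_nat p)" using Q.psq_Legendre[of "int p"] by simp
      then show ?thesis using Q.psq_prod[of "{..<multiplicity p k}" "\<lambda>_. of_nat p"] by simp
    next
      case False
      have "P.v (of_nat k) = P.v r + 2 * P.v (of_int n)" unfolding rk using r n by (simp add: P.padic_val_power)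
      then have "even (P.v (of_nat k))" using r(2)[OF pp False] by simp
      moreover have "P.v (of_nat k) = int (multiplicity (int p) (int k))" using P.padic_val_of_int[of "int k"] k(2) by simp
      moreover have "multiplicity (int p) (int k) = multiplicity p k"
      proof (rule multiplicity_eqI)
        have "p ^ multiplicity p k dvd k" by (rule multiplicity_dvd)
        then show "int p ^ multiplicity p k dvd int k" by (metis int_dvd_int_iff of_nat_power)
        have "\<not> p ^ Suc (multiplicity p k) dvd k"
        proof
          assume "p ^ Suc (multiplicity p k) dvd k"
          then have "Suc (multiplicity p k) \<le> multiplicity p k"
            by (rule multiplicity_geI[rotated 2]) (use k(2) P.p_gt_1 in auto)
          then show False by simp
        qed
        then show "\<not> int p ^ Suc (multiplicity p k) dvd int k" by (metis int_dvd_int_iff of_nat_power)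
      qed
      ultimately have "even (multiplicity p k)" by simp
      then obtain j where "multiplicity p k = j * 2" by (metis evenE mult.commute)
      then have "(of_nat (p ^ multiplicity p k) :: rat) = (of_nat p ^ j)\<^sup>2" by (simp add: power_mult)
      then show ?thesis using P.p_gt_1 by simp
    qed
  qed simp
  then have "Q.psq (of_nat k)" using prime_factorization_nat[OF k(2)] by simp
  then show ?thesis unfolding rk using n by simp
qed

lemma minus_one_nonsq: assumes "q \<in> S" shows "\<not> padic.psq q (- 1)"
proof -
  interpret Q: odd_padic q by (rule S_odd_padic[OF assms])
  have "odd ((q - 1) div 2)" using S_mod_8[OF assms] by presburger
  then have "Legendre (- 1) (int q) = - 1" unfolding Legendre_minus_one[OF Q.odd_padic_axioms] by simp
  then show ?thesis using Q.psq_Legendre[of "- 1"] Q.p_gt_1 by auto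
qed

text \<open>For negative k the number -k is a square in Q_q while -1 is not: the prime q detects the
  sign.\<close>

lemma psq_S_iff_pos:
  assumes q: "q \<in> S" and k: "k \<noteq> 0" "\<And>p. Factorial_Ring.prime p \<Longrightarrow> p \<notin> Bad \<Longrightarrow> even (padic_val p (of_int k))"
  shows "padic.psq q (of_int k) \<longleftrightarrow> k > 0"
proof -
  interpret Q: odd_padic q by (rule S_odd_padic[OF q])
  show ?thesis
  proof (cases "k > 0")
    case True
    then show ?thesis using psq_S_of_even[OF q, of "of_int k"] k by simp
  next
    case False
    have "Q.psq (- of_int k)"
    proof (rule psq_S_of_even[OF q])
      fix p assume p: "Factorial_Ring.prime p" "p \<notin> Bad"
      interpret P: padic p using p by unfold_locales
      show "even (padic_val p (- of_int k))" using k(2)[OF p] by simp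
    qed (use False k in simp)
    then have "Q.psq (of_int k) \<Longrightarrow> Q.psq ((- 1) * (of_int k)\<^sup>2)"
      using Q.psq_mult[of "of_int k" "- of_int k"] by (simp add: power2_eq_square)
    then show ?thesis using False k(1) minus_one_nonsq[OF q] Q.psq_mult_square[of "of_int k" "- 1"] by auto
  qed
qed

lemma psq_S_b: "q \<in> S \<Longrightarrow> padic.psq q (of_int b) \<longleftrightarrow> b > 0"
  using psq_S_iff_pos nz good_local(3)[where \<alpha> = 1] by simp

lemma psq_S_disc: "q \<in> S \<Longrightarrow> padic.psq q (of_int (a\<^sup>2 - 4 * b)) \<longleftrightarrow> a\<^sup>2 - 4 * b > 0"
proof -
  assume q: "q \<in> S"
  have "even (padic_val p (of_int (a\<^sup>2 - 4 * b)))" if "Factorial_Ring.prime p" "p \<notin> Bad" for p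
    using good_local(4)[OF that, of 1] by simp
  then show ?thesis by (rule psq_S_iff_pos[OF q nz(2)])
qed

end

section \<open>The local image of the twist at primes dividing d\<close>

context admissible_twist begin

text \<open>Passes to the good model at q and trades the squareness of b' and a'^2 - 4b' for the
  signs of b and a^2 - 4b, which select the applicable description of the twisted image.\<close>

lemma S_model:
  assumes q: "q \<in> S"
  shows "\<exists>u a' b'. u \<noteq> 0 \<and> of_int a = a' * u\<^sup>2 \<and> of_int b = b' * (u\<^sup>2)\<^sup>2 \<and>
    padic_abs q a' \<le> 1 \<and> padic_abs q b' = 1 \<and> padic_abs q (a'\<^sup>2 - 4 * b') = 1 \<and>
    (padic.psq q b' \<longleftrightarrow> b > 0) \<and> (padic.psq q (a'\<^sup>2 - 4 * b') \<longleftrightarrow> a\<^sup>2 - 4 * b > 0) \<and>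
    (\<forall>\<alpha>. padic.ptors q \<alpha> (of_int (a * D)) (of_int (b * D\<^sup>2)) \<longleftrightarrow> padic.ptors q \<alpha> (a' * of_int D) (b' * (of_int D)\<^sup>2))"
proof -
  interpret odd_padic q by (rule S_odd_padic[OF q])
  note p = S_props(4)[OF q] S_not_Bad[OF q]
  obtain u a' b' where u: "u \<noteq> 0" and ab: "of_int a = a' * u\<^sup>2" "of_int b = b' * (u\<^sup>2)\<^sup>2"
    and N': "N a' \<le> 1" "N b' = 1" "N (a'\<^sup>2 - 4 * b') = 1"
    using good_reduction_model[OF nz not_Bad(2)[OF p]] by blast
  have u2: "u\<^sup>2 \<noteq> 0" "psq (u\<^sup>2)" using u by auto
  have e: "(of_int (a * D) :: rat) = (a' * of_int D) * u\<^sup>2" "(of_int (b * D\<^sup>2) :: rat) = (b' * (of_int D)\<^sup>2) * (u\<^sup>2)\<^sup>2"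
    unfolding twist_coeffs ab by (simp_all add: mult_ac)
  have B: "of_int (a\<^sup>2 - 4 * b) = (a'\<^sup>2 - 4 * b') * (u\<^sup>2)\<^sup>2" using ab by (simp add: power_mult_distrib algebra_simps)
  have 1: "psq b' \<longleftrightarrow> b > 0" using psq_S_b[OF q] psq_mult_square[OF u2(1), of b'] unfolding ab by blast
  have 2: "psq (a'\<^sup>2 - 4 * b') \<longleftrightarrow> a\<^sup>2 - 4 * b > 0"
    using psq_S_disc[OF q] psq_mult_square[OF u2(1), of "a'\<^sup>2 - 4 * b'"] unfolding B by blast
  have 3: "ptors \<alpha> (of_int (a * D)) (of_int (b * D\<^sup>2)) \<longleftrightarrow> ptors \<alpha> (a' * of_int D) (b' * (of_int D)\<^sup>2)" for \<alpha>
    unfolding e by (rule ptors_scale[OF u2(2)])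
  show ?thesis using u ab N' 1 2 3 by (intro exI[of _ u] exI[of _ a'] exI[of _ b'] conjI allI)
qed

lemma D_S:
  assumes "q \<in> S" shows "(of_int D :: rat) \<noteq> 0" "odd (padic_val q (of_int D))"
  using val_d[OF S_props(4)[OF assms]] assms S_props(6) by auto

lemma twist_local_S_neg:
  assumes "q \<in> S" "b < 0" "\<alpha> \<noteq> 0" "padic.ptors q \<alpha> (of_int (a * D)) (of_int (b * D\<^sup>2))"
  shows "even (padic_val q \<alpha>)"
proof -
  interpret odd_padic q by (rule S_odd_padic[OF assms(1)])
  obtain a' b' where "N b' = 1" "psq b' \<longleftrightarrow> b > 0" "ptors \<alpha> (a' * of_int D) (b' * (of_int D)\<^sup>2)"
    using S_model[OF assms(1)] assms(4) by blast
  then show ?thesis using twist_ptors_even[of \<alpha> a' "of_int D" b'] assms D_S[OF assms(1)] by auto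
qed

lemma twist_local_S_all:
  assumes "q \<in> S" "b > 0" "a\<^sup>2 - 4 * b < 0" "\<alpha> \<noteq> 0"
  shows "padic.ptors q \<alpha> (of_int (a * D)) (of_int (b * D\<^sup>2))"
proof -
  interpret odd_padic q by (rule S_odd_padic[OF assms(1)])
  obtain u a' b' where m: "N a' \<le> 1" "N b' = 1" "N (a'\<^sup>2 - 4 * b') = 1"
    "psq b' \<longleftrightarrow> b > 0" "psq (a'\<^sup>2 - 4 * b') \<longleftrightarrow> a\<^sup>2 - 4 * b > 0"
    "\<forall>\<alpha>. ptors \<alpha> (of_int (a * D)) (of_int (b * D\<^sup>2)) \<longleftrightarrow> ptors \<alpha> (a' * of_int D) (b' * (of_int D)\<^sup>2)"
    using S_model[OF assms(1)] by blast
  have "psq b'" "\<not> psq (a'\<^sup>2 - 4 * b')" using m(4,5) assms by auto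
  then show ?thesis unfolding m(6)[rule_format] by (rule twist_ptors_all[OF assms(4) D_S[OF assms(1)] m(1-3)])
qed

text \<open>A rational approximation \<open>t\<close> of the root \<open>\<beta>\<^sub>q\<close> lying in the same square class.\<close>

lemma root_approx:
  assumes q: "q \<in> S" and pos: "b > 0" "a\<^sup>2 - 4 * b > 0" and \<beta>: "root_family a b d \<beta>"
  shows "\<exists>t. t \<noteq> 0 \<and> even (padic_val q t) \<and>
    hilbert_symbol (padic_field q) (\<beta> q) (padic_of_rat q (of_nat q)) = (if padic.psq q t then 1 else - 1) \<and>
    (\<forall>\<alpha>. \<alpha> \<noteq> 0 \<longrightarrow> (padic.ptors q \<alpha> (of_int (a * D)) (of_int (b * D\<^sup>2)) \<longleftrightarrow>
      padic.psq q \<alpha> \<or> padic.psq q (\<alpha> * of_int D * t)))"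
proof -
  interpret odd_padic q by (rule S_odd_padic[OF q])
  obtain u a' b' where u: "u \<noteq> 0" and ab: "of_int a = a' * u\<^sup>2" "of_int b = b' * (u\<^sup>2)\<^sup>2"
    and m: "N a' \<le> 1" "N b' = 1" "N (a'\<^sup>2 - 4 * b') = 1"
    "psq b' \<longleftrightarrow> b > 0" "psq (a'\<^sup>2 - 4 * b') \<longleftrightarrow> a\<^sup>2 - 4 * b > 0"
    "\<forall>\<alpha>. ptors \<alpha> (of_int (a * D)) (of_int (b * D\<^sup>2)) \<longleftrightarrow> ptors \<alpha> (a' * of_int D) (b' * (of_int D)\<^sup>2)"
    using S_model[OF q] by blast
  have root: "\<beta> q \<in> carrier Qp" "\<beta> q \<otimes>\<^bsub>Qp\<^esub> \<beta> q \<oplus>\<^bsub>Qp\<^esub> padic_of_rat q (of_int (- 2 * a)) \<otimes>\<^bsub>Qp\<^esub> \<beta> q \<oplus>\<^bsub>Qp\<^esub>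
      padic_of_rat q (of_int (a\<^sup>2 - 4 * b)) = \<zero>\<^bsub>Qp\<^esub>"
    using \<beta> q unfolding root_family_def S_def by auto
  obtain s where s: "pcauchy s" "\<beta> q = cls s" using root(1) by (rule Qp_cases)
  have "cls (\<lambda>n. s n * s n + of_int (- 2 * a) * s n + of_int (a\<^sup>2 - 4 * b)) = cls (\<lambda>_. 0)"
    using root(2) unfolding s(2) padic_of_rat_eq cls_zero
    by (simp only: cls_mult cls_add s pcauchy_const pcauchy_mult pcauchy_add)
  then have "pnull (\<lambda>n. s n * s n + of_int (- 2 * a) * s n + of_int (a\<^sup>2 - 4 * b) - 0)"
    by (subst (asm) cls_eq_iff, (intro pcauchy_intros s(1))+)
  then have null: "pnull (\<lambda>n. (s n - of_int a)\<^sup>2 - 4 * of_int b)"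
    by (simp add: power2_eq_square algebra_simps)
  have u4: "N ((u\<^sup>2)\<^sup>2) > 0" "N (u\<^sup>2) > 0" using u by auto
  \<comment> \<open>The bounds |u|^4 and |u|^2 become the bound 1 after division by the scaling
    factors of the good model.\<close>
  obtain M1 where M1: "\<forall>n\<ge>M1. N ((s n - of_int a)\<^sup>2 - 4 * of_int b) < N ((u\<^sup>2)\<^sup>2)"
    using pnullD[OF null u4(1)] by blast
  obtain M2 where M2: "\<forall>m\<ge>M2. \<forall>n\<ge>M2. N (s m - s n) < N (u\<^sup>2)"
    using s(1) u4(2) unfolding pcauchy_def by blast
  define n where "n = max M1 M2"
  define t where "t = s n"
  \<comment> \<open>The roots are a + 2 sqrt(b) for the two choices of sqrt(b), so after scaling r
    approximates a square root of b'.\<close>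
  define r where "r = (t / u\<^sup>2 - a') / 2"
  have tr: "t = (a' + 2 * r) * u\<^sup>2" using u by (simp add: r_def field_simps)
  have "(t - of_int a)\<^sup>2 - 4 * of_int b = (4 * (u\<^sup>2)\<^sup>2) * (r\<^sup>2 - b')"
    unfolding ab tr by (simp add: power2_eq_square algebra_simps)
  then have "N ((t - of_int a)\<^sup>2 - 4 * of_int b) = N ((u\<^sup>2)\<^sup>2) * N (r\<^sup>2 - b')"
    by (simp only: N_mult N_4 mult_1_left)
  moreover have "N ((t - of_int a)\<^sup>2 - 4 * of_int b) < N ((u\<^sup>2)\<^sup>2)" using M1 by (simp add: t_def n_def)
  ultimately have "N ((u\<^sup>2)\<^sup>2) * N (r\<^sup>2 - b') < N ((u\<^sup>2)\<^sup>2) * 1" by simp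
  then have r: "N (r\<^sup>2 - b') < 1" using u4(1) by (simp only: mult_less_cancel_left_pos)
  have psqs: "psq b'" "psq (a'\<^sup>2 - 4 * b')" using m(4,5) pos by auto
  have "a' + 2 * r \<noteq> 0 \<and> v (a' + 2 * r) = 0"
  proof -
    have Nr2: "N (r\<^sup>2) = 1" using N_eq_of_close[of "r\<^sup>2" b'] r m(2) by simp
    then have "(N r)\<^sup>2 = 1" by (simp add: N_power)
    then have Nr: "N r = 1" using N_nonneg[of r] by (simp add: power2_eq_1_iff)
    have "(a' + 2 * r) * (a' - 2 * r) - (a'\<^sup>2 - 4 * b') = - (4 * (r\<^sup>2 - b'))"
      by (simp add: power2_eq_square algebra_simps)
    then have "N ((a' + 2 * r) * (a' - 2 * r) - (a'\<^sup>2 - 4 * b')) = N (r\<^sup>2 - b')"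
      by (simp only: N_minus N_mult N_4 mult_1_left)
    then have "N ((a' + 2 * r) * (a' - 2 * r)) = 1"
      using N_eq_of_close[of "(a' + 2 * r) * (a' - 2 * r)" "a'\<^sup>2 - 4 * b'"] r m(3) by simp
    then have prod: "N (a' + 2 * r) * N (a' - 2 * r) = 1" by (simp only: N_mult)
    have "N (a' + 2 * r) \<le> 1" "N (a' - 2 * r) \<le> 1"
      using m(1) Nr by (auto intro!: N_add_le N_diff_le simp: N_mult)
    then have "N (a' + 2 * r) = 1"
      using prod mult_left_le[of "N (a' - 2 * r)" "N (a' + 2 * r)"] N_nonneg[of "a' + 2 * r"] by linarith
    then show ?thesis using N_eq_1_iff by blast
  qed
  then have t: "t \<noteq> 0" "even (v t)" "N t = N (u\<^sup>2)"
    unfolding tr using u N_eq_1_iff[of "a' + 2 * r"] by (auto simp: padic_val_power N_mult)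
  have near: "N (s k - t) < N t" if "k \<ge> n" for k
    using M2 that unfolding t(3) by (simp add: t_def n_def)
  have 1: "hilbert_symbol Qp (\<beta> q) (padic_of_rat q (of_nat q)) = (if psq t then 1 else - 1)"
    unfolding s(2) by (rule hilbert_symbol_iff[OF s(1) t(1,2) near])
  have 2: "ptors \<alpha> (of_int (a * D)) (of_int (b * D\<^sup>2)) \<longleftrightarrow> psq \<alpha> \<or> psq (\<alpha> * of_int D * t)" if "\<alpha> \<noteq> 0" for \<alpha>
  proof -
    have "\<alpha> * of_int D * t = \<alpha> * of_int D * (a' + 2 * r) * u\<^sup>2" unfolding tr by (simp only: mult.assoc)
    then have "psq (\<alpha> * of_int D * t) \<longleftrightarrow> psq (\<alpha> * of_int D * (a' + 2 * r))"
      by (simp only: psq_mult_square[OF u])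
    then show ?thesis
      unfolding m(6)[rule_format] twist_ptors_split[OF that D_S[OF q] m(1-3) psqs(2) r] by blast
  qed
  show ?thesis using t(1,2) 1 2 by blast
qed

lemma T_minus_iff: "q \<in> S \<Longrightarrow> q \<in> T_minus d \<beta> \<longleftrightarrow> q \<notin> T_plus d \<beta>"
  unfolding T_minus_def T_plus_def S_def by blast

text \<open>Let e = d/q, let t approximate the root and let x be the unit part of \<alpha>. For even
  valuation the condition says that x is a square. For odd valuation it says that -x e t is a
  square; as -1 is a nonsquare, this means that x is a square exactly when the classes of e and t
  differ. They differ on \<open>T_plus\<close>, where the condition is gamma = 0 for either parity,
  and agree on \<open>T_minus\<close>, where gamma has to equal lambda.\<close>

lemma twist_local_S_split:
  assumes q: "q \<in> S" and pos: "b > 0" "a\<^sup>2 - 4 * b > 0" and \<beta>: "root_family a b d \<beta>" and \<alpha>: "\<alpha> \<noteq> 0"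
  shows "padic.ptors q \<alpha> (of_int (a * D)) (of_int (b * D\<^sup>2)) \<longleftrightarrow>
    (if q \<in> T_plus d \<beta> then gamma_val q (sqcls \<alpha>) = 0 else gamma_val q (sqcls \<alpha>) + lambda_val q (sqcls \<alpha>) = 0)"
proof -
  interpret odd_padic q by (rule S_odd_padic[OF q])
  obtain t where t: "t \<noteq> 0" "even (v t)"
    and hil: "hilbert_symbol Qp (\<beta> q) (padic_of_rat q (of_nat q)) = (if psq t then 1 else - 1)"
    and loc: "\<forall>\<alpha>. \<alpha> \<noteq> 0 \<longrightarrow> (ptors \<alpha> (of_int (a * D)) (of_int (b * D\<^sup>2)) \<longleftrightarrow> psq \<alpha> \<or> psq (\<alpha> * of_int D * t))"
    using root_approx[OF q pos \<beta>] by blast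
  define x where "x = \<alpha> / of_nat q powi v \<alpha>"
  define e where "e = d div q"
  have de: "d = q * e" using S_props(7)[OF S_props(4)[OF q]] q by (simp add: e_def)
  have q0: "(of_nat q :: rat) \<noteq> 0" using p_gt_1 by simp
  have e0: "(of_nat e :: rat) \<noteq> 0" using de S_props(6) by auto
  have "v (of_int D) = 1" using val_d[OF S_props(4)[OF q]] q by simp
  moreover have "(of_int D :: rat) = - (of_nat q * of_nat e)" using de by (metis of_int_minus of_int_of_nat_eq of_nat_mult)
  ultimately have ve: "v (of_nat e) = 0" using q0 e0 by simp
  have "\<not> int q dvd int e" using ve e0 N_of_int_eq_1_iff[of "int e"] N_eq_1_iff[of "of_nat e"] by simp
  then have Le: "Legendre (int e) (int q) = (if psq (of_nat e) then 1 else - 1)"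
    using psq_Legendre[of "int e"] by (auto simp: Legendre_def cong_0_iff)
  have Tp: "q \<in> T_plus d \<beta> \<longleftrightarrow> (psq (of_nat e) \<noteq> psq t)"
  proof -
    have "q \<in> T_plus d \<beta> \<longleftrightarrow> Legendre (int e) (int q) \<noteq> hilbert_symbol Qp (\<beta> q) (padic_of_rat q (of_nat q))"
      using q by (simp add: T_plus_def S_def e_def)
    then show ?thesis unfolding hil Le by auto
  qed
  have Nx: "N x = 1" unfolding x_def by (rule unit_part[OF \<alpha>])
  then have x0: "x \<noteq> 0" "v x = 0" using N_eq_1_iff by auto
  have n1: "\<not> psq (- 1)" by (rule minus_one_nonsq[OF q])
  have tw: "psq (\<alpha> * of_int D * t) \<longleftrightarrow> odd (v \<alpha>) \<and> (psq x \<noteq> (psq (of_nat e) = psq t))"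
  proof (cases "odd (v \<alpha>)")
    case True
    then obtain k where k: "v \<alpha> = k + k + 1" by (metis oddE mult_2)
    have pw: "(of_nat q :: rat) powi v \<alpha> = of_nat q powi k * of_nat q powi k * of_nat q"
      unfolding k by (simp only: power_int_add[OF disjI1[OF q0]] power_int_1_right)
    have \<alpha>x: "\<alpha> = x * (of_nat q powi k * of_nat q powi k * of_nat q)" unfolding x_def pw[symmetric] using q0 by simp
    have "\<alpha> * of_int D * t = ((- 1) * (x * (of_nat e * t))) * (of_nat q powi k * of_nat q)\<^sup>2"
      unfolding \<open>(of_int D :: rat) = - (of_nat q * of_nat e)\<close> by (subst \<alpha>x) (simp add: power2_eq_square mult_ac)
    moreover have "of_nat q powi k * of_nat q \<noteq> (0 :: rat)" using q0 by simp
    ultimately have "psq (\<alpha> * of_int D * t) \<longleftrightarrow> psq ((- 1) * (x * (of_nat e * t)))"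
      by (simp only: psq_mult_square not_False_eq_True)
    also have "\<dots> \<longleftrightarrow> (psq (- 1) \<longleftrightarrow> psq (x * (of_nat e * t)))"
      using x0 e0 t ve by (intro psq_even_mult) auto
    also have "\<dots> \<longleftrightarrow> \<not> psq (x * (of_nat e * t))" using n1 by simp
    also have "psq (x * (of_nat e * t)) \<longleftrightarrow> (psq x \<longleftrightarrow> psq (of_nat e * t))"
      using x0 e0 t ve by (intro psq_even_mult) auto
    also have "psq (of_nat e * t) \<longleftrightarrow> (psq (of_nat e) \<longleftrightarrow> psq t)"
      using e0 t ve by (intro psq_even_mult) auto
    finally show ?thesis using True by blast
  next
    case False
    have "odd (v (\<alpha> * of_int D * t))" using False \<alpha> D_S[OF q] t by simp
    then show ?thesis using psq_even False by blast
  qed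
  have sq: "psq \<alpha> \<longleftrightarrow> even (v \<alpha>) \<and> psq x" unfolding x_def by (rule psq_unit_part[OF \<alpha>])
  have g: "gamma_val q (sqcls \<alpha>) = (if psq x then 0 else 1)" unfolding x_def by (rule gamma_val_sqcls[OF \<alpha>])
  have l: "lambda_val q (sqcls \<alpha>) = (if even (v \<alpha>) then 0 else 1)"
    unfolding lambda_val_sqcls[OF \<alpha>] using of_int_bit_eq_0_iff[of "v \<alpha>"] by (cases "of_int (v \<alpha>) :: bit") auto
  show ?thesis unfolding loc[rule_format, OF \<alpha>] tw sq g l Tp by auto
qed

section \<open>Selmer groups in terms of torsors and valuations\<close>

lemma local_condition_at:
  assumes "Factorial_Ring.prime p" "\<alpha> \<noteq> 0" "b' \<noteq> 0" "a'\<^sup>2 - 4 * b' \<noteq> 0"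
  shows "local_condition (padic_field p) (padic_of_rat p) a' b' (sqcls \<alpha>) \<longleftrightarrow> padic.ptors p \<alpha> (of_int a') (of_int b')"
proof -
  interpret padic p using assms by unfold_locales
  show ?thesis by (rule local_condition_padic[OF assms(3,4,2)])
qed

lemma sqcls_carrier: "\<alpha> \<noteq> 0 \<Longrightarrow> sqcls \<alpha> \<in> carrier (square_classes rat_field)"
  using carrier_square_classes by blast

text \<open>At primes dividing d the untwisted curve has good reduction, so its condition there is
  even valuation; this is the origin of the kernels of lambda.\<close>

lemma selmer_iff:
  assumes "\<alpha> \<noteq> 0"
  shows "sqcls \<alpha> \<in> selmer a b \<longleftrightarrow> (\<alpha> > 0 \<or> b > 0 \<and> (a \<le> 0 \<or> a\<^sup>2 \<le> 4 * b)) \<and>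
    (\<forall>p. Factorial_Ring.prime p \<and> p \<notin> S \<longrightarrow> padic.ptors p \<alpha> (of_int a) (of_int b)) \<and>
    (\<forall>q\<in>S. even (padic_val q \<alpha>))"
proof -
  have "padic.ptors q \<alpha> (of_int a) (of_int b) \<longleftrightarrow> even (padic_val q \<alpha>)" if "q \<in> S" for q
    using good_local(1)[OF S_props(4)[OF that] S_not_Bad[OF that] assms] .
  then show ?thesis
    unfolding selmer_def using sqcls_carrier[OF assms] local_condition_at[OF _ assms nz] local_condition_real[OF nz assms] S_props(4)
    by auto
qed

text \<open>Twisting by -d reverses the sign of a and preserves that of b and of a^2 - 4b. At the
  real place this exchanges a <= 0 with a >= 0, so positivity is imposed on opposite curves in cases
  (iii) and (iv).\<close>

lemma twist_selmer_iff:
  assumes "\<alpha> \<noteq> 0"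
  shows "sqcls \<alpha> \<in> twist_selmer (- int d) a b \<longleftrightarrow> (\<alpha> > 0 \<or> b > 0 \<and> (a \<ge> 0 \<or> a\<^sup>2 \<le> 4 * b)) \<and>
    (\<forall>p. Factorial_Ring.prime p \<and> p \<notin> S \<longrightarrow> padic.ptors p \<alpha> (of_int a) (of_int b)) \<and>
    (\<forall>q\<in>S. padic.ptors q \<alpha> (of_int (a * D)) (of_int (b * D\<^sup>2)))"
proof -
  have d: "int d > 0" using S_props(6) by simp
  then have d2: "(int d)\<^sup>2 > 0" by simp
  have "(a * D)\<^sup>2 \<le> 4 * (b * D\<^sup>2) \<longleftrightarrow> a\<^sup>2 * (int d)\<^sup>2 \<le> (4 * b) * (int d)\<^sup>2" by (simp add: power_mult_distrib mult.assoc)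
  also have "\<dots> \<longleftrightarrow> a\<^sup>2 \<le> 4 * b" using d2 by (simp only: mult_le_cancel_right_pos)
  finally have 1: "(a * D)\<^sup>2 \<le> 4 * (b * D\<^sup>2) \<longleftrightarrow> a\<^sup>2 \<le> 4 * b" .
  have 2: "b * D\<^sup>2 > 0 \<longleftrightarrow> b > 0" using d2 by (simp add: zero_less_mult_iff)
  have 3: "a * D \<le> 0 \<longleftrightarrow> a \<ge> 0" using d by (auto simp: mult_le_0_iff zero_le_mult_iff)
  have real: "local_condition real_field of_rat (a * D) (b * D\<^sup>2) (sqcls \<alpha>) \<longleftrightarrow> \<alpha> > 0 \<or> b > 0 \<and> (a \<ge> 0 \<or> a\<^sup>2 \<le> 4 * b)"
    unfolding local_condition_real[OF twist_nz assms] 1 2 3 ..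
  have loc: "local_condition (padic_field p) (padic_of_rat p) (a * D) (b * D\<^sup>2) (sqcls \<alpha>) \<longleftrightarrow>
      padic.ptors p \<alpha> (of_int (a * D)) (of_int (b * D\<^sup>2))" if "Factorial_Ring.prime p" for p
    by (rule local_condition_at[OF that assms twist_nz])
  have "sqcls \<alpha> \<in> twist_selmer D a b \<longleftrightarrow> (\<alpha> > 0 \<or> b > 0 \<and> (a \<ge> 0 \<or> a\<^sup>2 \<le> 4 * b)) \<and>
      (\<forall>p. Factorial_Ring.prime p \<longrightarrow> padic.ptors p \<alpha> (of_int (a * D)) (of_int (b * D\<^sup>2)))"
    unfolding twist_selmer_def selmer_def mem_Collect_eq real using sqcls_carrier[OF assms] loc by blast
  also have "(\<forall>p. Factorial_Ring.prime p \<longrightarrow> padic.ptors p \<alpha> (of_int (a * D)) (of_int (b * D\<^sup>2))) \<longleftrightarrow>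
    (\<forall>p. Factorial_Ring.prime p \<and> p \<notin> S \<longrightarrow> padic.ptors p \<alpha> (of_int a) (of_int b)) \<and>
    (\<forall>q\<in>S. padic.ptors q \<alpha> (of_int (a * D)) (of_int (b * D\<^sup>2)))"
    using twist_local_iff[OF _ _ assms] S_props(4) by blast
  finally show ?thesis .
qed

lemma relaxed_selmer_iff:
  assumes "\<alpha> \<noteq> 0"
  shows "sqcls \<alpha> \<in> relaxed_selmer d a b \<longleftrightarrow>
    (\<forall>p. Factorial_Ring.prime p \<and> p \<notin> S \<longrightarrow> padic.ptors p \<alpha> (of_int a) (of_int b))"
  unfolding relaxed_selmer_def mem_Collect_eq
  using sqcls_carrier[OF assms] local_condition_at[OF _ assms nz] S_props(7) by blast

lemma class_ker_iff: "\<alpha> \<noteq> 0 \<Longrightarrow> sqcls \<alpha> \<in> class_ker f \<longleftrightarrow> f (sqcls \<alpha>) = 0"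
  unfolding class_ker_def using sqcls_carrier by blast

lemma ker_lambda_iff: "\<alpha> \<noteq> 0 \<Longrightarrow> q \<in> S \<Longrightarrow> sqcls \<alpha> \<in> class_ker (lambda_val q) \<longleftrightarrow> even (padic_val q \<alpha>)"
proof -
  assume h: "\<alpha> \<noteq> 0" "q \<in> S"
  interpret odd_padic q by (rule S_odd_padic[OF h(2)])
  show ?thesis using class_ker_iff[OF h(1)] lambda_val_sqcls[OF h(1)] of_int_bit_eq_0_iff by simp
qed

lemma positive_iff: "\<alpha> \<noteq> 0 \<Longrightarrow> sqcls \<alpha> \<in> positive_classes V \<longleftrightarrow> sqcls \<alpha> \<in> V \<and> \<alpha> > 0"
  unfolding positive_classes_def using sqcls_pos_iff by auto

lemma ker_T_iff:
  assumes pos: "b > 0" "a\<^sup>2 - 4 * b > 0" and \<beta>: "root_family a b d \<beta>" and \<alpha>: "\<alpha> \<noteq> 0"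
  shows "sqcls \<alpha> \<in> (\<Inter>q\<in>T_plus d \<beta>. class_ker (gamma_val q)) \<and>
      sqcls \<alpha> \<in> (\<Inter>q\<in>T_minus d \<beta>. class_ker (\<lambda>C. gamma_val q C + lambda_val q C)) \<longleftrightarrow>
    (\<forall>q\<in>S. padic.ptors q \<alpha> (of_int (a * D)) (of_int (b * D\<^sup>2)))"
proof -
  have sub: "T_plus d \<beta> \<subseteq> S" "T_minus d \<beta> \<subseteq> S" unfolding T_plus_def T_minus_def S_def by auto
  show ?thesis
    using twist_local_S_split[OF _ pos \<beta> \<alpha>] T_minus_iff[of _ \<beta>] sub class_ker_iff[OF \<alpha>] by (auto simp: subset_iff)
qed

lemma classes_eqI:
  assumes "A \<subseteq> carrier (square_classes rat_field)" "B \<subseteq> carrier (square_classes rat_field)"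
    and "\<And>\<alpha>. \<alpha> \<noteq> 0 \<Longrightarrow> sqcls \<alpha> \<in> A \<longleftrightarrow> sqcls \<alpha> \<in> B"
  shows "A = B"
proof (intro Set.set_eqI)
  fix C
  show "C \<in> A \<longleftrightarrow> C \<in> B"
  proof (cases "C \<in> carrier (square_classes rat_field)")
    case True
    then obtain \<alpha> where "\<alpha> \<noteq> 0" "C = sqcls \<alpha>" unfolding carrier_square_classes by blast
    then show ?thesis using assms(3) by simp
  next
    case False
    then show ?thesis using assms(1,2) by blast
  qed
qed

lemma selmer_subset_classes: "selmer a' b' \<subseteq> carrier (square_classes rat_field)"
  "relaxed_selmer d a' b' \<subseteq> carrier (square_classes rat_field)"
  "positive_classes (relaxed_selmer d a' b') \<subseteq> carrier (square_classes rat_field)"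
  "twist_selmer k a' b' \<subseteq> carrier (square_classes rat_field)"
  by (auto simp: selmer_def relaxed_selmer_def positive_classes_def twist_selmer_def)

lemma Inter_lambda_iff:
  "\<alpha> \<noteq> 0 \<Longrightarrow> sqcls \<alpha> \<in> (\<Inter>q\<in>prime_factors d. class_ker (lambda_val q)) \<longleftrightarrow> (\<forall>q\<in>S. even (padic_val q \<alpha>))"
  using ker_lambda_iff unfolding S_def[symmetric] by blast

end

theorem theorem4p2:
  fixes a b :: int and d :: nat
  assumes "discriminant (curve a b) \<noteq> 0"
    and "two_torsion_group rat_field (of_int a) (of_int b) \<cong> integer_mod_group 2"
    and "d \<in> twist_set (curve a b)"
  shows
    "(b < 0 \<longrightarrow>
        discriminant (curve a b) > 0 \<and>
        selmer a b = twist_selmer (- int d) a b) \<and>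
     (discriminant (curve a b) < 0 \<and> b > 0 \<longrightarrow>
        selmer a b = relaxed_selmer d a b \<inter> (\<Inter>q\<in>prime_factors d. class_ker (lambda_val q)) \<and>
        twist_selmer (- int d) a b = relaxed_selmer d a b) \<and>
     (discriminant (curve a b) > 0 \<and> b > 0 \<and> a < 0 \<longrightarrow>
        selmer a b = relaxed_selmer d a b \<inter> (\<Inter>q\<in>prime_factors d. class_ker (lambda_val q)) \<and>
        (\<forall>\<beta>. root_family a b d \<beta> \<longrightarrow>
          twist_selmer (- int d) a b =
            positive_classes (relaxed_selmer d a b)
            \<inter> (\<Inter>q\<in>T_plus d \<beta>. class_ker (gamma_val q))
            \<inter> (\<Inter>q\<in>T_minus d \<beta>. class_ker (\<lambda>C. gamma_val q C + lambda_val q C)))) \<and>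
     (discriminant (curve a b) > 0 \<and> b > 0 \<and> a > 0 \<longrightarrow>
        selmer a b =
          positive_classes (relaxed_selmer d a b)
          \<inter> (\<Inter>q\<in>prime_factors d. class_ker (lambda_val q)) \<and>
        (\<forall>\<beta>. root_family a b d \<beta> \<longrightarrow>
          twist_selmer (- int d) a b =
            relaxed_selmer d a b
            \<inter> (\<Inter>q\<in>T_plus d \<beta>. class_ker (gamma_val q))
            \<inter> (\<Inter>q\<in>T_minus d \<beta>. class_ker (\<lambda>C. gamma_val q C + lambda_val q C))))"
proof -
  have "16 * b\<^sup>2 * (a\<^sup>2 - 4 * b) \<noteq> 0" using assms(1) unfolding discriminant_curve of_int_eq_0_iff .
  then have nz: "b \<noteq> 0" "a\<^sup>2 - 4 * b \<noteq> 0" by auto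
  interpret admissible_twist a b d using nz assms(3) by unfold_locales
  have b2: "16 * b\<^sup>2 > 0" using nz by simp
  have disc: "discriminant (curve a b) > 0 \<longleftrightarrow> a\<^sup>2 - 4 * b > 0" "discriminant (curve a b) < 0 \<longleftrightarrow> a\<^sup>2 - 4 * b < 0"
    unfolding discriminant_curve of_int_0_less_iff of_int_less_0_iff
    using b2 by (auto simp: zero_less_mult_iff mult_less_0_iff)
  have case1: "selmer a b = twist_selmer (- int d) a b" if b: "b < 0"
  proof (rule classes_eqI[OF selmer_subset_classes(1) selmer_subset_classes(4)])
    fix \<alpha> :: rat assume \<alpha>: "\<alpha> \<noteq> 0"
    \<comment> \<open>This inclusion is global: it uses the sign of \<alpha> and its valuations at
      all primes outside 2 N_E. The reverse one is local at each q, by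
      \<open>twist_local_S_neg\<close>.\<close>
    have "padic.ptors q \<alpha> (of_int (a * D)) (of_int (b * D\<^sup>2))"
      if h: "\<alpha> > 0" "\<And>p. Factorial_Ring.prime p \<Longrightarrow> p \<notin> S \<Longrightarrow> padic.ptors p \<alpha> (of_int a) (of_int b)"
        "\<And>q. q \<in> S \<Longrightarrow> even (padic_val q \<alpha>)" and q: "q \<in> S" for q
    proof -
      interpret odd_padic q by (rule S_odd_padic[OF q])
      have "psq \<alpha>"
      proof (rule psq_S_of_even[OF q h(1)])
        fix p assume p: "Factorial_Ring.prime p" "p \<notin> Bad"
        show "even (padic_val p \<alpha>)" using h(2)[OF p(1)] h(3)[of p] good_local(1)[OF p \<alpha>] by blast
      qed
      then show ?thesis unfolding ptors_def by blast
    qed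
    then show "sqcls \<alpha> \<in> selmer a b \<longleftrightarrow> sqcls \<alpha> \<in> twist_selmer (- int d) a b"
      unfolding selmer_iff[OF \<alpha>] twist_selmer_iff[OF \<alpha>] using b twist_local_S_neg[OF _ b \<alpha>] by (meson less_asym)
  qed
  have case2: "selmer a b = relaxed_selmer d a b \<inter> (\<Inter>q\<in>prime_factors d. class_ker (lambda_val q))"
    "twist_selmer (- int d) a b = relaxed_selmer d a b" if h: "a\<^sup>2 - 4 * b < 0" "b > 0"
  proof -
    \<comment> \<open>So neither curve imposes a condition at the real place, whatever the sign of
      a.\<close>
    have le: "a\<^sup>2 \<le> 4 * b" using h by simp
    show "selmer a b = relaxed_selmer d a b \<inter> (\<Inter>q\<in>prime_factors d. class_ker (lambda_val q))"
    proof (rule classes_eqI[OF selmer_subset_classes(1) subset_trans[OF Int_lower1 selmer_subset_classes(2)]])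
      fix \<alpha> :: rat assume \<alpha>: "\<alpha> \<noteq> 0"
      show "sqcls \<alpha> \<in> selmer a b \<longleftrightarrow> sqcls \<alpha> \<in> relaxed_selmer d a b \<inter> (\<Inter>q\<in>prime_factors d. class_ker (lambda_val q))"
        unfolding Int_iff selmer_iff[OF \<alpha>] relaxed_selmer_iff[OF \<alpha>] Inter_lambda_iff[OF \<alpha>] using h le by blast
    qed
    show "twist_selmer (- int d) a b = relaxed_selmer d a b"
    proof (rule classes_eqI[OF selmer_subset_classes(4) selmer_subset_classes(2)])
      fix \<alpha> :: rat assume \<alpha>: "\<alpha> \<noteq> 0"
      show "sqcls \<alpha> \<in> twist_selmer (- int d) a b \<longleftrightarrow> sqcls \<alpha> \<in> relaxed_selmer d a b"
        unfolding twist_selmer_iff[OF \<alpha>] relaxed_selmer_iff[OF \<alpha>] using twist_local_S_all[OF _ h(2,1) \<alpha>] h le by blast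
    qed
  qed
  have case3: "selmer a b = relaxed_selmer d a b \<inter> (\<Inter>q\<in>prime_factors d. class_ker (lambda_val q))"
    "root_family a b d \<beta> \<Longrightarrow> twist_selmer (- int d) a b = positive_classes (relaxed_selmer d a b)
            \<inter> (\<Inter>q\<in>T_plus d \<beta>. class_ker (gamma_val q))
            \<inter> (\<Inter>q\<in>T_minus d \<beta>. class_ker (\<lambda>C. gamma_val q C + lambda_val q C))"
    if h: "a\<^sup>2 - 4 * b > 0" "b > 0" "a < 0" for \<beta>
  proof -
    show "selmer a b = relaxed_selmer d a b \<inter> (\<Inter>q\<in>prime_factors d. class_ker (lambda_val q))"
    proof (rule classes_eqI[OF selmer_subset_classes(1) subset_trans[OF Int_lower1 selmer_subset_classes(2)]])
      fix \<alpha> :: rat assume \<alpha>: "\<alpha> \<noteq> 0"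
      show "sqcls \<alpha> \<in> selmer a b \<longleftrightarrow> sqcls \<alpha> \<in> relaxed_selmer d a b \<inter> (\<Inter>q\<in>prime_factors d. class_ker (lambda_val q))"
        unfolding Int_iff selmer_iff[OF \<alpha>] relaxed_selmer_iff[OF \<alpha>] Inter_lambda_iff[OF \<alpha>] using h by auto
    qed
    assume \<beta>: "root_family a b d \<beta>"
    show "twist_selmer (- int d) a b = positive_classes (relaxed_selmer d a b)
            \<inter> (\<Inter>q\<in>T_plus d \<beta>. class_ker (gamma_val q))
            \<inter> (\<Inter>q\<in>T_minus d \<beta>. class_ker (\<lambda>C. gamma_val q C + lambda_val q C))"
    proof (rule classes_eqI[OF selmer_subset_classes(4) subset_trans[OF Int_lower1 subset_trans[OF Int_lower1 selmer_subset_classes(3)]]])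
      fix \<alpha> :: rat assume \<alpha>: "\<alpha> \<noteq> 0"
      \<comment> \<open>For a < 0 and a^2 > 4b the twist imposes positivity at the real place, while
        the original curve imposes nothing there.\<close>
      have "\<alpha> > 0 \<or> b > 0 \<and> (a \<ge> 0 \<or> a\<^sup>2 \<le> 4 * b) \<longleftrightarrow> \<alpha> > 0" using h by auto
      then show "sqcls \<alpha> \<in> twist_selmer (- int d) a b \<longleftrightarrow> sqcls \<alpha> \<in> positive_classes (relaxed_selmer d a b)
            \<inter> (\<Inter>q\<in>T_plus d \<beta>. class_ker (gamma_val q))
            \<inter> (\<Inter>q\<in>T_minus d \<beta>. class_ker (\<lambda>C. gamma_val q C + lambda_val q C))"
        unfolding Int_iff twist_selmer_iff[OF \<alpha>] positive_iff[OF \<alpha>] relaxed_selmer_iff[OF \<alpha>]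
        using ker_T_iff[OF h(2,1) \<beta> \<alpha>] by argo
    qed
  qed
  have case4: "selmer a b = positive_classes (relaxed_selmer d a b) \<inter> (\<Inter>q\<in>prime_factors d. class_ker (lambda_val q))"
    "root_family a b d \<beta> \<Longrightarrow> twist_selmer (- int d) a b = relaxed_selmer d a b
            \<inter> (\<Inter>q\<in>T_plus d \<beta>. class_ker (gamma_val q))
            \<inter> (\<Inter>q\<in>T_minus d \<beta>. class_ker (\<lambda>C. gamma_val q C + lambda_val q C))"
    if h: "a\<^sup>2 - 4 * b > 0" "b > 0" "a > 0" for \<beta>
  proof -
    show "selmer a b = positive_classes (relaxed_selmer d a b) \<inter> (\<Inter>q\<in>prime_factors d. class_ker (lambda_val q))"
    proof (rule classes_eqI[OF selmer_subset_classes(1) subset_trans[OF Int_lower1 selmer_subset_classes(3)]])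
      fix \<alpha> :: rat assume \<alpha>: "\<alpha> \<noteq> 0"
      show "sqcls \<alpha> \<in> selmer a b \<longleftrightarrow> sqcls \<alpha> \<in> positive_classes (relaxed_selmer d a b) \<inter> (\<Inter>q\<in>prime_factors d. class_ker (lambda_val q))"
        unfolding Int_iff selmer_iff[OF \<alpha>] positive_iff[OF \<alpha>] relaxed_selmer_iff[OF \<alpha>] Inter_lambda_iff[OF \<alpha>] using h by auto
    qed
    assume \<beta>: "root_family a b d \<beta>"
    show "twist_selmer (- int d) a b = relaxed_selmer d a b
            \<inter> (\<Inter>q\<in>T_plus d \<beta>. class_ker (gamma_val q))
            \<inter> (\<Inter>q\<in>T_minus d \<beta>. class_ker (\<lambda>C. gamma_val q C + lambda_val q C))"
    proof (rule classes_eqI[OF selmer_subset_classes(4) subset_trans[OF Int_lower1 subset_trans[OF Int_lower1 selmer_subset_classes(2)]]])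
      fix \<alpha> :: rat assume \<alpha>: "\<alpha> \<noteq> 0"
      have "\<alpha> > 0 \<or> b > 0 \<and> (a \<ge> 0 \<or> a\<^sup>2 \<le> 4 * b)" using h by auto
      then show "sqcls \<alpha> \<in> twist_selmer (- int d) a b \<longleftrightarrow> sqcls \<alpha> \<in> relaxed_selmer d a b
            \<inter> (\<Inter>q\<in>T_plus d \<beta>. class_ker (gamma_val q))
            \<inter> (\<Inter>q\<in>T_minus d \<beta>. class_ker (\<lambda>C. gamma_val q C + lambda_val q C))"
        unfolding Int_iff twist_selmer_iff[OF \<alpha>] relaxed_selmer_iff[OF \<alpha>]
        using ker_T_iff[OF h(2,1) \<beta> \<alpha>] by argo
    qed
  qed
  have disc1: "discriminant (curve a b) > 0" if "b < 0"
    unfolding disc using that zero_le_power2[of a] by linarith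
  show ?thesis unfolding disc
    by (intro conjI impI allI; (elim conjE)?)
      (rule disc1[unfolded disc] case1 case2 case3 case4; assumption)+
qed

end
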